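(* Let $n\ge3$, let $[Q^{\gets}]$ be a twisted adapted class of type $D_{n+1}$, and let $\alpha,\beta,\gamma\in\Phi^+$ have folded coordinates $\widehat\phi_{[Q^\gets]}(\alpha)=(\overline i,p)$, $\widehat\phi_{[Q^\gets]}(\beta)=(\overline j,q)$, $\widehat\phi_{[Q^\gets]}(\gamma)=(\overline k,r)$, with $\alpha+\beta=\gamma$. Then the pair $(\alpha,\beta)$ is a $[Q^\gets]$-minimal pair of $\gamma$ if and only if the following holds: $\ell:=\max(\overline i,\overline j,\overline k)\le n$, $s+m=\ell$ for $\{s,m\}:=\{\overline i,\overline j,\overline k\}\setminus\{\ell\}$, and $$(q-r,\;p-r)=\begin{cases}(-\overline i,\ \overline j) & \text{if }\ell=\overline k,\\ (\overline i-(2n+2),\ \overline j) & \text{if }\ell=\overline i,\\ (-\overline i,\ 2n+2-\overline j) & \text{if }\ell=\overline j.\end{cases}$$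
   Context: Type $D_{n+1}$: index set $I=\{1,\dots,n+1\}$, edges $i-(i+1)$ for $1\le i\le n-1$ together with $(n-1)-(n+1)$; $\alpha_i,s_i$ simple roots and reflections, $\Phi^+$ positive roots, $w_0$ the longest element of the Weyl group, $N=n(n+1)$. $\vee:I\to I$ exchanges $n,n+1$ and fixes other indices; orbits $\overline1,\dots,\overline n$ with $\overline n=\{n,n+1\}$, identified with the integers $1,\dots,n$ ($\{\overline i,\overline j,\overline k\}\setminus\{\ell\}$ is understood as a multiset, removing one occurrence of $\ell$). For words, $(j_1\cdots j_m)^{k\vee}$ means applying $\vee$ to each letter $k$ times; $\prod$ of words is concatenation; $[\mathbf j]$ is the commutation class. A twisted adapted class is a class $[Q^\gets]=[\mathbf i_0]$ with $\mathbf i_0=\prod_{k=0}^n(i_1\cdots i_n)^{k\vee}$, where $i_1,\dots,i_n$ contains exactly one index of each orbit (such words are reduced words of $w_0$). Folded coordinates: for $\mathbf j_0=j_1\cdots j_N$ reduced for $w_0$ put $\beta_k^{\mathbf j_0}=s_{j_1}\cdots s_{j_{k-1}}(\alpha_{j_k})$. Let $\xi:\{\overline1,\dots,\overline n\}\to\mathbb Z$ satisfy, for $1\le i\le n-1$, $\xi(\overline i)=\xi(\overline{i+1})+1$ if $\overline i$ occurs before $\overline{i+1}$ in $\overline{i_1},\dots,\overline{i_n}$, and $\xi(\overline i)=\xi(\overline{i+1})-1$ otherwise (unique up to a constant, which is fixed). Then $\widehat\phi_{[Q^\gets]}(\beta^{\mathbf i_0}_{kn+t})=(\overline{i_t},\xi(\overline{i_t})-2k)$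 for $0\le k\le n$, $1\le t\le n$. Minimal pairs: $\beta_k^{\mathbf j_0}<_{\mathbf j_0}\beta_l^{\mathbf j_0}$ iff $k<l$. A sequence is $\underline m\in\mathbb Z_{\ge0}^{\Phi^+}$, written $(m_1,\dots,m_N)$ with $m_k$ the entry at $\beta_k^{\mathbf j_0}$; $\mathrm{wt}(\underline m)=\sum m_k\beta_k^{\mathbf j_0}$; a root is identified with the sequence with a single entry $1$. A pair is a sequence with two entries equal to $1$ and the others $0$; by convention it is written $(\alpha,\beta)$ with $\alpha$ preceding $\beta$, $\alpha<_{\mathbf j_0}\beta$. $\underline m<^{\mathtt b}_{\mathbf j_0}\underline m'$ iff there are $1\le k\le s\le N$ with $m_t=m'_t$ for $t<k$ and $t>s$, $m_k<m'_k$, $m_s<m'_s$; $\underline m\prec^{\mathtt b}_{[\mathbf j_0]}\underline m'$ iff $\mathrm{wt}(\underline m)=\mathrm{wt}(\underline m')$ and $\underline m<^{\mathtt b}_{\mathbf j_0'}\underline m'$ for all $\mathbf j_0'\in[\mathbf j_0]$. A pair $(\alpha,\beta)$ is a $[\mathbf j_0]$-minimal pair of $\gamma\in\Phi^+$ if $\gamma\prec^{\mathtt b}_{[\mathbf j_0]}(\alpha,\beta)$ and no sequence $\underline m'$ satisfies $\gamma\prec^{\mathtt b}_{[\mathbf j_0]}\underline m'\prec^{\mathtt b}_{[\mathbf j_0]}(\alpha,\beta)$. *)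

theory Defs
  imports Main "HOL-Library.Function_Algebras" "HOL-Library.Multiset"
begin

text \<open>
  The root lattice of type \<open>D\<^sub>n\<^sub>+\<^sub>1\<close> is realised by functions \<open>nat \<Rightarrow> int\<close>: the value at \<open>i\<close> is the
  coefficient of the simple root \<open>\<alpha>\<^sub>i\<close>. Words are lists of indices; positions in words are
  counted from 1, as in \<open>j\<^sub>1 \<cdots> j\<^sub>N\<close>.
\<close>

definition index_set :: "nat \<Rightarrow> nat set" where
  "index_set n = {1..n + 1}"

definition adjacent :: "nat \<Rightarrow> nat \<Rightarrow> nat \<Rightarrow> bool" where
  "adjacent n a b \<longleftrightarrow> (\<exists>i\<in>{1..n - 1}. {a, b} = {i, i + 1}) \<or> {a, b} = {n - 1, n + 1}"

definition cartan :: "nat \<Rightarrow> nat \<Rightarrow> nat \<Rightarrow> int" where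
  "cartan n i j = (if i = j then 2 else if adjacent n i j then - 1 else 0)"

definition simple_root :: "nat \<Rightarrow> nat \<Rightarrow> int" where
  "simple_root i = (\<lambda>j. if j = i then 1 else 0)"

definition simple_reflection :: "nat \<Rightarrow> nat \<Rightarrow> (nat \<Rightarrow> int) \<Rightarrow> (nat \<Rightarrow> int)" where
  "simple_reflection n i v =
     (\<lambda>j. v j - (\<Sum>l\<in>index_set n. cartan n i l * v l) * simple_root i j)"

definition roots :: "nat \<Rightarrow> (nat \<Rightarrow> int) set" where
  "roots n = {foldr (simple_reflection n) u (simple_root i) |u i.
                set u \<subseteq> index_set n \<and> i \<in> index_set n}"

definition positive_roots :: "nat \<Rightarrow> (nat \<Rightarrow> int) set" where
  "positive_roots n = {\<beta> \<in> roots n. \<forall>i. 0 \<le> \<beta> i}"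

inductive commutation_step :: "nat \<Rightarrow> nat list \<Rightarrow> nat list \<Rightarrow> bool" for n where
  "\<not> adjacent n a b \<Longrightarrow> commutation_step n (u @ [a, b] @ v) (u @ [b, a] @ v)"

definition commutation_class :: "nat \<Rightarrow> nat list \<Rightarrow> nat list set" where
  "commutation_class n js = {js'. (commutation_step n)\<^sup>*\<^sup>* js js'}"

definition vee :: "nat \<Rightarrow> nat \<Rightarrow> nat" where
  "vee n i = (if i = n then n + 1 else if i = n + 1 then n else i)"

text \<open>The \<open>\<or>\<close>-orbit of an index, identified with an element of \<open>{1..n}\<close>.\<close>

definition orbit :: "nat \<Rightarrow> nat \<Rightarrow> nat" where
  "orbit n i = (if i = n + 1 then n else i)"

definition orbit_transversal :: "nat \<Rightarrow> nat list \<Rightarrow> bool" where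
  "orbit_transversal n w \<longleftrightarrow>
     set w \<subseteq> index_set n \<and> (\<forall>c\<in>{1..n}. \<exists>!t. t < length w \<and> orbit n (w ! t) = c)"

text \<open>
  The twisted adapted classes are the classes \<open>commutation_class n (twisted_word n w)\<close> for
  \<open>w\<close> satisfying \<open>orbit_transversal n w\<close>.
\<close>

definition twisted_word :: "nat \<Rightarrow> nat list \<Rightarrow> nat list" where
  "twisted_word n w = concat (map (\<lambda>k. map (vee n ^^ k) w) [0..<n + 1])"

text \<open>\<open>root_at n js k = s\<^sub>j\<^sub>1 \<cdots> s\<^sub>j\<^sub>k\<^sub>-\<^sub>1 (\<alpha>\<^sub>j\<^sub>k)\<close>, for \<open>k \<in> {1..length js}\<close>.\<close>

definition root_at :: "nat \<Rightarrow> nat list \<Rightarrow> nat \<Rightarrow> (nat \<Rightarrow> int)" where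
  "root_at n js k =
     foldr (simple_reflection n) (take (k - 1) js) (simple_root (js ! (k - 1)))"

definition occurs_before :: "'a \<Rightarrow> 'a \<Rightarrow> 'a list \<Rightarrow> bool" where
  "occurs_before x y xs \<longleftrightarrow> (\<exists>a b. a < b \<and> b < length xs \<and> xs ! a = x \<and> xs ! b = y)"

definition height_function :: "nat \<Rightarrow> nat list \<Rightarrow> (nat \<Rightarrow> int) \<Rightarrow> bool" where
  "height_function n w \<xi> \<longleftrightarrow>
     (\<forall>i\<in>{1..n - 1}. \<xi> i =
        (if occurs_before i (i + 1) (map (orbit n) w) then \<xi> (i + 1) + 1 else \<xi> (i + 1) - 1))"

definition folded_coordinates ::
    "nat \<Rightarrow> nat list \<Rightarrow> (nat \<Rightarrow> int) \<Rightarrow> (nat \<Rightarrow> int) \<Rightarrow> nat \<times> int" where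
  "folded_coordinates n w \<xi> \<beta> =
     (THE c. \<exists>k\<in>{0..n}. \<exists>t\<in>{1..n}.
        \<beta> = root_at n (twisted_word n w) (k * n + t) \<and>
        c = (orbit n (w ! (t - 1)), \<xi> (orbit n (w ! (t - 1))) - 2 * int k))"

definition precedes :: "nat \<Rightarrow> nat list \<Rightarrow> (nat \<Rightarrow> int) \<Rightarrow> (nat \<Rightarrow> int) \<Rightarrow> bool" where
  "precedes n js \<alpha> \<beta> \<longleftrightarrow>
     (\<exists>k l. 1 \<le> k \<and> k < l \<and> l \<le> length js \<and> \<alpha> = root_at n js k \<and> \<beta> = root_at n js l)"

definition is_sequence :: "nat \<Rightarrow> ((nat \<Rightarrow> int) \<Rightarrow> nat) \<Rightarrow> bool" where
  "is_sequence n m \<longleftrightarrow> (\<forall>\<beta>. \<beta> \<notin> positive_roots n \<longrightarrow> m \<beta> = 0)"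

definition root_sequence :: "(nat \<Rightarrow> int) \<Rightarrow> (nat \<Rightarrow> int) \<Rightarrow> nat" where
  "root_sequence \<gamma> = (\<lambda>\<delta>. if \<delta> = \<gamma> then 1 else 0)"

definition pair_sequence :: "(nat \<Rightarrow> int) \<Rightarrow> (nat \<Rightarrow> int) \<Rightarrow> (nat \<Rightarrow> int) \<Rightarrow> nat" where
  "pair_sequence \<alpha> \<beta> = (\<lambda>\<delta>. if \<delta> = \<alpha> \<or> \<delta> = \<beta> then 1 else 0)"

definition wt :: "nat \<Rightarrow> nat list \<Rightarrow> ((nat \<Rightarrow> int) \<Rightarrow> nat) \<Rightarrow> (nat \<Rightarrow> int)" where
  "wt n js m = (\<lambda>i. \<Sum>k = 1..length js. int (m (root_at n js k)) * root_at n js k i)"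

definition bilex_less ::
    "nat \<Rightarrow> nat list \<Rightarrow> ((nat \<Rightarrow> int) \<Rightarrow> nat) \<Rightarrow> ((nat \<Rightarrow> int) \<Rightarrow> nat) \<Rightarrow> bool" where
  "bilex_less n js m m' \<longleftrightarrow>
     (\<exists>k s. 1 \<le> k \<and> k \<le> s \<and> s \<le> length js \<and>
        (\<forall>t\<in>{1..length js}. t < k \<or> s < t \<longrightarrow> m (root_at n js t) = m' (root_at n js t)) \<and>
        m (root_at n js k) < m' (root_at n js k) \<and>
        m (root_at n js s) < m' (root_at n js s))"

definition class_prec ::
    "nat \<Rightarrow> nat list \<Rightarrow> ((nat \<Rightarrow> int) \<Rightarrow> nat) \<Rightarrow> ((nat \<Rightarrow> int) \<Rightarrow> nat) \<Rightarrow> bool" where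
  "class_prec n js m m' \<longleftrightarrow>
     wt n js m = wt n js m' \<and> (\<forall>js'\<in>commutation_class n js. bilex_less n js' m m')"

text \<open>
  A pair is written with its smaller root first, so \<open>(\<alpha>, \<beta>)\<close> being a pair includes
  \<open>precedes n js \<alpha> \<beta>\<close>.
\<close>

definition minimal_pair ::
    "nat \<Rightarrow> nat list \<Rightarrow> (nat \<Rightarrow> int) \<Rightarrow> (nat \<Rightarrow> int) \<Rightarrow> (nat \<Rightarrow> int) \<Rightarrow> bool" where
  "minimal_pair n js \<alpha> \<beta> \<gamma> \<longleftrightarrow>
     precedes n js \<alpha> \<beta> \<and>
     class_prec n js (root_sequence \<gamma>) (pair_sequence \<alpha> \<beta>) \<and>
     \<not> (\<exists>m. is_sequence n m \<and> class_prec n js (root_sequence \<gamma>) m \<and>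
            class_prec n js m (pair_sequence \<alpha> \<beta>))"

end

theory Submission
  imports Defs
begin

text \<open>
  Write \<open>h = n + 1\<close>. In orthonormal coordinates the roots of type \<open>D\<^sub>n\<^sub>+\<^sub>1\<close> are the vectors
  \<open>\<epsilon>\<^sub>s - \<epsilon>\<^sub>t\<close>, where \<open>s\<close> and \<open>t\<close> are signed indices with \<open>\<bar>s\<bar> \<noteq> \<bar>t\<bar>\<close> and \<open>\<epsilon>\<^sub>-\<^sub>s = - \<epsilon>\<^sub>s\<close>. The twisted Coxeter
  element \<open>s\<^sub>i\<^sub>1 \<cdots> s\<^sub>i\<^sub>n \<or>\<close> permutes the \<open>2h\<close> signed indices in one cycle, and its \<open>h\<close>-th power
  is \<open>-1\<close>. So the signed indices can be listed as \<open>label x\<close>, with \<open>x\<close> an integer modulo \<open>2h\<close> and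
  \<open>label (x + h) = - label x\<close>, and every root is \<open>\<epsilon>\<close> of \<open>label x\<close> minus \<open>\<epsilon>\<close> of \<open>label y\<close>
  for some \<open>x < y \<le> x + n\<close>. A block of the twisted word shifts both labels by one, and the root with
  folded coordinates \<open>(i, p)\<close> has \<open>y - x = i\<close> and \<open>x + y = const - p\<close>. The order of the roots in
  the word then refines the product order on the pairs \<open>(x, y)\<close>, and two occurrences of letters that do
  not commute always have comparable pairs.

  An equation \<open>\<alpha> + \<beta> = \<gamma>\<close> forces a cancellation of one label of \<open>\<alpha>\<close> against one of \<open>\<beta>\<close>. Up to
  exchanging \<open>\<alpha>\<close> and \<open>\<beta>\<close>, this leaves four configurations (\<open>sum_of_roots_triple\<close>). Three of them,
  the tight ones, are the three cases of the coordinate formula. In the fourth, the loose one, the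
  three orbits add up to \<open>2h\<close>.

  In the loose configuration \<open>\<gamma> = (x, y)\<close>, \<open>\<alpha> = (y - h, z)\<close> and \<open>\<beta> = (z, x + h)\<close> with
  \<open>x < z < y\<close>, and the pair formed by \<open>(x, z)\<close> and \<open>(z, y)\<close> lies strictly between \<open>\<gamma>\<close> and
  \<open>(\<alpha>, \<beta>)\<close>. This only needs the order of pairs of non-orthogonal roots, and such an order is
  the same in all words of a commutation class (\<open>commutation_class_root_list\<close>).

  In all configurations \<open>\<gamma>\<close> has inner product 1 with \<open>\<alpha>\<close> and with \<open>\<beta>\<close>. By the same invariance it lies
  between them in every word of the class, so that \<open>\<gamma>\<close> is always below the pair.

  In a tight configuration let \<open>m\<close> lie strictly below \<open>(\<alpha>, \<beta>)\<close> with weight \<open>\<gamma>\<close>. The class contains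
  the words that sort the roots by \<open>x\<close> and by \<open>y\<close> (\<open>sorted_word_in_class\<close>). In each of them
  \<open>m\<close> is supported strictly between \<open>\<alpha>\<close> and \<open>\<beta>\<close>, so its support lies in a rectangle in the
  \<open>(x, y)\<close>-plane, with the corners \<open>\<alpha>\<close> and \<open>\<beta>\<close> removed (\<open>support_in_box\<close>). There is an antiperiodic
  function \<open>f\<close> of the labels such that \<open>f x - f y\<close> is positive at all roots of this region except \<open>\<gamma>\<close>,
  where it vanishes (\<open>separating_functional\<close>). As \<open>f\<close> induces a linear functional,
  \<open>m\<close> must be \<open>\<gamma>\<close> itself, and the pair is minimal.
\<close>

section \<open>Roots in orthonormal coordinates\<close>

text \<open>
  The inner product of the coordinate vectors of two nonzero signed indices.
\<close>

definition signed_delta :: "int \<Rightarrow> int \<Rightarrow> int" where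
  "signed_delta s t = (if s = t then 1 else if s = - t then - 1 else 0)"

text \<open>
  The coordinate vector of a signed index: minus the vector of \<open>\<bar>s\<bar>\<close> if \<open>s\<close> is negative.
\<close>

definition eps :: "int \<Rightarrow> nat \<Rightarrow> int" where
  "eps s a = signed_delta s (int a)"

text \<open>
  The coordinates with respect to the orthonormal basis \<open>\<epsilon>\<^sub>1, \<dots>, \<epsilon>\<^sub>n\<^sub>+\<^sub>1\<close> in which
  \<open>\<alpha>\<^sub>a = \<epsilon>\<^sub>a - \<epsilon>\<^sub>a\<^sub>+\<^sub>1\<close> for \<open>a \<le> n\<close> and \<open>\<alpha>\<^sub>n\<^sub>+\<^sub>1 = \<epsilon>\<^sub>n + \<epsilon>\<^sub>n\<^sub>+\<^sub>1\<close>.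
\<close>

definition ecoord :: "nat \<Rightarrow> (nat \<Rightarrow> int) \<Rightarrow> nat \<Rightarrow> int" where
  "ecoord n v a =
     (if a = 1 then v 1 else if a < n then v a - v (a - 1)
      else if a = n then v n + v (n + 1) - v (n - 1)
      else if a = n + 1 then v (n + 1) - v n else 0)"

text \<open>
  The simple root \<open>\<alpha>\<^sub>i\<close> is the difference of the vectors of its head and its tail index; for
  \<open>i = n + 1\<close> the tail is the signed index \<open>- (n + 1)\<close>.
\<close>

definition head_index :: "nat \<Rightarrow> nat \<Rightarrow> int" where
  "head_index n i = int (orbit n i)"

definition tail_index :: "nat \<Rightarrow> nat \<Rightarrow> int" where
  "tail_index n i = (if i = n + 1 then - int (n + 1) else int i + 1)"

definition signed_refl :: "nat \<Rightarrow> nat \<Rightarrow> int \<Rightarrow> int" where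
  "signed_refl n i s =
     (if s = head_index n i then tail_index n i
      else if s = tail_index n i then head_index n i
      else if s = - head_index n i then - tail_index n i
      else if s = - tail_index n i then - head_index n i else s)"

definition coroot :: "nat \<Rightarrow> nat \<Rightarrow> (nat \<Rightarrow> int) \<Rightarrow> int" where
  "coroot n i v = (\<Sum>l\<in>index_set n. cartan n i l * v l)"

lemma simple_reflection_eq: "simple_reflection n i v = (\<lambda>j. v j - coroot n i v * simple_root i j)"
  by (simp add: simple_reflection_def coroot_def)

lemma coroot_minus: "coroot n i (\<lambda>j. v j - c * v' j) = coroot n i v - c * coroot n i v'"
  unfolding coroot_def by (simp add: algebra_simps sum_subtractf sum_distrib_left)

lemma adjacent_iff:
  assumes "n \<ge> 3" "i \<in> index_set n" "l \<in> index_set n"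
  shows "adjacent n i l \<longleftrightarrow>
    (i = l + 1 \<and> i \<le> n) \<or> (l = i + 1 \<and> l \<le> n) \<or>
    (i = n - 1 \<and> l = n + 1) \<or> (l = n - 1 \<and> i = n + 1)"
  using assms unfolding adjacent_def index_set_def
  by (auto simp: doubleton_eq_iff)

lemma coroot_neighbours:
  assumes n: "n \<ge> 3" and i: "i \<in> index_set n"
  shows "coroot n i v = 2 * v i - sum v {l \<in> index_set n. adjacent n i l}"
proof -
  have fin: "finite (index_set n)" by (simp add: index_set_def)
  have "\<not> adjacent n i i" using n adjacent_iff[OF n i i] by auto
  then have "cartan n i l * v l = (if l = i then 2 * v l else 0) - (if adjacent n i l then v l else 0)" for l
    by (auto simp: cartan_def)
  then have "coroot n i v = (\<Sum>l\<in>index_set n. (if l = i then 2 * v l else 0))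
      - (\<Sum>l\<in>index_set n. (if adjacent n i l then v l else 0))"
    by (simp add: coroot_def sum_subtractf)
  then show ?thesis using i fin by (simp add: sum.inter_filter)
qed

text \<open>
  The simple roots in these coordinates have the Gram matrix given by the Cartan matrix, so pairing a
  vector with a simple root combines the two coordinates at which the simple root is nonzero.
\<close>

lemma coroot_eq:
  assumes n: "n \<ge> 3" and i: "i \<in> index_set n"
  shows "coroot n i v =
    (if i = n + 1 then ecoord n v n + ecoord n v (n + 1)
     else ecoord n v i - ecoord n v (i + 1))"
proof -
  let ?N = "{l \<in> index_set n. adjacent n i l}"
  have N: "?N = {l. l \<in> index_set n \<and> ((i = l + 1 \<and> i \<le> n) \<or> (l = i + 1 \<and> l \<le> n) \<or>
      (i = n - 1 \<and> l = n + 1) \<or> (l = n - 1 \<and> i = n + 1))}"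
    using adjacent_iff[OF n i] by blast
  consider "i = n + 1" | "i = n" | "i = n - 1" | "i = 1" | "1 < i" "i < n - 1"
    using i n unfolding index_set_def by force
  then show ?thesis
  proof cases
    case 1
    then have "?N = {n - 1}" unfolding N unfolding index_set_def using n by auto
    then show ?thesis using 1 n unfolding coroot_neighbours[OF n i] by (simp add: ecoord_def)
  next
    case 2
    then have "?N = {n - 1}" unfolding N unfolding index_set_def using n by auto
    then show ?thesis using 2 n unfolding coroot_neighbours[OF n i] by (simp add: ecoord_def)
  next
    case 3
    then have "?N = {n - 2, n, n + 1}" unfolding N unfolding index_set_def using n by auto
    moreover have "n - 2 \<noteq> n" "n - 2 \<noteq> n + 1" using n by auto
    then have "sum v {n - 2, n, n + 1} = v (n - 2) + v n + v (n + 1)" by simp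
    moreover have "n - 1 - 1 = n - 2" "n - 1 + 1 = n" "n - 1 \<noteq> 1" "n - 1 \<noteq> n + 1" using n by auto
    ultimately show ?thesis using 3 n unfolding coroot_neighbours[OF n i] by (simp add: ecoord_def)
  next
    case 4
    then have "?N = {2}" unfolding N unfolding index_set_def using n by auto
    then show ?thesis using 4 n unfolding coroot_neighbours[OF n i] by (simp add: ecoord_def numeral_2_eq_2)
  next
    case 5
    then have "?N = {i - 1, i + 1}" unfolding N unfolding index_set_def using n by auto
    moreover have "i \<noteq> 1" "i < n" "i + 1 < n" "i \<noteq> n + 1" "i + 1 \<noteq> 1" using 5 by auto
    ultimately show ?thesis using n unfolding coroot_neighbours[OF n i] by (simp add: ecoord_def)
  qed
qed

lemma head_tail_index:
  assumes n: "n \<ge> 3" and i: "i \<in> index_set n"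
  shows "1 \<le> head_index n i" "head_index n i \<le> int n" "1 \<le> \<bar>tail_index n i\<bar>"
    "\<bar>tail_index n i\<bar> \<le> int n + 1" "\<bar>head_index n i\<bar> < \<bar>tail_index n i\<bar>"
  using assms by (auto simp: head_index_def tail_index_def index_set_def orbit_def)

lemma ecoord_simple_root:
  assumes n: "n \<ge> 3" and i: "i \<in> index_set n"
  shows "ecoord n (simple_root i) = (\<lambda>a. eps (head_index n i) a - eps (tail_index n i) a)"
proof
  fix a
  consider "i = n + 1" | "i = n" | "1 \<le> i" "i < n" using i by (fastforce simp: index_set_def)
  then show "ecoord n (simple_root i) a = eps (head_index n i) a - eps (tail_index n i) a"
  proof cases
    case 1
    then show ?thesis using n
      by (cases "a = n"; cases "a = n + 1"; cases "a = 1"; cases "a < n")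
        (simp_all add: ecoord_def simple_root_def eps_def signed_delta_def head_index_def tail_index_def orbit_def)
  next
    case 2
    then show ?thesis using n
      by (cases "a = n"; cases "a = n + 1"; cases "a = 1"; cases "a < n")
        (simp_all add: ecoord_def simple_root_def eps_def signed_delta_def head_index_def tail_index_def orbit_def)
  next
    case 3
    then have "eps (head_index n i) a - eps (tail_index n i) a =
        (if a = i then 1 else if a = i + 1 then - 1 else 0)"
      by (auto simp: eps_def signed_delta_def head_index_def tail_index_def orbit_def)
    moreover have "ecoord n (simple_root i) a = (if a = i then 1 else if a = i + 1 then - 1 else 0)"
      using 3 n by (cases "a = i"; cases "a = i + 1"; cases "a = 1"; cases "a < n"; cases "a = n"; cases "a = n + 1")
        (auto simp: ecoord_def simple_root_def)
    ultimately show ?thesis by simp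
  qed
qed

lemma ecoord_minus: "ecoord n (\<lambda>j. v j - c * v' j) = (\<lambda>a. ecoord n v a - c * ecoord n v' a)"
  by (auto simp: fun_eq_iff ecoord_def algebra_simps)

lemma ecoord_add: "ecoord n (v + v') = (\<lambda>a. ecoord n v a + ecoord n v' a)"
  by (auto simp: fun_eq_iff ecoord_def algebra_simps)

lemma eps_signed_refl:
  assumes n: "n \<ge> 3" and i: "i \<in> index_set n" and s: "s \<noteq> 0"
  shows "eps (signed_refl n i s) a = eps s a -
    (signed_delta s (head_index n i) - signed_delta s (tail_index n i)) * (eps (head_index n i) a - eps (tail_index n i) a)"
proof -
  define H T where HT: "H = head_index n i" "T = tail_index n i"
  have ne: "H \<noteq> 0" "T \<noteq> 0" "H \<noteq> T" "H \<noteq> - T" using head_tail_index[OF n i] unfolding HT by auto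
  have m: "signed_delta (- z) x = - signed_delta z x" if "z \<noteq> 0" for z x using that by (auto simp: signed_delta_def)
  have k: "signed_delta H H = 1" "signed_delta T T = 1" "signed_delta H T = 0" "signed_delta T H = 0" using ne by (auto simp: signed_delta_def)
  consider "s = H" | "s = T" | "s = - H" | "s = - T" | "s \<notin> {H, T, - H, - T}" by auto
  then have "signed_delta (signed_refl n i s) x = signed_delta s x - (signed_delta s H - signed_delta s T) * (signed_delta H x - signed_delta T x)" for x
  proof cases
    case 5
    then have "signed_delta s H = 0" "signed_delta s T = 0" unfolding signed_delta_def by simp_all
    then show ?thesis using 5 by (simp add: signed_refl_def HT[symmetric])
  qed (use ne in \<open>simp_all add: signed_refl_def HT[symmetric] m k\<close>)
  then show ?thesis by (simp add: eps_def HT)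
qed

text \<open>
  Roots are compared through their orthonormal coordinates. Those coordinates determine a vector of
  the root lattice only together with the condition that it is supported on the index set.
\<close>

definition is_diff :: "nat \<Rightarrow> (nat \<Rightarrow> int) \<Rightarrow> int \<Rightarrow> int \<Rightarrow> bool" where
  "is_diff n v s t \<longleftrightarrow> (\<forall>j. j \<notin> index_set n \<longrightarrow> v j = 0) \<and>
     ecoord n v = (\<lambda>a. eps s a - eps t a) \<and>
     1 \<le> \<bar>s\<bar> \<and> \<bar>s\<bar> \<le> int n + 1 \<and> 1 \<le> \<bar>t\<bar> \<and> \<bar>t\<bar> \<le> int n + 1 \<and> \<bar>s\<bar> \<noteq> \<bar>t\<bar>"

lemma signed_refl_minus: "n \<ge> 3 \<Longrightarrow> i \<in> index_set n \<Longrightarrow> signed_refl n i (- s) = - signed_refl n i s"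
  by (auto simp: signed_refl_def head_index_def tail_index_def orbit_def index_set_def)

lemma signed_refl_invol: "n \<ge> 3 \<Longrightarrow> i \<in> index_set n \<Longrightarrow> signed_refl n i (signed_refl n i s) = s"
  by (auto simp: signed_refl_def head_index_def tail_index_def orbit_def index_set_def)

lemma abs_signed_refl: "n \<ge> 3 \<Longrightarrow> i \<in> index_set n \<Longrightarrow>
   1 \<le> \<bar>s\<bar> \<Longrightarrow> \<bar>s\<bar> \<le> int n + 1 \<Longrightarrow> 1 \<le> \<bar>signed_refl n i s\<bar> \<and> \<bar>signed_refl n i s\<bar> \<le> int n + 1"
  by (auto simp: signed_refl_def head_index_def tail_index_def orbit_def index_set_def)

lemma is_diff_simple_root:
  assumes n: "n \<ge> 3" and i: "i \<in> index_set n"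
  shows "is_diff n (simple_root i) (head_index n i) (tail_index n i)"
  using assms ecoord_simple_root[OF assms]
  by (auto simp: is_diff_def simple_root_def head_index_def tail_index_def orbit_def index_set_def)

lemma is_diff_simple_reflection:
  assumes n: "n \<ge> 3" and i: "i \<in> index_set n" and d: "is_diff n v s t"
  shows "is_diff n (simple_reflection n i v) (signed_refl n i s) (signed_refl n i t)"
proof -
  have st: "s \<noteq> 0" "t \<noteq> 0" using d by (auto simp: is_diff_def)
  have e: "ecoord n v = (\<lambda>a. eps s a - eps t a)" using d by (simp add: is_diff_def)
  have c: "coroot n i v = signed_delta s (head_index n i) - signed_delta s (tail_index n i)
       - (signed_delta t (head_index n i) - signed_delta t (tail_index n i))"
    unfolding coroot_eq[OF n i] e using n i
    by (auto simp: eps_def head_index_def tail_index_def index_set_def orbit_def signed_delta_def)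
  have "ecoord n (simple_reflection n i v) = (\<lambda>a. eps (signed_refl n i s) a - eps (signed_refl n i t) a)"
    unfolding simple_reflection_eq ecoord_minus e ecoord_simple_root[OF n i] c
      eps_signed_refl[OF n i st(1)] eps_signed_refl[OF n i st(2)]
    by (simp add: algebra_simps)
  moreover have "\<forall>j. j \<notin> index_set n \<longrightarrow> simple_reflection n i v j = 0"
    using d i by (auto simp: is_diff_def simple_reflection_def simple_root_def)
  moreover have "\<bar>signed_refl n i s\<bar> \<noteq> \<bar>signed_refl n i t\<bar>"
    using d signed_refl_invol[OF n i] signed_refl_minus[OF n i]
    by (metis abs_eq_iff is_diff_def)
  ultimately show ?thesis using d abs_signed_refl[OF n i] by (auto simp: is_diff_def)
qed

text \<open>
  The Weyl group acts on roots through signed permutations of their two indices. All later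
  computations with roots are therefore computations with integers.
\<close>

lemma is_diff_word:
  assumes n: "n \<ge> 3" and js: "set js \<subseteq> index_set n" and i: "i \<in> index_set n"
  shows "is_diff n (foldr (simple_reflection n) js (simple_root i))
     (foldr (signed_refl n) js (head_index n i)) (foldr (signed_refl n) js (tail_index n i))"
  using js
  by (induction js) (auto intro: is_diff_simple_root is_diff_simple_reflection n i)

text \<open>
  The partial sums of the coordinates recover the coefficients of the simple roots, except at the two
  ends of the fork, where the sum and the difference of the coefficients are recovered.
\<close>

lemma is_diff_inj:
  assumes n: "n \<ge> 3" and "is_diff n v s t" "is_diff n v' s t"
  shows "v = v'"
proof
  fix j
  have e: "ecoord n v a = ecoord n v' a" for a using assms by (simp add: is_diff_def)
  have low: "j \<le> n - 1 \<Longrightarrow> v j = v' j" for j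
  proof (induction j)
    case 0 show ?case using assms by (auto simp: is_diff_def index_set_def)
  next
    case (Suc j)
    have "Suc j < n" using Suc n by simp
    then show ?case using e[of "Suc j"] Suc n by (cases "j = 0") (auto simp: ecoord_def)
  qed
  have "v n + v (n + 1) = v' n + v' (n + 1)" "v (n + 1) - v n = v' (n + 1) - v' n"
    using e[of n] e[of "n+1"] low[of "n - 1"] n by (auto simp: ecoord_def)
  then have hi: "v n = v' n" "v (n + 1) = v' (n + 1)" by linarith+
  have "j > n + 1 \<Longrightarrow> v j = 0 \<and> v' j = 0"
    using assms(2,3) by (auto simp: is_diff_def index_set_def)
  moreover consider "j \<le> n - 1" | "j = n" | "j = n + 1" | "j > n + 1" by linarith
  ultimately show "v j = v' j" using low hi by (metis One_nat_def)
qed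

section \<open>Positivity and the inner product\<close>

text \<open>
  The criterion for a root \<open>\<epsilon>\<^sub>s - \<epsilon>\<^sub>t\<close> to be positive: the index of smaller absolute value has to occur with
  a plus sign. The sign at index \<open>n + 1\<close> is then irrelevant, which makes the criterion stable under \<open>\<or>\<close>.
\<close>

definition positive_diff :: "int \<Rightarrow> int \<Rightarrow> bool" where
  "positive_diff s t \<longleftrightarrow> (\<bar>s\<bar> < \<bar>t\<bar> \<and> 0 < s) \<or> (\<bar>t\<bar> < \<bar>s\<bar> \<and> t < 0)"

lemma sum_signed_delta: "(\<Sum>b = 1..j. signed_delta s (int b)) =
    (if 1 \<le> \<bar>s\<bar> \<and> \<bar>s\<bar> \<le> int j then sgn s else 0)"
proof (induction j)
  case 0 show ?case by simp
next
  case (Suc j)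
  then show ?case by (auto simp: signed_delta_def)
qed

text \<open>
  The coefficients below the fork are the partial sums of the coordinates. They are nonnegative since the
  first nonzero coordinate is positive and only two coordinates are nonzero.
\<close>

lemma positive_diff_nonneg:
  assumes n: "n \<ge> 3" and d: "is_diff n v s t" and p: "positive_diff s t"
  shows "0 \<le> v j"
proof -
  have e: "ecoord n v a = eps s a - eps t a" for a using d by (simp add: is_diff_def)
  define S where "S m = (\<Sum>b = 1..m. eps s b - eps t b)" for m
  have S: "S m = (if \<bar>s\<bar> \<le> int m then sgn s else 0) - (if \<bar>t\<bar> \<le> int m then sgn t else 0)" for m
    using d unfolding S_def eps_def sum_subtractf sum_signed_delta by (simp add: is_diff_def)
  have Spos: "0 \<le> S m" for m
    using p unfolding S positive_diff_def by (auto simp: sgn_if)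
  have Suc: "S (Suc m) = S m + ecoord n v (Suc m)" for m by (simp add: S_def e)
  have low: "j \<le> n - 1 \<Longrightarrow> v j = S j" for j
  proof (induction j)
    case 0 show ?case using d by (auto simp: is_diff_def index_set_def S_def)
  next
    case (Suc j)
    have "Suc j < n" using Suc n by simp
    then show ?case using \<open>S (Suc j) = S j + ecoord n v (Suc j)\<close> Suc n
      by (cases "j = 0") (auto simp: ecoord_def S_def)
  qed
  have nn: "S n = v n + v (n + 1)"
    using Suc[of "n - 1"] low[of "n - 1"] n by (simp add: ecoord_def)
  have "S (n + 1) = S n + (v (n + 1) - v n)"
    using Suc[of n] n by (simp add: ecoord_def)
  then have a: "2 * v (n + 1) = S (n + 1)" using nn by linarith
  then have b: "2 * v n = 2 * S n - S (n + 1)" using nn by linarith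
  have "0 \<le> 2 * S n - S (n + 1)"
    using p d unfolding S positive_diff_def is_diff_def by (auto simp: sgn_if)
  then have "0 \<le> v n" "0 \<le> v (n + 1)" using a b Spos[of "n + 1"] by linarith+
  moreover have "j > n + 1 \<Longrightarrow> v j = 0" using d by (auto simp: is_diff_def index_set_def)
  moreover consider "j \<le> n - 1" | "j = n" | "j = n + 1" | "j > n + 1" by linarith
  ultimately show ?thesis using low Spos by (metis One_nat_def order_refl)
qed

text \<open>
  A simple reflection makes only its own simple root negative. The two alternatives are the two ways of
  writing that root as a difference.
\<close>

lemma positive_diff_signed_refl:
  assumes n: "n \<ge> 3" and i: "i \<in> index_set n" and p: "positive_diff s t"
    and q: "\<not> positive_diff (signed_refl n i s) (signed_refl n i t)"
    and r: "1 \<le> \<bar>s\<bar>" "\<bar>s\<bar> \<le> int n + 1" "1 \<le> \<bar>t\<bar>" "\<bar>t\<bar> \<le> int n + 1" "\<bar>s\<bar> \<noteq> \<bar>t\<bar>"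
  shows "(s = head_index n i \<and> t = tail_index n i) \<or> (s = - tail_index n i \<and> t = - head_index n i)"
proof (cases "i = n + 1")
  case True
  then have ht: "head_index n i = int n" "tail_index n i = - int n - 1"
    by (auto simp: head_index_def tail_index_def orbit_def)
  show ?thesis using p q r n unfolding signed_refl_def ht positive_diff_def
    by (smt (verit))
next
  case False
  then have ht: "head_index n i = int i" "tail_index n i = int i + 1" and i': "i \<ge> 1"
    using i by (auto simp: head_index_def tail_index_def orbit_def index_set_def)
  show ?thesis using p q r n i' unfolding signed_refl_def ht positive_diff_def
    by (smt (verit) of_nat_1 of_nat_mono)
qed

definition inner_form :: "nat \<Rightarrow> (nat \<Rightarrow> int) \<Rightarrow> (nat \<Rightarrow> int) \<Rightarrow> int" where
  "inner_form n v v' = (\<Sum>a = 1..n + 1. ecoord n v a * ecoord n v' a)"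

lemma inner_form_add_left: "inner_form n (v + v') x = inner_form n v x + inner_form n v' x"
  by (simp add: inner_form_def ecoord_add algebra_simps sum.distrib)

lemma inner_form_commute: "inner_form n v x = inner_form n x v"
  by (simp add: inner_form_def mult.commute)

lemma sum_eps_eps:
  assumes "1 \<le> \<bar>s\<bar>" "\<bar>s\<bar> \<le> int m" "t \<noteq> 0"
  shows "(\<Sum>a = 1..m. eps s a * eps t a) = signed_delta s t"
proof -
  have "(\<Sum>a = 1..m. eps s a * eps t a) = (\<Sum>a = 1..m. if a = nat \<bar>s\<bar> then signed_delta s t else 0)"
    using assms by (intro sum.cong) (auto simp: eps_def signed_delta_def)
  then show ?thesis using assms by auto
qed

lemma inner_form_diff:
  assumes d: "is_diff n v s t" "is_diff n v' s' t'"
  shows "inner_form n v v' = signed_delta s s' - signed_delta s t' - signed_delta t s' + signed_delta t t'"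
proof -
  have "inner_form n v v' = (\<Sum>a = 1..n+1. eps s a * eps s' a) - (\<Sum>a = 1..n+1. eps s a * eps t' a)
      - (\<Sum>a = 1..n+1. eps t a * eps s' a) + (\<Sum>a = 1..n+1. eps t a * eps t' a)"
    using d by (simp add: inner_form_def is_diff_def algebra_simps sum.distrib sum_subtractf)
  then show ?thesis using d by (subst (asm) (1 2 3 4) sum_eps_eps) (auto simp: is_diff_def)
qed

lemma inner_form_self: "is_diff n v s t \<Longrightarrow> inner_form n v v = 2"
  by (subst inner_form_diff) (auto simp: signed_delta_def is_diff_def)

text \<open>
  All roots have norm 2, so a root that is a sum of two roots has inner product 1 with each of them.
\<close>

lemma inner_form_sum:
  assumes "is_diff n v s t" "is_diff n v' s' t'" "is_diff n (v + v') s'' t''"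
  shows "inner_form n v (v + v') = 1" "inner_form n (v + v') v' = 1"
proof -
  have "inner_form n (v + v') (v + v') = 2" "inner_form n v v = 2" "inner_form n v' v' = 2"
    using assms inner_form_self by blast+
  then show "inner_form n v (v + v') = 1" "inner_form n (v + v') v' = 1"
    using inner_form_commute[of n v' v] inner_form_commute[of n v "v + v'"] inner_form_commute[of n v' "v + v'"]
    by (simp_all add: inner_form_add_left)
qed

lemma signed_delta_signed_refl:
  assumes n: "n \<ge> 3" and i: "i \<in> index_set n"
  shows "signed_delta (signed_refl n i s) (signed_refl n i t) = signed_delta s t"
proof -
  have "signed_refl n i s = signed_refl n i t \<longleftrightarrow> s = t"
    by (metis signed_refl_invol[OF assms])
  moreover have "signed_refl n i s = - signed_refl n i t \<longleftrightarrow> s = - t"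
    by (metis signed_refl_invol[OF assms] signed_refl_minus[OF assms])
  ultimately show ?thesis by (simp add: signed_delta_def)
qed

lemma signed_delta_word:
  assumes n: "n \<ge> 3" and js: "set js \<subseteq> index_set n"
  shows "signed_delta (foldr (signed_refl n) js s) (foldr (signed_refl n) js t) = signed_delta s t"
  using js by (induction js) (auto simp: signed_delta_signed_refl n)

text \<open>
  Two roots that a commutation move can exchange are orthogonal: they are the images of two
  orthogonal simple roots under one element of the Weyl group.
\<close>

lemma inner_form_word_nonadjacent:
  assumes n: "n \<ge> 3" and js: "set js \<subseteq> index_set n"
    and i: "i \<in> index_set n" and l: "l \<in> index_set n" and ne: "i \<noteq> l" and na: "\<not> adjacent n i l"
  shows "inner_form n (foldr (simple_reflection n) js (simple_root i))
     (foldr (simple_reflection n) js (simple_root l)) = 0"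
proof -
  have na': "\<not> (i = l + 1 \<and> i \<le> n)" "\<not> (l = i + 1 \<and> l \<le> n)"
      "\<not> (i = n - 1 \<and> l = n + 1)" "\<not> (l = n - 1 \<and> i = n + 1)"
    using na unfolding adjacent_iff[OF n i l] by auto
  have il: "1 \<le> i" "1 \<le> l" "i \<le> n + 1" "l \<le> n + 1" using i l by (auto simp: index_set_def)
  have ht: "head_index n a = int a \<and> tail_index n a = int a + 1" if "a \<le> n" for a
    using that by (simp add: head_index_def tail_index_def orbit_def)
  have ht1: "head_index n (Suc n) = int n" "tail_index n (Suc n) = - int n - 1"
    by (simp_all add: head_index_def tail_index_def orbit_def)
  consider "i \<le> n" "l \<le> n" | "i = n + 1" "l \<le> n" | "i \<le> n" "l = n + 1"
    using il ne by linarith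
  then have "signed_delta (head_index n i) (head_index n l) - signed_delta (head_index n i) (tail_index n l)
      - signed_delta (tail_index n i) (head_index n l) + signed_delta (tail_index n i) (tail_index n l) = 0"
  proof cases
    case 1
    then show ?thesis using na' ne il n by (simp add: ht signed_delta_def)
  next
    case 2
    show ?thesis
    proof (cases "l = n")
      case True
      then show ?thesis using 2 n by (simp add: ht ht1 signed_delta_def)
    next
      case False
      then show ?thesis using 2 n na' il by (simp add: ht ht1 signed_delta_def)
    qed
  next
    case 3
    show ?thesis
    proof (cases "i = n")
      case True
      then show ?thesis using 3 n by (simp add: ht ht1 signed_delta_def)
    next
      case False
      then show ?thesis using 3 n na' il by (simp add: ht ht1 signed_delta_def)
    qed
  qed
  then show ?thesis
    by (simp add: inner_form_diff[OF is_diff_word[OF n js i] is_diff_word[OF n js l]] signed_delta_word[OF n js])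
qed

section \<open>Root lists of words and commutation classes\<close>

definition root_list :: "nat \<Rightarrow> nat list \<Rightarrow> (nat \<Rightarrow> int) list" where
  "root_list n js = map (\<lambda>k. root_at n js (Suc k)) [0..<length js]"

lemma length_root_list [simp]: "length (root_list n js) = length js"
  by (simp add: root_list_def)

lemma nth_root_list: "k < length js \<Longrightarrow> root_list n js ! k = root_at n js (Suc k)"
  by (simp add: root_list_def)

lemma root_at_Suc: "root_at n js (Suc k) = foldr (simple_reflection n) (take k js) (simple_root (js ! k))"
  by (simp add: root_at_def)

lemma root_list_append:
  "root_list n (u @ v) = root_list n u @ map (foldr (simple_reflection n) u) (root_list n v)"
  by (rule nth_equalityI) (auto simp: nth_root_list nth_append root_at_Suc)

lemma simple_reflection_simple_root_nonadjacent:
  assumes "a \<noteq> b" "\<not> adjacent n a b"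
  shows "coroot n a (simple_root b) = 0"
proof -
  have "cartan n a l * simple_root b l = 0" for l
    using assms by (auto simp: cartan_def simple_root_def)
  then show ?thesis unfolding coroot_def by (intro sum.neutral) blast
qed

lemma adjacent_commute: "adjacent n a b \<longleftrightarrow> adjacent n b a"
  by (simp add: adjacent_def insert_commute)

lemma simple_reflection_commute:
  assumes "a \<noteq> b" "\<not> adjacent n a b"
  shows "simple_reflection n a (simple_reflection n b v) = simple_reflection n b (simple_reflection n a v)"
  unfolding simple_reflection_eq coroot_minus
  using simple_reflection_simple_root_nonadjacent[OF assms]
    simple_reflection_simple_root_nonadjacent[of b a n] assms adjacent_commute[of n a b]
  by (simp add: fun_eq_iff)

lemma root_list_pair:
  assumes "a \<noteq> b" "\<not> adjacent n a b"
  shows "root_list n [a, b] = [simple_root a, simple_root b]"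
  using simple_reflection_simple_root_nonadjacent[OF assms]
  by (simp add: root_list_def root_at_def simple_reflection_eq)

text \<open>
  Exchanging two commuting letters exchanges the two corresponding roots and keeps the others. The
  letters have to be distinct, since two equal neighbours give opposite roots.
\<close>

lemma root_list_swap:
  fixes u :: "nat list"
  assumes "a \<noteq> b" "\<not> adjacent n a b"
  defines "P \<equiv> foldr (simple_reflection n) u"
  shows "\<exists>R. root_list n (u @ [a, b] @ v) = root_list n u @ [P (simple_root a), P (simple_root b)] @ R \<and>
     root_list n (u @ [b, a] @ v) = root_list n u @ [P (simple_root b), P (simple_root a)] @ R"
proof -
  have ba: "b \<noteq> a" "\<not> adjacent n b a" using assms adjacent_commute by blast+
  show ?thesis
    unfolding root_list_append root_list_pair[OF assms(1,2)] root_list_pair[OF ba] P_def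
    by (simp add: simple_reflection_commute[OF assms(1,2)])
qed

text \<open>
  Commutation moves on words whose letters carry further data, here the roots. Allowing only the swaps
  that satisfy \<open>ok\<close> keeps the sorting argument free of words and roots.
\<close>

inductive labelled_swap :: "('a \<Rightarrow> 'a \<Rightarrow> bool) \<Rightarrow> 'a list \<Rightarrow> 'a list \<Rightarrow> bool" for ok where
  "ok p q \<Longrightarrow> labelled_swap ok (us @ [p, q] @ vs) (us @ [q, p] @ vs)"

lemma labelled_swap_Cons: "labelled_swap ok xs ys \<Longrightarrow> labelled_swap ok (x # xs) (x # ys)"
  by (induction rule: labelled_swap.induct) (metis append_Cons labelled_swap.intros)

lemma labelled_swaps_Cons:
  "(labelled_swap ok)\<^sup>*\<^sup>* xs ys \<Longrightarrow> (labelled_swap ok)\<^sup>*\<^sup>* (x # xs) (x # ys)"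
  by (induction rule: rtranclp_induct) (auto intro: rtranclp.rtrancl_into_rtrancl labelled_swap_Cons)

lemma labelled_swaps_insort:
  assumes "\<And>y. y \<in> set xs \<Longrightarrow> f y < f x \<Longrightarrow> ok x y"
  shows "(labelled_swap ok)\<^sup>*\<^sup>* (x # xs) (insort_key f x xs)"
  using assms
proof (induction xs)
  case (Cons y ys)
  show ?case
  proof (cases "f x \<le> f y")
    case False
    then have "labelled_swap ok (x # y # ys) (y # x # ys)"
      using labelled_swap.intros[of ok x y "[]" ys] Cons.prems[of y] by simp
    moreover have "(labelled_swap ok)\<^sup>*\<^sup>* (y # x # ys) (y # insort_key f x ys)"
      using Cons by (intro labelled_swaps_Cons) auto
    ultimately show ?thesis using False by (simp add: converse_rtranclp_into_rtranclp)
  qed simp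
qed simp

text \<open>
  Insertion sort only ever exchanges neighbours that were inverted in the original list, so it suffices
  that those may be exchanged. As it is stable, elements with equal keys are never exchanged.
\<close>

lemma labelled_swaps_sort:
  assumes "sorted_wrt (\<lambda>x y. f y < f x \<longrightarrow> ok x y) xs"
  shows "(labelled_swap ok)\<^sup>*\<^sup>* xs (sort_key f xs)"
  using assms
proof (induction xs)
  case (Cons x xs)
  have "(labelled_swap ok)\<^sup>*\<^sup>* (x # xs) (x # sort_key f xs)"
    using Cons by (intro labelled_swaps_Cons) simp
  also have "(labelled_swap ok)\<^sup>*\<^sup>* \<dots> (insort_key f x (sort_key f xs))"
    using Cons.prems by (intro labelled_swaps_insort) auto
  finally show ?case by simp
qed simp

text \<open>
  Swaps of labelled letters give commutation moves, and the roots travel along with their letters.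
\<close>

lemma labelled_swaps_root_list:
  assumes "(labelled_swap (\<lambda>p q. letter p \<noteq> letter q \<and> \<not> adjacent n (letter p) (letter q)))\<^sup>*\<^sup>* Z Z'"
    and "root_list n (map letter Z) = map root Z"
  shows "map letter Z' \<in> commutation_class n (map letter Z) \<and> root_list n (map letter Z') = map root Z'"
  using assms
proof (induction rule: rtranclp_induct)
  case base
  then show ?case by (simp add: commutation_class_def)
next
  case (step Y Z')
  from step.hyps(2) obtain us p q vs where Y: "Y = us @ [p, q] @ vs" "Z' = us @ [q, p] @ vs"
    and ne: "letter p \<noteq> letter q" "\<not> adjacent n (letter p) (letter q)"
    by (auto elim!: labelled_swap.cases)
  have "commutation_step n (map letter Y) (map letter Z')"
    using commutation_step.intros[OF ne(2), of "map letter us" "map letter vs"] by (simp add: Y)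
  then have "map letter Z' \<in> commutation_class n (map letter Z)"
    using step.IH[OF step.prems] by (auto simp: commutation_class_def)
  moreover have "root_list n (map letter Z') = map root Z'"
  proof -
    define P where "P = foldr (simple_reflection n) (map letter us)"
    obtain R where
      "root_list n (map letter us @ [letter p, letter q] @ map letter vs) =
          root_list n (map letter us) @ [P (simple_root (letter p)), P (simple_root (letter q))] @ R"
      "root_list n (map letter us @ [letter q, letter p] @ map letter vs) =
          root_list n (map letter us) @ [P (simple_root (letter q)), P (simple_root (letter p))] @ R"
      using root_list_swap[OF ne] unfolding P_def by blast
    moreover have "root_list n (map letter Y) = map root Y" using step by simp
    ultimately show ?thesis by (simp add: Y append_eq_append_conv)
  qed
  ultimately show ?case by blast
qed

definition before :: "'a \<Rightarrow> 'a \<Rightarrow> 'a list \<Rightarrow> bool" where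
  "before x y xs \<longleftrightarrow> (\<exists>k l. k < l \<and> l < length xs \<and> xs ! k = x \<and> xs ! l = y)"

lemma before_append:
  "before x y (us @ vs) \<longleftrightarrow> before x y us \<or> before x y vs \<or> (x \<in> set us \<and> y \<in> set vs)"
proof
  assume "before x y (us @ vs)"
  then obtain k l where kl: "k < l" "l < length (us @ vs)" "(us @ vs) ! k = x" "(us @ vs) ! l = y"
    by (auto simp: before_def)
  show "before x y us \<or> before x y vs \<or> (x \<in> set us \<and> y \<in> set vs)"
  proof (cases "k < length us"; cases "l < length us")
    assume "\<not> k < length us" "\<not> l < length us"
    then have "before x y vs" unfolding before_def
      by (intro exI[of _ "k - length us"] exI[of _ "l - length us"]) (use kl in \<open>auto simp: nth_append\<close>)
    then show ?thesis by blast
  qed (use kl in \<open>auto simp: before_def nth_append\<close>)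
next
  assume "before x y us \<or> before x y vs \<or> (x \<in> set us \<and> y \<in> set vs)"
  then consider "before x y us" | "before x y vs" | "x \<in> set us" "y \<in> set vs" by blast
  then show "before x y (us @ vs)"
  proof cases
    case 1
    then obtain k l where "k < l" "l < length us" "us ! k = x" "us ! l = y" by (auto simp: before_def)
    then show ?thesis unfolding before_def
      by (intro exI[of _ k] exI[of _ l]) (auto simp: nth_append)
  next
    case 2
    then obtain k l where "k < l" "l < length vs" "vs ! k = x" "vs ! l = y" by (auto simp: before_def)
    then show ?thesis unfolding before_def
      by (intro exI[of _ "length us + k"] exI[of _ "length us + l"]) (auto simp: nth_append)
  next
    case 3
    then obtain k l where "k < length us" "us ! k = x" "l < length vs" "vs ! l = y"
      by (metis in_set_conv_nth)
    then show ?thesis unfolding before_def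
      by (intro exI[of _ k] exI[of _ "length us + l"]) (auto simp: nth_append)
  qed
qed

lemma before_pair: "before x y [a, b] \<longleftrightarrow> x = a \<and> y = b"
  unfolding before_def
proof
  assume "\<exists>k l. k < l \<and> l < length [a, b] \<and> [a, b] ! k = x \<and> [a, b] ! l = y"
  then obtain k l where kl: "k < l" "l < 2" "[a, b] ! k = x" "[a, b] ! l = y" by auto
  then have "k = 0" "l = 1" by linarith+
  then show "x = a \<and> y = b" using kl(3,4) by simp
next
  assume "x = a \<and> y = b"
  then show "\<exists>k l. k < l \<and> l < length [a, b] \<and> [a, b] ! k = x \<and> [a, b] ! l = y"
    by (intro exI[of _ 0] exI[of _ 1]) simp
qed

lemma before_swap:
  assumes "before x y (us @ [a, b] @ vs)" "x \<noteq> a \<or> y \<noteq> b"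
  shows "before x y (us @ [b, a] @ vs)"
  using assms unfolding before_append before_pair by auto

text \<open>
  A commutation move changes only the order of two orthogonal roots. Hence the order of two
  non-orthogonal roots is an invariant of the class. This replaces the convexity of the orders given by
  reduced words.
\<close>

lemma commutation_class_root_list:
  assumes n: "n \<ge> 3" and js: "set js \<subseteq> index_set n" and js': "js' \<in> commutation_class n js"
  shows "set js' \<subseteq> index_set n \<and> mset (root_list n js') = mset (root_list n js) \<and>
    (\<forall>x y. before x y (root_list n js) \<longrightarrow> inner_form n x y \<noteq> 0 \<longrightarrow> before x y (root_list n js'))"
proof -
  have "(commutation_step n)\<^sup>*\<^sup>* js js'" using js' by (simp add: commutation_class_def)
  then show ?thesis
  proof (induction rule: rtranclp_induct)
    case base
    then show ?case using js by simp
  next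
    case (step js1 js2)
    from step.hyps(2) obtain a b u v where j: "js1 = u @ [a, b] @ v" "js2 = u @ [b, a] @ v"
      and na: "\<not> adjacent n a b"
      by (auto elim!: commutation_step.cases)
    show ?case
    proof (cases "a = b")
      case True
      then show ?thesis using step.IH j by simp
    next
      case False
      have s: "set u \<subseteq> index_set n" "a \<in> index_set n" "b \<in> index_set n" "set js2 \<subseteq> index_set n"
        using step.IH unfolding j by auto
      define P where "P = foldr (simple_reflection n) u"
      obtain R where
        r: "root_list n js1 = root_list n u @ [P (simple_root a), P (simple_root b)] @ R"
           "root_list n js2 = root_list n u @ [P (simple_root b), P (simple_root a)] @ R"
        using root_list_swap[OF False na] unfolding P_def j by blast
      have "inner_form n (P (simple_root a)) (P (simple_root b)) = 0"
        unfolding P_def by (rule inner_form_word_nonadjacent[OF n s(1,2,3) False na])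
      then have "before x y (root_list n js2)" if "before x y (root_list n js1)" "inner_form n x y \<noteq> 0" for x y
        using that before_swap unfolding r by metis
      moreover have "mset (root_list n js2) = mset (root_list n js1)" unfolding r by simp
      ultimately show ?thesis using step.IH s(4) by auto
    qed
  qed
qed

section \<open>Labels of signed indices from the twisted Coxeter element\<close>

text \<open>
  The action of \<open>\<or>\<close> on signed indices: it exchanges \<open>\<alpha>\<^sub>n\<close> and \<open>\<alpha>\<^sub>n\<^sub>+\<^sub>1\<close>, which is the sign change
  of the last coordinate.
\<close>

definition flip :: "nat \<Rightarrow> int \<Rightarrow> int" where
  "flip n s = (if \<bar>s\<bar> = int n + 1 then - s else s)"

lemma flip_flip [simp]: "flip n (flip n s) = s"
  by (simp add: flip_def)

lemma flip_power_twice [simp]: "(flip n ^^ k) ((flip n ^^ k) s) = s"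
proof (induction k arbitrary: s)
  case (Suc k)
  show ?case by (subst funpow_Suc_right) (simp add: Suc)
qed simp

lemma flip_minus: "flip n (- s) = - flip n s"
  by (simp add: flip_def)

lemma signed_refl_vee:
  assumes "n \<ge> 3" "a \<in> index_set n"
  shows "vee n a \<in> index_set n" "head_index n (vee n a) = flip n (head_index n a)"
    "tail_index n (vee n a) = flip n (tail_index n a)"
    "signed_refl n (vee n a) s = flip n (signed_refl n a (flip n s))"
proof -
  show v: "vee n a \<in> index_set n" using assms by (auto simp: vee_def index_set_def)
  show h: "head_index n (vee n a) = flip n (head_index n a)"
    using assms by (auto simp: vee_def index_set_def head_index_def orbit_def flip_def)
  show t: "tail_index n (vee n a) = flip n (tail_index n a)"
    using assms by (auto simp: vee_def index_set_def tail_index_def flip_def)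
  have e: "flip n x = y \<longleftrightarrow> x = flip n y" for x y by auto
  show "signed_refl n (vee n a) s = flip n (signed_refl n a (flip n s))"
    unfolding signed_refl_def h t e by (auto simp: flip_minus)
qed

lemma signed_refl_vee_power:
  assumes n: "n \<ge> 3" and a: "a \<in> index_set n"
  shows "(vee n ^^ k) a \<in> index_set n \<and> head_index n ((vee n ^^ k) a) = (flip n ^^ k) (head_index n a) \<and>
    tail_index n ((vee n ^^ k) a) = (flip n ^^ k) (tail_index n a) \<and>
    (\<forall>s. signed_refl n ((vee n ^^ k) a) s = (flip n ^^ k) (signed_refl n a ((flip n ^^ k) s)))"
proof (induction k)
  case (Suc k)
  have "(flip n ^^ Suc k) s = (flip n ^^ k) (flip n s)" for s by (subst funpow_Suc_right) simp
  then show ?case using Suc signed_refl_vee[OF n, of "(vee n ^^ k) a"] by simp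
qed (simp add: a)

lemma foldr_signed_refl_vee_power:
  assumes n: "n \<ge> 3" and js: "set js \<subseteq> index_set n"
  shows "foldr (signed_refl n) (map (vee n ^^ k) js) s = (flip n ^^ k) (foldr (signed_refl n) js ((flip n ^^ k) s))"
  using js by (induction js) (auto simp: signed_refl_vee_power[OF n])

locale twisted_adapted =
  fixes n :: nat and w :: "nat list" and \<xi> :: "nat \<Rightarrow> int"
  assumes n3: "n \<ge> 3" and transversal: "orbit_transversal n w" and height: "height_function n w \<xi>"
begin

lemma w_index: "t < length w \<Longrightarrow> w ! t \<in> index_set n"
  using transversal nth_mem unfolding orbit_transversal_def by blast

lemma set_w: "set w \<subseteq> index_set n"
  using transversal unfolding orbit_transversal_def by blast

lemma orbit_w: "t < length w \<Longrightarrow> orbit n (w ! t) \<in> {1..n}"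
  using w_index[of t] n3 by (auto simp: orbit_def index_set_def)

definition place :: "nat \<Rightarrow> nat" where
  "place i = (THE t. t < length w \<and> orbit n (w ! t) = i)"

lemma place: "i \<in> {1..n} \<Longrightarrow> place i < length w \<and> orbit n (w ! place i) = i"
  unfolding place_def by (rule theI') (use transversal in \<open>auto simp: orbit_transversal_def\<close>)

lemma place_orbit: "t < length w \<Longrightarrow> place (orbit n (w ! t)) = t"
  unfolding place_def
  by (rule the1_equality) (use transversal orbit_w in \<open>auto simp: orbit_transversal_def\<close>)

lemma length_w: "length w = n"
proof -
  have "bij_betw place {1..n} {..<length w}"
    by (rule bij_betw_byWitness[where f' = "\<lambda>t. orbit n (w ! t)"])
      (use place place_orbit orbit_w in auto)
  then show ?thesis using bij_betw_same_card by fastforce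
qed

lemma occurs_before_iff:
  assumes "i \<in> {1..n}" "i' \<in> {1..n}"
  shows "occurs_before i i' (map (orbit n) w) \<longleftrightarrow> place i < place i'"
proof
  assume "occurs_before i i' (map (orbit n) w)"
  then obtain a b where "a < b" "b < length w" "orbit n (w ! a) = i" "orbit n (w ! b) = i'"
    by (auto simp: occurs_before_def)
  then show "place i < place i'" using place_orbit[of a] place_orbit[of b] by auto
next
  assume "place i < place i'"
  then show "occurs_before i i' (map (orbit n) w)" unfolding occurs_before_def
    by (intro exI[of _ "place i"] exI[of _ "place i'"]) (use place assms in auto)
qed

lemma place_inj: "i \<in> {1..n} \<Longrightarrow> i' \<in> {1..n} \<Longrightarrow> place i = place i' \<Longrightarrow> i = i'"
  using place by metis

text \<open>
  The left label of the root of orbit \<open>i\<close> in the first block. The height function is an affine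
  function of the sum of the two labels, so half of a height difference enters; the normalisation is that
  orbit \<open>n\<close> starts at 0.
\<close>

definition start :: "nat \<Rightarrow> int" where
  "start i = (\<xi> n + int n - \<xi> i - int i) div 2"

lemma height_step:
  assumes "1 \<le> i" "i < n"
  shows "\<xi> i = (if place i < place (i + 1) then \<xi> (i + 1) + 1 else \<xi> (i + 1) - 1)"
  using height assms occurs_before_iff[of i "i + 1"] unfolding height_function_def by auto

lemma start_parity: "1 \<le> i \<Longrightarrow> i \<le> n \<Longrightarrow> 2 * start i = \<xi> n + int n - \<xi> i - int i"
proof -
  assume i: "1 \<le> i" "i \<le> n"
  have "even (\<xi> n + int n - \<xi> i - int i)"
    using i(2,1)
  proof (induction i rule: inc_induct)
    case base then show ?case by simp
  next
    case (step i)
    have e: "\<xi> n + int n - \<xi> i - int i =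
        \<xi> n + int n - \<xi> (Suc i) - int (Suc i) + (if place i < place (i + 1) then 0 else 2)"
      using height_step[of i] step by simp
    show ?case unfolding e by (rule dvd_add) (use step in auto)
  qed
  then show ?thesis unfolding start_def by simp
qed

lemma start_n: "start n = 0"
  by (simp add: start_def)

text \<open>
  The left label grows, or the right label \<open>start i + i\<close> does, according to which of two neighbouring
  orbits comes first. Both are thus monotone in the orbit, in opposite directions.
\<close>

lemma start_step:
  assumes "1 \<le> i" "i < n"
  shows "start i = start (i + 1) + (if place i < place (i + 1) then 0 else 1)"
  using height_step[OF assms] start_parity[of i] start_parity[of "i + 1"] assms by (auto split: if_splits)

definition prefix :: "nat \<Rightarrow> int \<Rightarrow> int" where
  "prefix t = foldr (signed_refl n) (take t w)"

text \<open>
  The action of \<open>s\<^sub>i\<^sub>1 \<cdots> s\<^sub>i\<^sub>n \<or>\<close> on signed indices. One block of the twisted word acts by it, up to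
  powers of \<open>\<or>\<close>.
\<close>

definition coxeter :: "int \<Rightarrow> int" where
  "coxeter s = foldr (signed_refl n) w (flip n s)"

text \<open>
  The two signed indices of the root of orbit \<open>i\<close> in the first block.
\<close>

definition left_end :: "nat \<Rightarrow> int" where
  "left_end i = prefix (place i) (int i)"

definition right_end :: "nat \<Rightarrow> int" where
  "right_end i = prefix (place i) (tail_index n (w ! place i))"

lemma prefix_minus: "prefix t (- s) = - prefix t s"
proof -
  have "set js \<subseteq> index_set n \<Longrightarrow> foldr (signed_refl n) js (- s) = - foldr (signed_refl n) js s" for js
    by (induction js) (auto simp: signed_refl_minus n3)
  then show ?thesis unfolding prefix_def using set_w set_take_subset by (metis order_trans)
qed

lemma coxeter_prefix: "coxeter s = prefix n (flip n s)"
  by (simp add: coxeter_def prefix_def length_w)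

lemma coxeter_minus: "coxeter (- s) = - coxeter s"
  by (simp add: coxeter_prefix flip_minus prefix_minus)

lemma prefix_Suc: "t < n \<Longrightarrow> prefix (Suc t) s = prefix t (signed_refl n (w ! t) s)"
  by (simp add: prefix_def take_Suc_conv_app_nth length_w)

lemma prefix_skip:
  assumes "t1 \<le> t2" "t2 \<le> n" "\<And>t. t1 \<le> t \<Longrightarrow> t < t2 \<Longrightarrow> signed_refl n (w ! t) s = s"
  shows "prefix t2 s = prefix t1 s"
  using assms
proof (induction t2 rule: dec_induct)
  case (step t)
  then show ?case using prefix_Suc[of t s] by simp
qed simp

lemma head_index_place: "i \<in> {1..n} \<Longrightarrow> head_index n (w ! place i) = int i"
  using place by (simp add: head_index_def)

lemma tail_index_place:
  "i \<in> {1..n} \<Longrightarrow> i < n \<Longrightarrow> tail_index n (w ! place i) = int i + 1"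
  "\<bar>tail_index n (w ! place n)\<bar> = int n + 1"
  using place[of i] place[of n] n3 by (auto simp: tail_index_def orbit_def split: if_splits)

lemma place_less: "i \<in> {1..n} \<Longrightarrow> place i < n"
  using place length_w by auto

lemma signed_refl_fix:
  assumes "t < n" "i \<in> {1..n}" "t \<noteq> place i" "i \<ge> 2 \<Longrightarrow> t \<noteq> place (i - 1)"
  shows "signed_refl n (w ! t) (int i) = int i"
proof -
  have t: "t < length w" using assms length_w by simp
  have "orbit n (w ! t) \<noteq> i" using place_orbit[OF t] assms by auto
  moreover have "orbit n (w ! t) \<noteq> i - 1"
  proof
    assume o: "orbit n (w ! t) = i - 1"
    then have "1 \<le> i - 1" using orbit_w[OF t] by simp
    then have "i \<ge> 2" by linarith
    then show False using place_orbit[OF t] assms(4) o by simp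
  qed
  ultimately show ?thesis using orbit_w[OF t] w_index[OF t] assms(2) n3
    by (auto simp: signed_refl_def head_index_def tail_index_def orbit_def index_set_def split: if_splits)
qed

text \<open>
  Only the letters of orbits \<open>i - 1\<close> and \<open>i\<close> move the index \<open>i\<close>; a stretch of the word that
  contains neither can be skipped.
\<close>

lemma prefix_skip_index:
  assumes "t1 \<le> t2" "t2 \<le> n" "i \<in> {1..n}" "place i < t1 \<or> t2 \<le> place i"
    "i \<ge> 2 \<Longrightarrow> place (i - 1) < t1 \<or> t2 \<le> place (i - 1)"
  shows "prefix t2 (int i) = prefix t1 (int i)"
  by (rule prefix_skip[OF assms(1,2)], rule signed_refl_fix) (use assms in auto)

lemma signed_refl_fix_top:
  assumes "t < n" "t \<noteq> place n" "\<bar>s\<bar> = int n + 1"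
  shows "signed_refl n (w ! t) s = s"
proof -
  have t: "t < length w" using assms length_w by simp
  have "orbit n (w ! t) \<noteq> n" using place_orbit[OF t] assms by auto
  then show ?thesis using orbit_w[OF t] w_index[OF t] assms(3) n3
    by (auto simp: signed_refl_def head_index_def tail_index_def orbit_def index_set_def split: if_splits)
qed

lemma signed_refl_place:
  assumes "i \<in> {1..n}"
  shows "signed_refl n (w ! place i) (int i) = tail_index n (w ! place i)"
    "signed_refl n (w ! place i) (tail_index n (w ! place i)) = int i"
proof -
  show a: "signed_refl n (w ! place i) (int i) = tail_index n (w ! place i)"
    by (simp add: signed_refl_def head_index_place[OF assms])
  show "signed_refl n (w ! place i) (tail_index n (w ! place i)) = int i"
    using signed_refl_invol[OF n3 w_index] place[OF assms] by (metis a)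
qed

text \<open>
  Applied from right to left, the prefix before the letter of orbit \<open>i + 1\<close> first meets the letter of orbit
  \<open>i\<close>, if that one occurs, and this turns the index \<open>i + 1\<close> into \<open>i\<close>.
\<close>

lemma left_end_step:
  assumes "1 \<le> i" "i < n"
  shows "place i < place (i + 1) \<Longrightarrow> left_end (i + 1) = left_end i"
    "place (i + 1) < place i \<Longrightarrow> left_end (i + 1) = int (i + 1)"
proof -
  have i: "i \<in> {1..n}" "i + 1 \<in> {1..n}" using assms by auto
  { assume lt: "place i < place (i + 1)"
    have "prefix (place (i + 1)) (int (i + 1)) = prefix (Suc (place i)) (int (i + 1))"
      by (rule prefix_skip_index) (use lt place_less[OF i(2)] i in auto)
    also have "\<dots> = prefix (place i) (int i)"
      using prefix_Suc[OF place_less[OF i(1)]] signed_refl_place(2)[OF i(1)]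
        tail_index_place(1)[OF i(1)] assms by (simp add: add.commute[of 1])
    finally show "left_end (i + 1) = left_end i" by (simp add: left_end_def) }
  { assume lt: "place (i + 1) < place i"
    have "prefix (place (i + 1)) (int (i + 1)) = prefix 0 (int (i + 1))"
      by (rule prefix_skip_index) (use lt place_less[OF i(2)] i in auto)
    then show "left_end (i + 1) = int (i + 1)" by (simp add: left_end_def prefix_def) }
qed

lemma left_end_1: "left_end 1 = 1"
proof -
  have "prefix (place 1) (int 1) = prefix 0 (int 1)"
    by (rule prefix_skip_index) (use place_less[of 1] n3 in auto)
  then show ?thesis by (simp add: left_end_def prefix_def)
qed

lemma right_end_step:
  assumes "1 \<le> i" "i < n"
  shows "place (i + 1) < place i \<Longrightarrow> right_end i = right_end (i + 1)"
    "place i < place (i + 1) \<Longrightarrow> right_end i = int (i + 1)"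
proof -
  have i: "i \<in> {1..n}" "i + 1 \<in> {1..n}" using assms by auto
  have r: "right_end i = prefix (place i) (int (i + 1))"
    using tail_index_place(1)[OF i(1)] assms by (simp add: right_end_def add.commute)
  { assume lt: "place (i + 1) < place i"
    have "prefix (place i) (int (i + 1)) = prefix (Suc (place (i + 1))) (int (i + 1))"
      by (rule prefix_skip_index) (use lt place_less[OF i(1)] i in auto)
    also have "\<dots> = right_end (i + 1)"
      using prefix_Suc[OF place_less[OF i(2)]] signed_refl_place(1)[OF i(2)]
      by (simp add: right_end_def)
    finally show "right_end i = right_end (i + 1)" using r by simp }
  { assume lt: "place i < place (i + 1)"
    have "prefix (place i) (int (i + 1)) = prefix 0 (int (i + 1))"
      by (rule prefix_skip_index) (use lt place_less[OF i(1)] i in auto)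
    then show "right_end i = int (i + 1)" using r by (simp add: prefix_def) }
qed

lemma right_end_n: "right_end n = tail_index n (w ! place n)" "\<bar>right_end n\<bar> = int n + 1"
proof -
  have n: "n \<in> {1..n}" using n3 by simp
  have "prefix (place n) (tail_index n (w ! place n)) = prefix 0 (tail_index n (w ! place n))"
    by (rule prefix_skip) (use place_less[OF n] tail_index_place(2) in \<open>auto intro!: signed_refl_fix_top\<close>)
  then show "right_end n = tail_index n (w ! place n)" by (simp add: right_end_def prefix_def)
  then show "\<bar>right_end n\<bar> = int n + 1" using tail_index_place(2) by simp
qed

lemma coxeter_index:
  assumes "2 \<le> i" "i \<le> n"
  shows "place (i - 1) < place i \<Longrightarrow> coxeter (int i) = right_end i"
    "place i < place (i - 1) \<Longrightarrow> coxeter (int i) = left_end (i - 1)"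
proof -
  have i: "i \<in> {1..n}" "i - 1 \<in> {1..n}" using assms by auto
  have c: "coxeter (int i) = prefix n (int i)"
    using assms by (simp add: coxeter_prefix flip_def)
  { assume lt: "place (i - 1) < place i"
    have "prefix n (int i) = prefix (Suc (place i)) (int i)"
      by (rule prefix_skip_index) (use lt place_less[OF i(1)] i in auto)
    then show "coxeter (int i) = right_end i"
      using c prefix_Suc[OF place_less[OF i(1)]] signed_refl_place(1)[OF i(1)]
      by (simp add: right_end_def) }
  { assume lt: "place i < place (i - 1)"
    have "prefix n (int i) = prefix (Suc (place (i - 1))) (int i)"
      by (rule prefix_skip_index) (use lt place_less[OF i(2)] i in auto)
    moreover have "tail_index n (w ! place (i - 1)) = int i"
      using tail_index_place(1)[OF i(2)] assms by auto
    ultimately show "coxeter (int i) = left_end (i - 1)"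
      using c prefix_Suc[OF place_less[OF i(2)]] signed_refl_place(2)[OF i(2)]
      by (simp add: left_end_def) }
qed

lemma coxeter_1: "coxeter 1 = right_end 1"
proof -
  have i: "1 \<in> {1..n}" using n3 by simp
  have "prefix n (int 1) = prefix (Suc (place 1)) (int 1)"
    by (rule prefix_skip_index) (use place_less[OF i] i in auto)
  then show ?thesis
    using prefix_Suc[OF place_less[OF i]] signed_refl_place(1)[OF i] n3
    by (simp add: right_end_def coxeter_prefix flip_def)
qed

text \<open>
  This is where the twist enters: \<open>\<or>\<close> negates the index \<open>\<plusminus>(n + 1)\<close>, and so the cycle of the twisted
  Coxeter element closes up only after passing through all negatives.
\<close>

lemma coxeter_right_end_n: "coxeter (right_end n) = - left_end n"
proof -
  have n: "n \<in> {1..n}" using n3 by simp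
  define r where "r = right_end n"
  have r: "\<bar>r\<bar> = int n + 1" "r = tail_index n (w ! place n)" using right_end_n r_def by auto
  have "coxeter r = - prefix n r" using r(1) by (simp add: coxeter_prefix flip_def prefix_minus)
  also have "prefix n r = prefix (Suc (place n)) r"
    by (rule prefix_skip) (use place_less[OF n] r in \<open>auto intro!: signed_refl_fix_top\<close>)
  also have "\<dots> = left_end n"
    using prefix_Suc[OF place_less[OF n]] signed_refl_place(2)[OF n] r by (simp add: left_end_def)
  finally show ?thesis by (simp add: r_def)
qed

text \<open>
  Of the two ends of a root of the first block, exactly one moves when passing to the next orbit, and it
  moves by one step of the twisted Coxeter element.
\<close>

lemma ends_step:
  assumes "1 \<le> i" "i < n"
  shows "place i < place (i + 1) \<Longrightarrow> left_end (i + 1) = left_end i \<and> right_end (i + 1) = coxeter (right_end i)"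
    "\<not> place i < place (i + 1) \<Longrightarrow> left_end i = coxeter (left_end (i + 1)) \<and> right_end (i + 1) = right_end i"
proof -
  show "place i < place (i + 1) \<Longrightarrow> left_end (i + 1) = left_end i \<and> right_end (i + 1) = coxeter (right_end i)"
    using left_end_step(1)[OF assms] right_end_step(2)[OF assms] coxeter_index(1)[of "i + 1"] assms by auto
  assume "\<not> place i < place (i + 1)"
  then have "place (i + 1) < place i" using place_inj[of i "i + 1"] assms by fastforce
  then show "left_end i = coxeter (left_end (i + 1)) \<and> right_end (i + 1) = right_end i"
    using left_end_step(2)[OF assms] right_end_step(1)[OF assms] coxeter_index(2)[of "i + 1"] assms by auto
qed

lemma start_mono: "1 \<le> i \<Longrightarrow> i \<le> j \<Longrightarrow> j \<le> n \<Longrightarrow> start j \<le> start i \<and> start i + int i \<le> start j + int j"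
proof -
  assume a: "1 \<le> i" "i \<le> j" "j \<le> n"
  show ?thesis using a(2,3,1)
  proof (induction j rule: dec_induct)
    case (step j)
    then show ?case using start_step[of j] by (auto split: if_splits)
  qed simp
qed

lemma start_nonneg: "1 \<le> i \<Longrightarrow> i \<le> n \<Longrightarrow> 0 \<le> start i \<and> start i + int i \<le> int n"
  using start_mono[of i n] start_n by simp

abbreviation coxeter_orbit :: "nat \<Rightarrow> int" where
  "coxeter_orbit k \<equiv> (coxeter ^^ k) (left_end n)"

lemma left_end_coxeter_orbit:
  assumes "1 \<le> i" "i \<le> n"
  shows "left_end i = coxeter_orbit (nat (start i))"
  using assms(2,1)
proof (induction i rule: inc_induct)
  case base then show ?case by (simp add: start_n)
next
  case (step i)
  then have i: "1 \<le> i" "i < n" by auto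
  have "0 \<le> start (i + 1)" using start_nonneg[of "i + 1"] i by simp
  then show ?case using step start_step[OF i] ends_step[OF i]
    by (cases "place i < place (i + 1)") (auto simp: nat_add_distrib)
qed

lemma right_end_coxeter_orbit:
  assumes "1 \<le> i" "i \<le> n"
  shows "right_end i = coxeter_orbit (nat (start i + int i))"
  using assms
proof (induction i rule: nat_induct_at_least)
  case base
  have "nat (start 1 + int 1) = Suc (nat (start 1))" using start_nonneg[of 1] n3 by (simp add: nat_add_distrib)
  then show ?case using coxeter_1 left_end_1 left_end_coxeter_orbit[of 1] n3 by simp
next
  case (Suc i)
  then have i: "1 \<le> i" "i < n" by auto
  have "0 \<le> start i" "0 \<le> start (i + 1)" using start_nonneg[of i] start_nonneg[of "i + 1"] i by auto
  then show ?case using Suc start_step[OF i] ends_step[OF i]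
    by (cases "place i < place (i + 1)") (auto simp: nat_add_distrib)
qed

lemma coxeter_power_minus: "(coxeter ^^ k) (- s) = - (coxeter ^^ k) s"
  by (induction k) (simp_all add: coxeter_minus)

text \<open>
  Walking along the right ends leads from \<open>left_end n\<close> in \<open>n\<close> steps to \<open>right_end n\<close>, and one more step
  gives \<open>- left_end n\<close>.
\<close>

lemma coxeter_orbit_half: "coxeter_orbit (k + (n + 1)) = - coxeter_orbit k"
proof -
  have "coxeter_orbit (n + 1) = - left_end n"
    using coxeter_right_end_n right_end_coxeter_orbit[of n] n3 start_n by simp
  then have "(coxeter ^^ k) (coxeter_orbit (n + 1)) = - coxeter_orbit k" by (simp only: coxeter_power_minus)
  then show ?thesis by (simp only: funpow_add o_apply)
qed

lemma coxeter_orbit_mod: "coxeter_orbit (k mod (2 * (n + 1))) = coxeter_orbit k"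
proof -
  have "coxeter_orbit (r + q * (2 * (n + 1))) = coxeter_orbit r" for r q
  proof (induction q)
    case (Suc q)
    have "coxeter_orbit (r + Suc q * (2 * (n + 1))) = coxeter_orbit ((r + q * (2 * (n + 1)) + (n + 1)) + (n + 1))"
      by (rule arg_cong[of _ _ coxeter_orbit]) simp
    also have "\<dots> = coxeter_orbit r" using Suc by (simp only: coxeter_orbit_half minus_minus)
    finally show ?case .
  qed simp
  from this[of "k mod (2 * (n + 1))" "k div (2 * (n + 1))"] show ?thesis
    by (simp only: mod_div_mult_eq)
qed

text \<open>
  The Coxeter number is \<open>2n\<close>, but the twisted Coxeter element has order \<open>2h\<close>, with \<open>h\<close> as half period.
\<close>

definition h :: int where "h = int n + 1"

text \<open>
  The signed index that is reached from \<open>left_end n\<close> in \<open>x\<close> steps.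
\<close>

definition label :: "int \<Rightarrow> int" where
  "label x = coxeter_orbit (nat (x mod (2 * h)))"

lemma label_of_nat: "label (int k) = coxeter_orbit k"
proof -
  have "int k mod (2 * h) = int (k mod (2 * (n + 1)))"
    by (simp add: h_def zmod_int algebra_simps)
  then show ?thesis using coxeter_orbit_mod[of k] by (simp add: label_def)
qed

lemma label_cong: "x mod (2 * h) = y mod (2 * h) \<Longrightarrow> label x = label y"
  by (simp add: label_def)

lemma obtain_nat_cong: obtains k where "(x + int j) mod (2 * h) = int (k + j) mod (2 * h)"
    "x mod (2 * h) = int k mod (2 * h)"
proof (rule that[of "nat (x mod (2 * h))"])
  have p: "0 \<le> x mod (2 * h)" by (rule pos_mod_sign) (simp add: h_def)
  show "(x + int j) mod (2 * h) = int (nat (x mod (2 * h)) + j) mod (2 * h)"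
    using p by (simp add: mod_add_left_eq)
  show "x mod (2 * h) = int (nat (x mod (2 * h))) mod (2 * h)"
    using p by simp
qed

lemma label_half: "label (x + h) = - label x"
proof -
  obtain k where "(x + int (n + 1)) mod (2 * h) = int (k + (n + 1)) mod (2 * h)" "x mod (2 * h) = int k mod (2 * h)"
    using obtain_nat_cong .
  then have "label (x + int (n + 1)) = coxeter_orbit (k + (n + 1))" "label x = coxeter_orbit k"
    using label_cong label_of_nat by metis+
  then show ?thesis using coxeter_orbit_half[of k] by (simp add: h_def add.commute)
qed

lemma label_power: "label (x + int j) = (coxeter ^^ j) (label x)"
proof -
  obtain k where "(x + int j) mod (2 * h) = int (k + j) mod (2 * h)" "x mod (2 * h) = int k mod (2 * h)"
    using obtain_nat_cong .
  then have "label (x + int j) = coxeter_orbit (k + j)" "label x = coxeter_orbit k"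
    using label_cong label_of_nat by metis+
  then show ?thesis by (simp add: add.commute[of k j] funpow_add)
qed

lemma left_end_label: "1 \<le> i \<Longrightarrow> i \<le> n \<Longrightarrow> left_end i = label (start i)"
  using left_end_coxeter_orbit[of i] label_of_nat[of "nat (start i)"] start_nonneg[of i] by simp

lemma right_end_label: "1 \<le> i \<Longrightarrow> i \<le> n \<Longrightarrow> right_end i = label (start i + int i)"
  using right_end_coxeter_orbit[of i] label_of_nat[of "nat (start i + int i)"] start_nonneg[of i] by simp

text \<open>
  Each index occurs as a left end or as a right end of a root in the first block, and negatives are half a
  period away.
\<close>

lemma label_surj:
  assumes "1 \<le> \<bar>s\<bar>" "\<bar>s\<bar> \<le> h"
  shows "\<exists>x. label x = s"
proof -
  have position: "\<exists>x. \<bar>label x\<bar> = int a" if a: "1 \<le> a" "a \<le> n + 1" for a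
  proof -
    consider "a = 1" | "a = n + 1" | "2 \<le> a" "a \<le> n" using a by linarith
    then show ?thesis
    proof cases
      case 1
      then show ?thesis using left_end_label[of 1] left_end_1 n3 by (intro exI[of _ "start 1"]) simp
    next
      case 2
      then show ?thesis using right_end_label[of n] right_end_n n3 by (intro exI[of _ "start n + int n"]) simp
    next
      case 3
      then have i: "1 \<le> a - 1" "a - 1 < n" "a - 1 + 1 = a" by auto
      show ?thesis
      proof (cases "place (a - 1) < place a")
        case True
        then have "right_end (a - 1) = int a" using right_end_step(2)[OF i(1,2)] i(3) by simp
        then show ?thesis using right_end_label[of "a - 1"] i
          by (intro exI[of _ "start (a - 1) + int (a - 1)"]) simp
      next
        case False
        then have "place a < place (a - 1)" using place_inj[of "a - 1" a] 3 by fastforce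
        then have "left_end a = int a" using left_end_step(2)[OF i(1,2)] i(3) by simp
        then show ?thesis using left_end_label[of a] 3 by (intro exI[of _ "start a"]) simp
      qed
    qed
  qed
  have "1 \<le> nat \<bar>s\<bar>" "nat \<bar>s\<bar> \<le> n + 1" using assms unfolding h_def by linarith+
  from position[OF this] obtain x where "\<bar>label x\<bar> = int (nat \<bar>s\<bar>)" by blast
  then have "\<bar>label x\<bar> = \<bar>s\<bar>" by simp
  then have "label x = s \<or> label (x + h) = s" using label_half[of x] by linarith
  then show ?thesis by blast
qed

text \<open>
  There are \<open>2h\<close> signed indices and all of them are labels, so no label repeats within a period.
\<close>

lemma label_bij: "label ` {0..<2 * h} = {s. 1 \<le> \<bar>s\<bar> \<and> \<bar>s\<bar> \<le> h} \<and> inj_on label {0..<2 * h}"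
proof -
  let ?A = "{0..<2 * h}" and ?S = "{s. 1 \<le> \<bar>s\<bar> \<and> \<bar>s\<bar> \<le> h}"
  have h: "0 < h" by (simp add: h_def)
  have S: "?S = {- h..- 1} \<union> {1..h}" by auto
  have cS: "card ?S = nat (2 * h)" unfolding S using h by (subst card_Un_disjoint) auto
  have fS: "finite ?S" unfolding S by simp
  have "?S \<subseteq> label ` ?A"
  proof
    fix s assume "s \<in> ?S"
    then obtain x where x: "label x = s" using label_surj by blast
    moreover have "label (x mod (2 * h)) = label x" by (rule label_cong) simp
    moreover have "x mod (2 * h) \<in> ?A" using h by simp
    ultimately show "s \<in> label ` ?A" by (metis imageI)
  qed
  moreover from this have "card ?S \<le> card (label ` ?A)" by (intro card_mono) auto
  moreover have "card (label ` ?A) \<le> card ?A" by (rule card_image_le) simp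
  moreover have "card ?A = nat (2 * h)" by simp
  ultimately have e: "card (label ` ?A) = card ?A" "card ?S = card (label ` ?A)" "?S \<subseteq> label ` ?A" using cS by auto
  have "?S = label ` ?A" by (rule card_subset_eq) (use e in auto)
  moreover have "inj_on label ?A" by (rule eq_card_imp_inj_on) (use e in auto)
  ultimately show ?thesis by simp
qed

lemma label_range: "1 \<le> \<bar>label x\<bar>" "\<bar>label x\<bar> \<le> h"
proof -
  have "label (x mod (2 * h)) = label x" by (rule label_cong) simp
  moreover have "x mod (2 * h) \<in> {0..<2 * h}" by (simp add: h_def)
  ultimately have "label x \<in> label ` {0..<2 * h}" by (metis imageI)
  then show "1 \<le> \<bar>label x\<bar>" "\<bar>label x\<bar> \<le> h" using label_bij by auto
qed

lemma label_eq_iff: "label x = label y \<longleftrightarrow> x mod (2 * h) = y mod (2 * h)"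
proof
  assume "label x = label y"
  then have "label (x mod (2 * h)) = label (y mod (2 * h))" using label_cong by (metis mod_mod_trivial)
  moreover have "x mod (2 * h) \<in> {0..<2 * h}" "y mod (2 * h) \<in> {0..<2 * h}" by (simp_all add: h_def)
  ultimately show "x mod (2 * h) = y mod (2 * h)" by (rule inj_onD[OF conjunct2[OF label_bij]])
qed (rule label_cong)

definition block_word :: "nat \<Rightarrow> nat list" where
  "block_word k = concat (map (\<lambda>k. map (vee n ^^ k) w) [0..<k])"

lemma length_block_word: "length (block_word k) = k * n"
  by (induction k) (simp_all add: block_word_def length_w)

lemma foldr_block_word: "foldr (signed_refl n) (block_word k) s = (coxeter ^^ k) ((flip n ^^ k) s)"
proof (induction k arbitrary: s)
  case 0 show ?case by (simp add: block_word_def)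
next
  case (Suc k)
  have "block_word (Suc k) = block_word k @ map (vee n ^^ k) w" by (simp add: block_word_def)
  then have "foldr (signed_refl n) (block_word (Suc k)) s =
      (coxeter ^^ k) (foldr (signed_refl n) w ((flip n ^^ k) s))"
    by (simp add: foldr_signed_refl_vee_power[OF n3 set_w] Suc.IH)
  also have "foldr (signed_refl n) w ((flip n ^^ k) s) = coxeter ((flip n ^^ Suc k) s)"
    by (simp add: coxeter_def)
  finally show ?case by (simp only: funpow_Suc_right o_apply)
qed

lemma twisted_word_block:
  assumes "k \<le> n"
  obtains rest where "twisted_word n w = block_word k @ map (vee n ^^ k) w @ rest"
proof
  have "[0..<n + 1] = [0..<k] @ [k] @ [Suc k..<n + 1]"
    using assms by (metis append_Cons append_Nil le_imp_less_Suc le_add1 Suc_eq_plus1 upt_add_eq_append upt_conv_Cons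
        le0 less_imp_le_nat add_0 le_add_diff_inverse)
  then show "twisted_word n w = block_word k @ map (vee n ^^ k) w @
      concat (map (\<lambda>k. map (vee n ^^ k) w) [Suc k..<n + 1])"
    unfolding twisted_word_def block_word_def by simp
qed

text \<open>
  In block \<open>k\<close> the twists of the preceding blocks and of the letters of the block cancel, so that the root
  is the \<open>k\<close>-th image of the root of the first block and its labels are shifted by \<open>k\<close>.
\<close>

lemma root_at_diff:
  assumes k: "k \<le> n" and i: "i \<in> {1..n}"
  shows "is_diff n (root_at n (twisted_word n w) (k * n + Suc (place i)))
    (label (start i + int k)) (label (start i + int i + int k))"
proof -
  obtain rest where tw: "twisted_word n w = block_word k @ map (vee n ^^ k) w @ rest"
    using twisted_word_block[OF k] .
  let ?t = "place i" and ?v = "map (vee n ^^ k) (take (place i) w)"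
  have t: "?t < n" "?t < length w" using place_less[OF i] length_w by auto
  let ?a = "w ! ?t"
  have a: "?a \<in> index_set n" using w_index t by simp
  have tk: "take (k * n + ?t) (twisted_word n w) = block_word k @ ?v"
    unfolding tw using t by (simp add: length_block_word take_map length_w)
  have nt: "twisted_word n w ! (k * n + ?t) = (vee n ^^ k) ?a"
    unfolding tw using t by (simp add: length_block_word nth_append)
  have sv: "set (take ?t w) \<subseteq> index_set n" using set_w set_take_subset by (metis order_trans)
  have sb: "set (block_word k) \<subseteq> index_set n"
    using set_w signed_refl_vee_power[OF n3] by (auto simp: block_word_def)
  have s: "set (block_word k @ ?v) \<subseteq> index_set n"
    using sb sv signed_refl_vee_power[OF n3] by auto
  have f: "foldr (signed_refl n) (block_word k @ ?v) ((flip n ^^ k) z) = (coxeter ^^ k) (prefix ?t z)" for z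
    by (simp add: foldr_signed_refl_vee_power[OF n3 sv] foldr_block_word prefix_def)
  have "is_diff n (root_at n (twisted_word n w) (Suc (k * n + ?t)))
     ((coxeter ^^ k) (left_end i)) ((coxeter ^^ k) (right_end i))"
    using is_diff_word[OF n3 s, of "(vee n ^^ k) ?a"] signed_refl_vee_power[OF n3 a, of k]
    by (simp only: root_at_Suc tk nt f left_end_def right_end_def head_index_place[OF i])
  then show ?thesis using i by (simp add: left_end_label right_end_label label_power)
qed

end

section \<open>Positive roots as pairs of labels\<close>

lemma is_diff_swap: "is_diff n v s t \<Longrightarrow> is_diff n v (- t) (- s)"
proof -
  assume d: "is_diff n v s t"
  then have "s \<noteq> 0" "t \<noteq> 0" by (auto simp: is_diff_def)
  then have "eps (- t) a - eps (- s) a = eps s a - eps t a" for a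
    by (auto simp: eps_def signed_delta_def)
  then show ?thesis using d by (auto simp: is_diff_def)
qed

lemma is_diff_uminus: "is_diff n v s t \<Longrightarrow> is_diff n (\<lambda>j. - v j) t s"
proof -
  assume d: "is_diff n v s t"
  then have "ecoord n v a = eps s a - eps t a" for a by (simp add: is_diff_def)
  moreover have "ecoord n (\<lambda>j. - v j) a = - ecoord n v a" for a by (auto simp: ecoord_def)
  ultimately show ?thesis using d by (auto simp: is_diff_def)
qed

text \<open>
  A root has exactly two presentations as a difference. If two presentations shared no index, their inner
  product could not be 2.
\<close>

lemma is_diff_unique:
  assumes "is_diff n v s t" "is_diff n v s' t'"
  shows "(s = s' \<and> t = t') \<or> (s = - t' \<and> t = - s')"
proof -
  have "signed_delta s s' - signed_delta s t' - signed_delta t s' + signed_delta t t' = 2"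
    using inner_form_diff[OF assms] inner_form_self[OF assms(1)] by simp
  moreover have st: "\<bar>s\<bar> \<noteq> \<bar>t\<bar>" "\<bar>s'\<bar> \<noteq> \<bar>t'\<bar>" using assms by (auto simp: is_diff_def)
  moreover have zero: "signed_delta a b = 0" if "\<bar>a\<bar> \<noteq> \<bar>b\<bar>" for a b using that by (auto simp: signed_delta_def)
  moreover have one: "signed_delta a b = 1 \<Longrightarrow> a = b" "signed_delta a b = - 1 \<Longrightarrow> a = - b" "signed_delta a b \<le> 1" "- 1 \<le> signed_delta a b" for a b
    by (auto simp: signed_delta_def split: if_splits)
  consider "\<bar>s\<bar> = \<bar>s'\<bar>" | "\<bar>s\<bar> = \<bar>t'\<bar>" | "\<bar>s\<bar> \<noteq> \<bar>s'\<bar>" "\<bar>s\<bar> \<noteq> \<bar>t'\<bar>" by blast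
  then show ?thesis
  proof cases
    case 1
    then have "signed_delta s t' = 0" "signed_delta t s' = 0" using zero st by auto
    then have "signed_delta s s' = 1" "signed_delta t t' = 1"
      using calculation(1) one(3)[of s s'] one(3)[of t t'] by linarith+
    then show ?thesis using one(1) by blast
  next
    case 2
    then have "signed_delta s s' = 0" "signed_delta t t' = 0" using zero st by auto
    then have "signed_delta s t' = - 1" "signed_delta t s' = - 1"
      using calculation(1) one(4)[of s t'] one(4)[of t s'] by linarith+
    then show ?thesis using one(2) by blast
  next
    case 3
    then have z: "signed_delta s s' = 0" "signed_delta s t' = 0" using zero by auto
    have "signed_delta t s' = 0 \<or> signed_delta t t' = 0" using zero st(2) by metis
    then show ?thesis using calculation(1) z one(3)[of t t'] one(4)[of t s'] by linarith
  qed
qed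

lemma first_change: "\<not> P 0 \<Longrightarrow> P N \<Longrightarrow> \<exists>j<N. \<not> P j \<and> P (Suc j)"
proof (induction N)
  case (Suc N)
  then show ?case by (cases "P N") (auto intro: less_SucI)
qed simp

lemma is_diff_nonzero:
  assumes "is_diff n v s t" shows "\<exists>j. v j \<noteq> 0"
proof (rule ccontr)
  assume "\<not> ?thesis"
  then have "v = (\<lambda>_. 0)" by auto
  then have "ecoord n v a = 0" for a by (simp add: ecoord_def)
  then have "inner_form n v v = 0" by (simp add: inner_form_def)
  then show False using inner_form_self[OF assms] by simp
qed

lemma positive_diff_uminus:
  "\<bar>s\<bar> \<noteq> \<bar>t\<bar> \<Longrightarrow> s \<noteq> 0 \<Longrightarrow> t \<noteq> 0 \<Longrightarrow> positive_diff (- s) (- t) \<longleftrightarrow> \<not> positive_diff s t"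
  unfolding positive_diff_def by linarith

lemma positive_diff_flip:
  assumes "\<bar>s\<bar> \<le> int n + 1" "\<bar>t\<bar> \<le> int n + 1"
  shows "positive_diff (flip n s) (flip n t) \<longleftrightarrow> positive_diff s t"
  using assms unfolding positive_diff_def flip_def by auto

context twisted_adapted
begin

lemma h_pos: "0 < h" by (simp add: h_def)

lemma label_minus_iff: "label x = - label y \<longleftrightarrow> x mod (2 * h) = (y + h) mod (2 * h)"
  using label_eq_iff[of x "y + h"] label_half[of y] by simp

lemma mod_eq_iff_ex: "x mod (2 * h) = y mod (2 * h) \<longleftrightarrow> (\<exists>q. x = y + 2 * h * q)"
  by (metis mod_eqE mod_mult_self2)

lemma label_abs_neq: "1 \<le> i \<Longrightarrow> i \<le> int n \<Longrightarrow> \<bar>label x\<bar> \<noteq> \<bar>label (x + i)\<bar>"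
proof
  assume i: "1 \<le> i" "i \<le> int n" and "\<bar>label x\<bar> = \<bar>label (x + i)\<bar>"
  then have "label (x + i) = label x \<or> label (x + i) = - label x" by linarith
  then obtain q where "i = 2 * h * q \<or> i = h + 2 * h * q"
    unfolding label_eq_iff label_minus_iff mod_eq_iff_ex by (auto simp: algebra_simps)
  then have "i = h * (2 * q) \<or> i = h * (1 + 2 * q)" by (auto simp: algebra_simps)
  then obtain z where z: "i = h * z" by blast
  then have "0 < z" using i h_pos by (metis less_le_trans zero_less_mult_pos zero_less_one)
  then have "h * 1 \<le> h * z" using h_pos by (intro mult_left_mono) auto
  then show False using z i h_def by linarith
qed

lemma small_multiple: "z = 2 * h * q \<Longrightarrow> \<bar>z\<bar> < 2 * h \<Longrightarrow> z = 0"
  using h_pos by (metis dvd_triv_left zdvd_imp_le abs_of_pos mult_pos_pos zero_less_numeral dvd_imp_le_int not_le abs_mult)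

lemma coxeter_label: "coxeter (label x) = label (x + 1)"
  using label_power[of x 1] by simp

text \<open>
  The roots that are positive and become negative under the inverse twisted Coxeter element are those of the
  first block. Following such a root through the word letter by letter, some letter makes it
  negative, and then it is the simple root of that letter.
\<close>

lemma crossing:
  assumes i: "1 \<le> i" "i \<le> n"
    and position: "positive_diff (label (x + 1)) (label (x + 1 + int i))"
    and neg: "\<not> positive_diff (label x) (label (x + int i))"
  shows "(x + 1) mod (2 * h) = start i mod (2 * h)"
proof -
  \<comment> \<open>The image of \<open>label y\<close> under the letters of \<open>w\<close> from position \<open>t\<close> on: at \<open>t = 0\<close> this is
    \<open>label (y + 1)\<close>, and at \<open>t = n\<close> it is \<open>label y\<close> up to the sign of the last coordinate.\<close>
  define G where "G y t = foldr (signed_refl n) (drop t w) (flip n (label y))" for y t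
  have idx: "w ! t \<in> index_set n" if "t < n" for t using that w_index length_w by simp
  have step: "G y t = signed_refl n (w ! t) (G y (Suc t))" if "t < n" for y t
    using that Cons_nth_drop_Suc[of t w] length_w unfolding G_def
    by (metis foldr_Cons comp_apply)
  have step': "G y (Suc t) = signed_refl n (w ! t) (G y t)" if "t < n" for y t
    using step[OF that] signed_refl_invol[OF n3 idx[OF that]] by simp
  have pre: "prefix t (G y t) = label (y + 1)" for y t
    using coxeter_label[of y] unfolding coxeter_def G_def prefix_def
    by (metis append_take_drop_id foldr_append comp_apply)
  have Gn: "G y n = flip n (label y)" for y by (simp add: G_def length_w)
  have rng: "1 \<le> \<bar>G y t\<bar> \<and> \<bar>G y t\<bar> \<le> int n + 1" if "t \<le> n" for y t
    using that
  proof (induction t rule: inc_induct)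
    case base
    then show ?case using label_range[of y] by (auto simp: Gn flip_def h_def)
  next
    case (step t)
    then show ?case using abs_signed_refl[OF n3 idx[of t]] \<open>\<And>y. t < n \<Longrightarrow> G y t = _\<close> by simp
  qed
  let ?y = "x + int i"
  have ne: "\<bar>G x t\<bar> \<noteq> \<bar>G ?y t\<bar>" for t
  proof
    assume "\<bar>G x t\<bar> = \<bar>G ?y t\<bar>"
    then have "G x t = G ?y t \<or> G x t = - G ?y t" by linarith
    then have "label (x + 1) = label (?y + 1) \<or> label (x + 1) = - label (?y + 1)"
      using pre[of t x] pre[of t ?y] prefix_minus by metis
    then have "\<bar>label (x + 1)\<bar> = \<bar>label (x + 1 + int i)\<bar>" by (auto simp: algebra_simps)
    then show False using label_abs_neq[of "int i" "x + 1"] i by simp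
  qed
  define Pos where "Pos t = positive_diff (G x t) (G ?y t)" for t
  have "Pos 0" using position pre[of 0 x] pre[of 0 ?y] by (simp add: Pos_def prefix_def algebra_simps)
  moreover have "\<not> Pos n"
    using neg positive_diff_flip[of "label x" n "label ?y"] label_range by (simp add: Pos_def Gn h_def)
  ultimately obtain t where t: "t < n" "Pos t" "\<not> Pos (Suc t)"
    using first_change[of "\<lambda>t. \<not> Pos t" n] by blast
  let ?a = "w ! t" and ?i = "orbit n (w ! t)"
  have io: "?i \<in> {1..n}" "place ?i = t" using orbit_w[of t] place_orbit[of t] t length_w by auto
  have le: "prefix t (head_index n ?a) = left_end ?i" "prefix t (tail_index n ?a) = right_end ?i"
    using io by (simp_all add: left_end_def right_end_def head_index_def)
  have "(G x t = head_index n ?a \<and> G ?y t = tail_index n ?a) \<or>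
      (G x t = - tail_index n ?a \<and> G ?y t = - head_index n ?a)"
    using positive_diff_signed_refl[OF n3 idx[OF t(1)], of "G x t" "G ?y t"]
      t rng[of t x] rng[of t ?y] ne[of t] step'[OF t(1)] by (simp add: Pos_def)
  then have "(label (x + 1) = left_end ?i \<and> label (?y + 1) = right_end ?i) \<or>
      (label (x + 1) = - right_end ?i \<and> label (?y + 1) = - left_end ?i)"
    using pre[of t x] pre[of t ?y] le prefix_minus by metis
  then have "(label (x + 1) = label (start ?i) \<and> label (?y + 1) = label (start ?i + int ?i)) \<or>
      (label (x + 1) = - label (start ?i + int ?i) \<and> label (?y + 1) = - label (start ?i))"
    using io left_end_label right_end_label by simp
  then show ?thesis
  proof
    assume "label (x + 1) = label (start ?i) \<and> label (?y + 1) = label (start ?i + int ?i)"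
    then obtain q q' where q: "x + 1 = start ?i + 2 * h * q" "?y + 1 = start ?i + int ?i + 2 * h * q'"
      unfolding label_eq_iff mod_eq_iff_ex by blast
    then have "int i - int ?i = 2 * h * (q' - q)" by (simp add: algebra_simps)
    then have "int i - int ?i = 0" by (rule small_multiple) (use i io in \<open>auto simp: h_def\<close>)
    then show ?thesis using q(1) by (auto simp: mod_eq_iff_ex)
  next
    assume "label (x + 1) = - label (start ?i + int ?i) \<and> label (?y + 1) = - label (start ?i)"
    then obtain q q' where q: "x + 1 = start ?i + int ?i + h + 2 * h * q" "?y + 1 = start ?i + h + 2 * h * q'"
      unfolding label_minus_iff mod_eq_iff_ex by blast
    then have "int i + int ?i = 2 * h * (q' - q)" by (simp add: algebra_simps)
    then have "int i + int ?i = 0" by (rule small_multiple) (use i io in \<open>auto simp: h_def\<close>)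
    then show ?thesis using i by simp
  qed
qed

text \<open>
  The pairs of labels of the roots in the twisted word: those of orbit \<open>y - x\<close> in the blocks
  \<open>0, \<dots>, n\<close>. Other pairs describe negative roots, or roots already listed.
\<close>

definition in_window :: "int \<Rightarrow> int \<Rightarrow> bool" where
  "in_window x y \<longleftrightarrow> 1 \<le> y - x \<and> y - x \<le> int n \<and> start (nat (y - x)) \<le> x \<and> x \<le> start (nat (y - x)) + int n"

lemma in_windowE:
  assumes "in_window x y"
  obtains i k where "1 \<le> i" "i \<le> n" "k \<le> n" "x = start i + int k" "y = start i + int i + int k"
    "nat (y - x) = i" "nat (x - start i) = k"
proof -
  define i k where "i = nat (y - x)" and "k = nat (x - start i)"
  have a: "1 \<le> y - x" "y - x \<le> int n" "start i \<le> x" "x \<le> start i + int n"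
    using assms unfolding in_window_def i_def by auto
  have ik: "int i = y - x" "int k = x - start i" using a by (simp_all add: i_def k_def)
  show ?thesis
    by (rule that[OF _ _ _ _ _ i_def[symmetric] k_def[symmetric]]) (use a ik in linarith)+
qed

lemma in_windowI: "1 \<le> i \<Longrightarrow> i \<le> n \<Longrightarrow> k \<le> n \<Longrightarrow> in_window (start i + int k) (start i + int i + int k)"
  by (simp add: in_window_def)

text \<open>
  Within one orbit of the twisted Coxeter element signs are antiperiodic, so a negative root in the window would
  force a change from negative to positive within the following \<open>h\<close> steps. By \<open>crossing\<close> this happens
  only at the start of the window and at its translates by multiples of \<open>2h\<close>, which are too far away.
\<close>

lemma in_window_positive:
  assumes "in_window x y"
  shows "positive_diff (label x) (label y)"
proof (rule ccontr)
  obtain i k where ik: "1 \<le> i" "i \<le> n" "k \<le> n" "x = start i + int k" "y = start i + int i + int k"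
    using in_windowE[OF assms] by metis
  define Pos where "Pos z = positive_diff (label z) (label (z + int i))" for z
  assume "\<not> positive_diff (label x) (label y)"
  then have "\<not> Pos x" using ik by (simp add: Pos_def algebra_simps)
  moreover have "Pos (x + h) \<longleftrightarrow> \<not> Pos x"
  proof -
    have "label (x + h + int i) = - label (x + int i)" using label_half[of "x + int i"] by (simp add: algebra_simps)
    then show ?thesis unfolding Pos_def label_half
      using positive_diff_uminus label_abs_neq[of "int i" x] label_range[of x] label_range[of "x + int i"] ik by auto
  qed
  ultimately have "\<not> Pos (x + int 0)" "Pos (x + int (n + 1))" by (auto simp: h_def algebra_simps)
  then obtain j where j: "j < n + 1" "\<not> Pos (x + int j)" "Pos (x + int (Suc j))"
    using first_change[of "\<lambda>j. Pos (x + int j)" "n + 1"] by blast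
  have "(x + int j + 1) mod (2 * h) = start i mod (2 * h)"
    by (rule crossing[OF ik(1,2)]) (use j in \<open>auto simp: Pos_def algebra_simps\<close>)
  then obtain q where "x + int j + 1 = start i + 2 * h * q" unfolding mod_eq_iff_ex by blast
  then have "int k + int j + 1 = 2 * h * q" using ik by simp
  then have "int k + int j + 1 = 0" by (rule small_multiple) (use ik j in \<open>auto simp: h_def\<close>)
  then show False by simp
qed

text \<open>
  Counted from 0, as the positions in \<open>root_list\<close>.
\<close>

definition position :: "int \<Rightarrow> int \<Rightarrow> nat" where
  "position x y = nat (x - start (nat (y - x))) * n + place (nat (y - x))"

definition root_of :: "int \<Rightarrow> int \<Rightarrow> nat \<Rightarrow> int" where
  "root_of x y = root_at n (twisted_word n w) (Suc (position x y))"

definition xcoord :: "nat \<Rightarrow> int" where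
  "xcoord m = start (orbit n (w ! (m mod n))) + int (m div n)"

definition ycoord :: "nat \<Rightarrow> int" where
  "ycoord m = xcoord m + int (orbit n (w ! (m mod n)))"

lemma length_twisted: "length (twisted_word n w) = (n + 1) * n"
  using length_block_word[of "n + 1"] by (simp add: block_word_def twisted_word_def)

lemma root_of_diff: "in_window x y \<Longrightarrow> is_diff n (root_of x y) (label x) (label y)"
proof -
  assume "in_window x y"
  then obtain i k where ik: "1 \<le> i" "i \<le> n" "k \<le> n" "x = start i + int k" "y = start i + int i + int k"
      "nat (y - x) = i" "nat (x - start i) = k"
    using in_windowE by metis
  then have "position x y = k * n + place i" by (simp add: position_def)
  then show ?thesis using root_at_diff[of k i] ik(1-3) unfolding ik(4,5) root_of_def
    by simp
qed

lemma position_props: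
  assumes "in_window x y"
  shows "position x y < (n + 1) * n" "xcoord (position x y) = x" "ycoord (position x y) = y"
proof -
  obtain i k where ik: "1 \<le> i" "i \<le> n" "k \<le> n" "x = start i + int k" "y = start i + int i + int k"
      "nat (y - x) = i" "nat (x - start i) = k"
    using in_windowE[OF assms] by metis
  have p: "position x y = k * n + place i" using ik by (simp add: position_def)
  have pl: "place i < n" "orbit n (w ! place i) = i" using place_less place ik by auto
  have "k * n \<le> n * n" using ik(3) by (rule mult_le_mono1)
  moreover have "(n + 1) * n = n * n + n" by simp
  ultimately show "position x y < (n + 1) * n" using pl(1) p by linarith
  show "xcoord (position x y) = x" "ycoord (position x y) = y"
    unfolding xcoord_def ycoord_def p using pl ik(4,5) by simp_all
qed

lemma coords_window:
  assumes "m < (n + 1) * n"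
  shows "in_window (xcoord m) (ycoord m)" "position (xcoord m) (ycoord m) = m"
proof -
  have mm: "m mod n < n" using n3 by simp
  have k: "m div n \<le> n" using assms by (simp add: less_mult_imp_div_less less_Suc_eq_le[symmetric])
  have o: "orbit n (w ! (m mod n)) \<in> {1..n}" "place (orbit n (w ! (m mod n))) = m mod n"
    using orbit_w place_orbit length_w mm by auto
  show "in_window (xcoord m) (ycoord m)" using in_windowI[of "orbit n (w ! (m mod n))" "m div n"] k o
    by (simp add: xcoord_def ycoord_def algebra_simps)
  show "position (xcoord m) (ycoord m) = m" using o by (simp add: position_def xcoord_def ycoord_def)
qed

lemma window_range:
  assumes "in_window x y"
  shows "0 \<le> x" "y \<le> 2 * int n" "x < y" "y \<le> x + int n"
proof -
  obtain i k where ik: "1 \<le> i" "i \<le> n" "k \<le> n" "x = start i + int k" "y = start i + int i + int k"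
    using in_windowE[OF assms] by metis
  then show "0 \<le> x" "y \<le> 2 * int n" "x < y" "y \<le> x + int n" using start_nonneg[of i] by auto
qed

text \<open>
  The block number cannot decrease when both labels increase, because \<open>start i\<close> decreases and
  \<open>start i + i\<close> increases with \<open>i\<close>. If it stays the same, then one of the two labels is constant along all
  orbits in between, and this says that those orbits occur in the right order in \<open>w\<close>.
\<close>

lemma position_less:
  assumes a: "in_window x y" and b: "in_window x' y'"
    and le: "x \<le> x'" "y \<le> y'" and ne: "x \<noteq> x' \<or> y \<noteq> y'"
  shows "position x y < position x' y'"
proof -
  obtain i k where ik: "1 \<le> i" "i \<le> n" "k \<le> n" "x = start i + int k" "y = start i + int i + int k"
      "nat (y - x) = i" "nat (x - start i) = k"
    using in_windowE[OF a] by metis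
  obtain i' k' where ik': "1 \<le> i'" "i' \<le> n" "k' \<le> n" "x' = start i' + int k'" "y' = start i' + int i' + int k'"
      "nat (y' - x') = i'" "nat (x' - start i') = k'"
    using in_windowE[OF b] by metis
  have p: "position x y = k * n + place i" "position x' y' = k' * n + place i'" using ik ik' by (simp_all add: position_def)
  have pl: "place i < n" "place i' < n" using place_less ik ik' by auto
  have kk: "k \<le> k' \<and> (k = k' \<longrightarrow> place i < place i')"
  proof (cases "i \<le> i'")
    case True
    have start: "start i' \<le> start i" using start_mono[of i i'] ik ik' True by simp
    then have "k \<le> k'" using le ik ik' by simp
    moreover have "place i < place i'" if "k = k'"
    proof -
      have "i \<noteq> i'" using ne that ik ik' by auto
      then have i: "i < i'" using True by simp
      have e: "start i = start i'" using start that le(1) ik(4) ik'(4) by simp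
      have "j \<le> i' \<Longrightarrow> start j = start i \<and> (j \<noteq> i \<longrightarrow> place i < place j)" if "i \<le> j" for j
        using that
      proof (induction j rule: dec_induct)
        case (step j)
        have "start (Suc j) = start i"
          using start_mono[of i "Suc j"] start_mono[of "Suc j" i'] step ik ik' e by simp
        moreover have "start j = start i" using step by simp
        ultimately have "place j < place (Suc j)"
          using start_step[of j] step ik ik' by (auto split: if_splits)
        then show ?case using step \<open>start (Suc j) = start i\<close> by fastforce
      qed simp
      from this[of i'] show ?thesis using i by simp
    qed
    ultimately show ?thesis by blast
  next
    case False
    then have i: "i' < i" by simp
    have Y: "start i' + int i' \<le> start i + int i" using start_mono[of i' i] ik ik' i by simp
    then have "k \<le> k'" using le ik ik' by simp
    moreover have "place i < place i'" if "k = k'"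
    proof -
      have e: "start i + int i = start i' + int i'" using Y that le(2) ik(5) ik'(5) by simp
      have "j \<le> i \<Longrightarrow> start j + int j = start i' + int i' \<and> (j \<noteq> i' \<longrightarrow> place j < place i')" if "i' \<le> j" for j
        using that
      proof (induction j rule: dec_induct)
        case (step j)
        have "start (Suc j) + int (Suc j) = start i' + int i'"
          using start_mono[of i' "Suc j"] start_mono[of "Suc j" i] step ik ik' e by simp
        moreover have "start j + int j = start i' + int i'" using step by simp
        ultimately have "\<not> place j < place (Suc j)"
          using start_step[of j] step ik ik' by (auto split: if_splits)
        moreover have "place j \<noteq> place (Suc j)" using place_inj[of j "Suc j"] step ik ik' by auto
        ultimately show ?case using step \<open>start (Suc j) + int (Suc j) = start i' + int i'\<close> by fastforce
      qed simp
      from this[of i] show ?thesis using i by simp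
    qed
    ultimately show ?thesis by blast
  qed
  show ?thesis
  proof (cases "k = k'")
    case True then show ?thesis using kk p by simp
  next
    case False
    then have "Suc k \<le> k'" using kk by simp
    then have "Suc k * n \<le> k' * n" by (rule mult_le_mono1)
    then show ?thesis using p pl by simp
  qed
qed

text \<open>
  The window is convex for the product order, again by the opposite monotonicity of the two labels.
\<close>

lemma in_window_between:
  assumes a: "in_window x1 y1" and b: "in_window x2 y2"
    and le: "x1 \<le> x" "y1 \<le> y" "x \<le> x2" "y \<le> y2" and d: "1 \<le> y - x" "y - x \<le> int n"
  shows "in_window x y"
proof -
  define i i1 i2 where "i = nat (y - x)" "i1 = nat (y1 - x1)" "i2 = nat (y2 - x2)"
  have r: "1 \<le> i" "i \<le> n" "1 \<le> i1" "i1 \<le> n" "1 \<le> i2" "i2 \<le> n"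
    using a b d by (auto simp: i_i1_i2_def in_window_def)
  have y: "y = x + int i" "y1 = x1 + int i1" "y2 = x2 + int i2"
    using a b d by (auto simp: i_i1_i2_def in_window_def)
  have w: "start i1 \<le> x1" "x2 \<le> start i2 + int n" using a b by (auto simp: i_i1_i2_def in_window_def)
  have "start i \<le> x"
  proof (cases "i1 \<le> i")
    case True
    then show ?thesis using start_mono[of i1 i] r w le by auto
  next
    case False
    then show ?thesis using start_mono[of i i1] r w le y by auto
  qed
  moreover have "x \<le> start i + int n"
  proof (cases "i \<le> i2")
    case True
    then show ?thesis using start_mono[of i i2] r w le by auto
  next
    case False
    then show ?thesis using start_mono[of i2 i] r w le y by auto
  qed
  ultimately show ?thesis using d by (simp add: in_window_def i_i1_i2_def)
qed

text \<open>
  All labels of roots in the window lie between 0 and \<open>2n\<close>, which is less than a period. This is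
  what makes it possible to pass from signed indices back to integers.
\<close>

lemma label_window_inj:
  assumes "0 \<le> x" "x \<le> 2 * int n" "0 \<le> y" "y \<le> 2 * int n" "label x = label y"
  shows "x = y"
proof -
  obtain q where "x = y + 2 * h * q" using assms unfolding label_eq_iff mod_eq_iff_ex by blast
  then have "x - y = 2 * h * q" by simp
  then have "x - y = 0" by (rule small_multiple) (use assms in \<open>auto simp: h_def\<close>)
  then show ?thesis by simp
qed

lemma label_window_minus:
  assumes "0 \<le> x" "x \<le> 2 * int n" "0 \<le> y" "y \<le> 2 * int n" "label x = - label y"
  shows "x = y + h \<or> x = y - h"
proof -
  obtain q where q: "x = y + h + 2 * h * q" using assms unfolding label_minus_iff mod_eq_iff_ex by blast
  have "\<bar>x - y\<bar> < 2 * h" using assms by (simp add: h_def)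
  moreover have e: "x - y = h * (1 + 2 * q)" using q by (simp add: algebra_simps)
  ultimately have "h * \<bar>1 + 2 * q\<bar> < h * 2" using h_pos by (simp add: abs_mult)
  then have "\<bar>1 + 2 * q\<bar> < 2" using h_pos by (simp add: mult_less_cancel_left)
  then have "1 + 2 * q = 1 \<or> 1 + 2 * q = -1" by presburger
  then have "x - y = h * 1 \<or> x - y = h * (- 1)" using e by metis
  then show ?thesis by auto
qed

lemma root_of_inj:
  assumes "in_window x y" "in_window x' y'" "root_of x y = root_of x' y'"
  shows "x = x' \<and> y = y'"
proof -
  note r = window_range[OF assms(1)] window_range[OF assms(2)]
  have "(label x = label x' \<and> label y = label y') \<or> (label x = - label y' \<and> label y = - label x')"
    using is_diff_unique root_of_diff assms by metis
  then show ?thesis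
  proof
    assume "label x = label x' \<and> label y = label y'"
    then show ?thesis using label_window_inj r by (meson order_trans less_imp_le)
  next
    assume e: "label x = - label y' \<and> label y = - label x'"
    have "x = y' + h \<or> x = y' - h" by (rule label_window_minus) (use e r in auto)
    moreover have "y = x' + h \<or> y = x' - h" by (rule label_window_minus) (use e r in auto)
    ultimately show ?thesis using r by (auto simp: h_def)
  qed
qed

lemma root_of_nonneg: "in_window x y \<Longrightarrow> 0 \<le> root_of x y j"
  using positive_diff_nonneg[OF n3 root_of_diff in_window_positive] by blast

lemma set_twisted: "set (twisted_word n w) \<subseteq> index_set n"
  using set_w signed_refl_vee_power[OF n3] by (auto simp: twisted_word_def)

lemma root_of_positive: "in_window x y \<Longrightarrow> root_of x y \<in> positive_roots n"
proof -
  assume a: "in_window x y"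
  have "twisted_word n w ! position x y \<in> index_set n"
    using set_twisted position_props(1)[OF a] length_twisted nth_mem by fastforce
  moreover have "set (take (position x y) (twisted_word n w)) \<subseteq> index_set n"
    using set_twisted set_take_subset by fastforce
  ultimately have "root_of x y \<in> roots n" unfolding root_of_def root_at_Suc roots_def by blast
  then show ?thesis using root_of_nonneg[OF a] by (simp add: positive_roots_def)
qed

text \<open>
  Of the two presentations of a root, one has labels whose difference modulo \<open>2h\<close> is at most \<open>n\<close>.
\<close>

lemma root_differenceE:
  assumes "is_diff n v s t"
  obtains x i where "1 \<le> i" "i \<le> n" "is_diff n v (label x) (label (x + int i))"
proof -
  have "1 \<le> \<bar>s\<bar>" "\<bar>s\<bar> \<le> h" "1 \<le> \<bar>t\<bar>" "\<bar>t\<bar> \<le> h" and ne: "\<bar>s\<bar> \<noteq> \<bar>t\<bar>"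
    using assms by (auto simp: is_diff_def h_def)
  then obtain x y where xy: "label x = s" "label y = t" using label_surj by metis
  define d where "d = (y - x) mod (2 * h)"
  have d: "0 \<le> d" "d < 2 * h" using h_pos by (simp_all add: d_def)
  have y: "y mod (2 * h) = (x + d) mod (2 * h)" by (simp add: d_def mod_add_right_eq)
  then have ud: "label (x + d) = t" using xy label_cong by metis
  have "d \<noteq> 0" using ud xy ne by auto
  moreover have "d \<noteq> h" using ud xy ne label_half[of x] by auto
  ultimately have "(1 \<le> d \<and> d \<le> int n) \<or> (h + 1 \<le> d \<and> d \<le> h + int n)"
    using d unfolding h_def by auto
  then consider "1 \<le> d" "d \<le> int n" | "h + 1 \<le> d" "d \<le> h + int n" by blast
  then show ?thesis
  proof cases
    case 1
    then show ?thesis using that[of "nat d" x] assms xy ud by simp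
  next
    case 2
    have "label (x + d - h) = - t" using label_half[of "x + d - h"] ud by simp
    moreover have "label (x + d - h + (2 * h - d)) = - s" using label_half[of x] xy by (simp add: algebra_simps)
    moreover have "2 * h - d = int (nat (2 * h - d))" using d by simp
    ultimately show ?thesis using that[of "nat (2 * h - d)" "x + d - h"] is_diff_swap[OF assms] 2
      by (simp add: h_def)
  qed
qed

text \<open>
  Up to sign each root lies in the window, and the roots in the window are positive.
\<close>

lemma positive_root_window:
  assumes "\<beta> \<in> positive_roots n"
  obtains x y where "in_window x y" "\<beta> = root_of x y"
proof -
  obtain us i0 where "set us \<subseteq> index_set n" "i0 \<in> index_set n"
    "\<beta> = foldr (simple_reflection n) us (simple_root i0)"
    using assms by (auto simp: positive_roots_def roots_def)
  then obtain s t where "is_diff n \<beta> s t" using is_diff_word[OF n3] by metis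
  then obtain x i where i: "1 \<le> i" "i \<le> n" and d: "is_diff n \<beta> (label x) (label (x + int i))"
    using root_differenceE by metis
  \<comment> \<open>The distance from the start of the window. The second half of the period consists of negatives.\<close>
  define \<kappa> where "\<kappa> = (x - start i) mod (2 * h)"
  have \<kappa>: "0 \<le> \<kappa>" "\<kappa> < 2 * h" using h_pos by (simp_all add: \<kappa>_def)
  define q where "q = (x - start i) div (2 * h)"
  have "\<kappa> = x - start i - 2 * h * q" by (simp add: \<kappa>_def q_def minus_mult_div_eq_mod)
  then have q: "x = start i + \<kappa> + 2 * h * q" by simp
  have u1: "label x = label (start i + \<kappa>)" "label (x + int i) = label (start i + \<kappa> + int i)"
    unfolding label_eq_iff mod_eq_iff_ex by (rule exI[of _ q], simp add: q)+
  show ?thesis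
  proof (cases "\<kappa> < h")
    case True
    define k where "k = nat \<kappa>"
    have k: "k \<le> n" "\<kappa> = int k" using True \<kappa> by (auto simp: k_def h_def)
    have w: "in_window (start i + int k) (start i + int i + int k)" by (rule in_windowI[OF i k(1)])
    have "\<beta> = root_of (start i + int k) (start i + int i + int k)"
      by (rule is_diff_inj[OF n3 d]) (use root_of_diff[OF w] u1 k in \<open>simp add: algebra_simps\<close>)
    then show ?thesis using that w by blast
  next
    case False
    define k where "k = nat (\<kappa> - h)"
    have k: "k \<le> n" "\<kappa> = int k + h" using False \<kappa> by (auto simp: k_def h_def)
    have w: "in_window (start i + int k) (start i + int i + int k)" by (rule in_windowI[OF i k(1)])
    let ?\<rho> = "root_of (start i + int k) (start i + int i + int k)"
    have "label x = - label (start i + int k)" "label (x + int i) = - label (start i + int i + int k)"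
      using u1 k label_half[of "start i + int k"] label_half[of "start i + int i + int k"] by (simp_all add: algebra_simps)
    then have "is_diff n (\<lambda>j. - ?\<rho> j) (label x) (label (x + int i))"
      using is_diff_swap[OF is_diff_uminus[OF root_of_diff[OF w]]] by simp
    then have "\<beta> = (\<lambda>j. - ?\<rho> j)" using is_diff_inj[OF n3 d] by blast
    moreover have "0 \<le> \<beta> j" "0 \<le> ?\<rho> j" for j using assms root_of_nonneg[OF w] by (auto simp: positive_roots_def)
    ultimately have "\<beta> j = 0" for j by (metis antisym neg_le_0_iff_le)
    then show ?thesis using is_diff_nonzero[OF d] by simp
  qed
qed

text \<open>
  The folded coordinates are a linear change of coordinates away from the labels.
\<close>

lemma folded_coordinates_root_of:
  assumes a: "in_window x y"
  shows "folded_coordinates n w \<xi> (root_of x y) = (nat (y - x), \<xi> n + int n - (x + y))"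
  unfolding folded_coordinates_def
proof (rule the_equality)
  obtain i k where ik: "1 \<le> i" "i \<le> n" "k \<le> n" "x = start i + int k" "y = start i + int i + int k"
      "nat (y - x) = i" "nat (x - start i) = k"
    using in_windowE[OF a] by metis
  have p: "position x y = k * n + place i" using ik by (simp add: position_def)
  have pl: "place i < n" "orbit n (w ! place i) = i" using place_less place ik by auto
  show "\<exists>k\<in>{0..n}. \<exists>t\<in>{1..n}. root_of x y = root_at n (twisted_word n w) (k * n + t) \<and>
      (nat (y - x), \<xi> n + int n - (x + y)) =
      (orbit n (w ! (t - 1)), \<xi> (orbit n (w ! (t - 1))) - 2 * int k)"
    by (rule bexI[of _ k], rule bexI[of _ "Suc (place i)"])
      (use ik start_parity[of i] pl p in \<open>auto simp: root_of_def\<close>)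
next
  fix c
  assume "\<exists>k\<in>{0..n}. \<exists>t\<in>{1..n}. root_of x y = root_at n (twisted_word n w) (k * n + t) \<and>
      c = (orbit n (w ! (t - 1)), \<xi> (orbit n (w ! (t - 1))) - 2 * int k)"
  then obtain k t where kt: "k \<le> n" "1 \<le> t" "t \<le> n" "root_of x y = root_at n (twisted_word n w) (k * n + t)"
    "c = (orbit n (w ! (t - 1)), \<xi> (orbit n (w ! (t - 1))) - 2 * int k)" by auto
  define i where "i = orbit n (w ! (t - 1))"
  have i: "i \<in> {1..n}" "place i = t - 1" using orbit_w place_orbit kt length_w by (auto simp: i_def)
  have w: "in_window (start i + int k) (start i + int i + int k)" using in_windowI i kt by simp
  have "position (start i + int k) (start i + int i + int k) = k * n + (t - 1)" by (simp add: position_def i)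
  then have "root_of x y = root_of (start i + int k) (start i + int i + int k)"
    using kt by (simp add: root_of_def)
  then have "x = start i + int k \<and> y = start i + int i + int k" using root_of_inj a w by blast
  then show "c = (nat (y - x), \<xi> n + int n - (x + y))"
    using kt(5) start_parity[of i] i by (auto simp: i_def)
qed

end

section \<open>The bilexicographic order\<close>

lemma nth_before_iff:
  "distinct xs \<Longrightarrow> k < length xs \<Longrightarrow> l < length xs \<Longrightarrow> before (xs ! k) (xs ! l) xs \<longleftrightarrow> k < l"
  unfolding before_def by (metis distinct_conv_nth order_less_trans)

lemma bilex_less_iff:
  "bilex_less n js m m' \<longleftrightarrow> (\<exists>k s. k \<le> s \<and> s < length js \<and>
     (\<forall>t < length js. t < k \<or> s < t \<longrightarrow> m (root_list n js ! t) = m' (root_list n js ! t)) \<and>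
     m (root_list n js ! k) < m' (root_list n js ! k) \<and> m (root_list n js ! s) < m' (root_list n js ! s))"
proof
  assume "bilex_less n js m m'"
  then obtain k s where ks: "1 \<le> k" "k \<le> s" "s \<le> length js"
    "\<And>t. t \<in> {1..length js} \<Longrightarrow> t < k \<or> s < t \<Longrightarrow> m (root_at n js t) = m' (root_at n js t)"
    "m (root_at n js k) < m' (root_at n js k)" "m (root_at n js s) < m' (root_at n js s)"
    unfolding bilex_less_def by blast
  show "\<exists>k s. k \<le> s \<and> s < length js \<and>
     (\<forall>t < length js. t < k \<or> s < t \<longrightarrow> m (root_list n js ! t) = m' (root_list n js ! t)) \<and>
     m (root_list n js ! k) < m' (root_list n js ! k) \<and> m (root_list n js ! s) < m' (root_list n js ! s)"
  proof (intro exI conjI allI impI)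
    fix t assume t: "t < length js" "t < k - 1 \<or> s - 1 < t"
    then have "m (root_at n js (Suc t)) = m' (root_at n js (Suc t))" by (intro ks(4)) auto
    then show "m (root_list n js ! t) = m' (root_list n js ! t)" using t(1) by (simp add: nth_root_list)
  qed (use ks in \<open>auto simp: nth_root_list\<close>)
next
  assume "\<exists>k s. k \<le> s \<and> s < length js \<and>
     (\<forall>t < length js. t < k \<or> s < t \<longrightarrow> m (root_list n js ! t) = m' (root_list n js ! t)) \<and>
     m (root_list n js ! k) < m' (root_list n js ! k) \<and> m (root_list n js ! s) < m' (root_list n js ! s)"
  then obtain k s where ks: "k \<le> s" "s < length js"
    "\<And>t. t < length js \<Longrightarrow> t < k \<or> s < t \<Longrightarrow> m (root_list n js ! t) = m' (root_list n js ! t)"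
    "m (root_list n js ! k) < m' (root_list n js ! k)" "m (root_list n js ! s) < m' (root_list n js ! s)"
    by blast
  have e: "m (root_at n js t) = m' (root_at n js t)"
    if "1 \<le> t" "t \<le> length js" "t < Suc k \<or> Suc s < t" for t
  proof -
    have "m (root_list n js ! (t - 1)) = m' (root_list n js ! (t - 1))"
      by (rule ks(3)) (use that in auto)
    then show ?thesis using that nth_root_list[of "t - 1" js n] by simp
  qed
  show "bilex_less n js m m'" unfolding bilex_less_def
    by (rule exI[of _ "Suc k"], rule exI[of _ "Suc s"]) (use ks e in \<open>auto simp: nth_root_list\<close>)
qed

lemma wt_eq:
  assumes "distinct (root_list n js)"
  shows "wt n js m = (\<lambda>i. \<Sum>\<rho>\<in>set (root_list n js). int (m \<rho>) * \<rho> i)"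
proof
  fix i
  have "wt n js m i = (\<Sum>k\<in>{0..<length js}. int (m (root_list n js ! k)) * (root_list n js ! k) i)"
    unfolding wt_def
    by (rule sum.reindex_bij_witness[of _ Suc "\<lambda>k. k - 1"]) (auto simp: nth_root_list)
  also have "\<dots> = (\<Sum>\<rho>\<in>set (root_list n js). int (m \<rho>) * \<rho> i)"
    by (rule sum.reindex_bij_betw[OF bij_betw_nth]) (use assms in auto)
  finally show "wt n js m i = (\<Sum>\<rho>\<in>set (root_list n js). int (m \<rho>) * \<rho> i)" .
qed

lemma sum_root_sequence:
  assumes "finite R" "\<gamma> \<in> R"
  shows "(\<Sum>\<rho>\<in>R. int (root_sequence \<gamma> \<rho>) * \<rho> i) = \<gamma> i"
proof -
  have "(\<Sum>\<rho>\<in>R. int (root_sequence \<gamma> \<rho>) * \<rho> i) = (\<Sum>\<rho>\<in>R. if \<rho> = \<gamma> then \<gamma> i else 0)"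
    by (rule sum.cong) (auto simp: root_sequence_def)
  then show ?thesis using assms by simp
qed

lemma sum_pair_sequence:
  assumes "finite R" "\<alpha> \<in> R" "\<beta> \<in> R" "\<alpha> \<noteq> \<beta>"
  shows "(\<Sum>\<rho>\<in>R. int (pair_sequence \<alpha> \<beta> \<rho>) * \<rho> i) = \<alpha> i + \<beta> i"
proof -
  have "(\<Sum>\<rho>\<in>R. int (pair_sequence \<alpha> \<beta> \<rho>) * \<rho> i) =
      (\<Sum>\<rho>\<in>R. (if \<rho> = \<alpha> then \<alpha> i else 0) + (if \<rho> = \<beta> then \<beta> i else 0))"
    using assms(4) by (intro sum.cong) (auto simp: pair_sequence_def)
  then show ?thesis using assms by (simp add: sum.distrib)
qed

text \<open>
  Below a pair in the bilexicographic order there are only the pair with one root removed and the sequences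
  that live strictly between its two roots.
\<close>

lemma bilex_less_pair:
  assumes d: "distinct (root_list n js)" and b: "before \<alpha> \<beta> (root_list n js)"
    and l: "bilex_less n js m (pair_sequence \<alpha> \<beta>)"
  shows "(\<exists>\<delta>\<in>set (root_list n js). m \<delta> = 0 \<and>
        (\<forall>\<rho>\<in>set (root_list n js). pair_sequence \<alpha> \<beta> \<rho> = m \<rho> + root_sequence \<delta> \<rho>)) \<or>
      (\<forall>\<rho>\<in>set (root_list n js). m \<rho> \<noteq> 0 \<longrightarrow> before \<alpha> \<rho> (root_list n js) \<and> before \<rho> \<beta> (root_list n js))"
proof -
  let ?r = "root_list n js"
  obtain a c where ac: "a < c" "c < length js" "?r ! a = \<alpha>" "?r ! c = \<beta>"
    using b by (auto simp: before_def)
  have val: "pair_sequence \<alpha> \<beta> (?r ! t) = (if t = a \<or> t = c then 1 else 0)" if "t < length js" for t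
    using that ac d nth_eq_iff_index_eq[of ?r t a] nth_eq_iff_index_eq[of ?r t c]
    by (auto simp: pair_sequence_def)
  obtain k s where ks: "k \<le> s" "s < length js"
    "\<And>t. t < length js \<Longrightarrow> t < k \<or> s < t \<Longrightarrow> m (?r ! t) = pair_sequence \<alpha> \<beta> (?r ! t)"
    "m (?r ! k) < pair_sequence \<alpha> \<beta> (?r ! k)" "m (?r ! s) < pair_sequence \<alpha> \<beta> (?r ! s)"
    using l unfolding bilex_less_iff by blast
  have k: "k = a \<or> k = c" "m (?r ! k) = 0" "pair_sequence \<alpha> \<beta> (?r ! k) = 1"
    using ks val[of k] by (auto split: if_splits)
  have s: "s = a \<or> s = c" "m (?r ! s) = 0"
    using ks val[of s] by (auto split: if_splits)
  show ?thesis
  proof (cases "k = s")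
    case True
    have "pair_sequence \<alpha> \<beta> (?r ! t) = m (?r ! t) + root_sequence (?r ! k) (?r ! t)" if "t < length js" for t
    proof (cases "t = k")
      case True
      then show ?thesis using k by (simp add: root_sequence_def)
    next
      case False
      then have "m (?r ! t) = pair_sequence \<alpha> \<beta> (?r ! t)" using \<open>k = s\<close> by (intro ks(3)[OF that]) auto
      moreover have "?r ! t \<noteq> ?r ! k" using that False \<open>k = s\<close> ks(2) d by (simp add: nth_eq_iff_index_eq)
      ultimately show ?thesis by (simp add: root_sequence_def)
    qed
    then have "\<forall>\<rho>\<in>set ?r. pair_sequence \<alpha> \<beta> \<rho> = m \<rho> + root_sequence (?r ! k) \<rho>"
      by (metis in_set_conv_nth length_root_list)
    moreover have "?r ! k \<in> set ?r" using ks by simp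
    ultimately show ?thesis using k(2) by blast
  next
    case False
    then have kc: "k = a" "s = c" using k s ks(1) ac(1) by auto
    have "a < t \<and> t < c" if "t < length js" "m (?r ! t) \<noteq> 0" for t
    proof (rule ccontr)
      assume "\<not> (a < t \<and> t < c)"
      then consider "t < k" | "s < t" | "t = k" | "t = s" using kc by linarith
      then show False
        using that k s ks(3)[OF that(1)] val[OF that(1)] kc ac(1) by cases auto
    qed
    then have "\<forall>t<length js. m (?r ! t) \<noteq> 0 \<longrightarrow> before \<alpha> (?r ! t) ?r \<and> before (?r ! t) \<beta> ?r"
      using nth_before_iff[OF d] ac by (metis length_root_list order_less_trans)
    then show ?thesis by (metis in_set_conv_nth length_root_list)
  qed
qed

lemma bilex_less_root_pair:
  assumes "before \<delta> \<gamma> (root_list n js)" "before \<gamma> \<delta>' (root_list n js)" and d: "distinct (root_list n js)"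
  shows "bilex_less n js (root_sequence \<gamma>) (pair_sequence \<delta> \<delta>')"
proof -
  let ?r = "root_list n js"
  obtain a c where ac: "a < c" "c < length js" "?r ! a = \<delta>" "?r ! c = \<gamma>"
    using assms by (auto simp: before_def)
  obtain c' e where ce: "c' < e" "e < length js" "?r ! c' = \<gamma>" "?r ! e = \<delta>'"
    using assms by (auto simp: before_def)
  have idx: "?r ! t = ?r ! t' \<longleftrightarrow> t = t'" if "t < length js" "t' < length js" for t t'
    using that d nth_eq_iff_index_eq[of ?r t t'] by simp
  have c: "c = c'" using idx[of c c'] ac ce by simp
  have v: "root_sequence \<gamma> (?r ! t) = (if t = c then 1 else 0)"
    "pair_sequence \<delta> \<delta>' (?r ! t) = (if t = a \<or> t = e then 1 else 0)" if "t < length js" for t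
    unfolding root_sequence_def pair_sequence_def
    using that idx[of t a] idx[of t c] idx[of t e] ac ce c by simp_all
  show ?thesis unfolding bilex_less_iff
    by (intro exI[of _ a] exI[of _ e]) (use ac ce c v in auto)
qed

lemma bilex_less_pair_pair:
  assumes "before \<alpha> \<delta> (root_list n js)" "before \<delta> \<delta>' (root_list n js)" "before \<delta>' \<beta> (root_list n js)"
    and d: "distinct (root_list n js)"
  shows "bilex_less n js (pair_sequence \<delta> \<delta>') (pair_sequence \<alpha> \<beta>)"
proof -
  let ?r = "root_list n js"
  obtain a c where ac: "a < c" "c < length js" "?r ! a = \<alpha>" "?r ! c = \<delta>"
    using assms by (auto simp: before_def)
  obtain c' e where ce: "c' < e" "e < length js" "?r ! c' = \<delta>" "?r ! e = \<delta>'"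
    using assms by (auto simp: before_def)
  obtain e' g where eg: "e' < g" "g < length js" "?r ! e' = \<delta>'" "?r ! g = \<beta>"
    using assms by (auto simp: before_def)
  have idx: "?r ! t = ?r ! t' \<longleftrightarrow> t = t'" if "t < length js" "t' < length js" for t t'
    using that d nth_eq_iff_index_eq[of ?r t t'] by simp
  have c: "c = c'" "e = e'" using idx[of c c'] idx[of e e'] ac ce eg by simp_all
  have v: "pair_sequence \<delta> \<delta>' (?r ! t) = (if t = c \<or> t = e then 1 else 0)"
    "pair_sequence \<alpha> \<beta> (?r ! t) = (if t = a \<or> t = g then 1 else 0)" if "t < length js" for t
    unfolding pair_sequence_def
    using that idx[of t a] idx[of t c] idx[of t e] idx[of t g] ac ce eg c by simp_all
  show ?thesis unfolding bilex_less_iff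
    by (intro exI[of _ a] exI[of _ g]) (use ac ce eg c v in auto)
qed

section \<open>Words sorted by a label\<close>

text \<open>
  Equal or non-commuting letters have orbits that differ by at most one.
\<close>

lemma orbit_adjacent:
  assumes "n \<ge> 3" "a \<in> index_set n" "b \<in> index_set n" "a = b \<or> adjacent n a b"
  shows "\<bar>int (orbit n a) - int (orbit n b)\<bar> \<le> 1"
  using assms(4) unfolding adjacent_iff[OF assms(1-3)] using assms(1) by (auto simp: orbit_def)

context twisted_adapted
begin

abbreviation tw :: "nat list" where "tw \<equiv> twisted_word n w"

text \<open>
  By \<open>root_of_positive\<close> and \<open>positive_root_window\<close> these are the positive roots.
\<close>

definition base_roots :: "(nat \<Rightarrow> int) set" where "base_roots = set (root_list n tw)"

lemma nth_root_list_tw: "m < (n + 1) * n \<Longrightarrow> root_list n tw ! m = root_of (xcoord m) (ycoord m)"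
  using nth_root_list[of m tw n] coords_window[of m] by (simp add: length_twisted root_of_def)

lemma root_list_tw: "root_list n tw = map (\<lambda>m. root_of (xcoord m) (ycoord m)) [0..<(n + 1) * n]"
  by (rule nth_equalityI) (use nth_root_list_tw in \<open>auto simp: length_twisted\<close>)

lemma distinct_root_list_tw: "distinct (root_list n tw)"
proof -
  have "inj_on (\<lambda>m. root_of (xcoord m) (ycoord m)) {0..<(n + 1) * n}"
  proof (rule inj_onI)
    fix m m' assume a: "m \<in> {0..<(n + 1) * n}" "m' \<in> {0..<(n + 1) * n}"
      "root_of (xcoord m) (ycoord m) = root_of (xcoord m') (ycoord m')"
    then have "xcoord m = xcoord m' \<and> ycoord m = ycoord m'"
      using root_of_inj coords_window(1) by (meson atLeastLessThan_iff)
    then show "m = m'" using coords_window(2) a by (metis atLeastLessThan_iff)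
  qed
  then show ?thesis by (simp add: root_list_tw distinct_map)
qed

lemma nth_position: "in_window x y \<Longrightarrow> root_list n tw ! position x y = root_of x y"
  using nth_root_list_tw position_props by simp

lemma base_roots_eq: "base_roots = {root_of x y |x y. in_window x y}"
proof
  show "base_roots \<subseteq> {root_of x y |x y. in_window x y}"
    unfolding base_roots_def root_list_tw using coords_window(1) by fastforce
  show "{root_of x y |x y. in_window x y} \<subseteq> base_roots"
  proof clarify
    fix x y assume a: "in_window x y"
    show "root_of x y \<in> base_roots" unfolding base_roots_def
      using nth_position[OF a] position_props(1)[OF a] nth_mem[of "position x y" "root_list n tw"]
      by (simp add: length_twisted)
  qed
qed

lemma before_tw:
  assumes "in_window x y" "in_window x' y'"
  shows "before (root_of x y) (root_of x' y') (root_list n tw) \<longleftrightarrow> position x y < position x' y'"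
  using nth_before_iff[OF distinct_root_list_tw, of "position x y" "position x' y'"]
    nth_position assms position_props(1) by (simp add: length_twisted)

lemma precedes_iff: "precedes n tw \<alpha> \<beta> \<longleftrightarrow> before \<alpha> \<beta> (root_list n tw)"
proof
  assume "precedes n tw \<alpha> \<beta>"
  then obtain k l where "1 \<le> k" "k < l" "l \<le> length tw" "\<alpha> = root_at n tw k" "\<beta> = root_at n tw l"
    by (auto simp: precedes_def)
  then show "before \<alpha> \<beta> (root_list n tw)" unfolding before_def
    by (intro exI[of _ "k - 1"] exI[of _ "l - 1"]) (auto simp: nth_root_list)
next
  assume "before \<alpha> \<beta> (root_list n tw)"
  then obtain k l where "k < l" "l < length tw" "root_list n tw ! k = \<alpha>" "root_list n tw ! l = \<beta>"
    by (auto simp: before_def)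
  then show "precedes n tw \<alpha> \<beta>" unfolding precedes_def
    by (intro exI[of _ "Suc k"] exI[of _ "Suc l"]) (auto simp: nth_root_list)
qed

lemma wt_tw: "wt n tw m = (\<lambda>i. \<Sum>\<rho>\<in>base_roots. int (m \<rho>) * \<rho> i)"
  unfolding base_roots_def by (rule wt_eq[OF distinct_root_list_tw])

lemma finite_base_roots: "finite base_roots" by (simp add: base_roots_def)

lemma class_root_list:
  assumes "js \<in> commutation_class n tw"
  shows "distinct (root_list n js)" "set (root_list n js) = base_roots"
    "before x y (root_list n tw) \<Longrightarrow> inner_form n x y \<noteq> 0 \<Longrightarrow> before x y (root_list n js)"
proof -
  note c = commutation_class_root_list[OF n3 set_twisted assms]
  then have "mset (root_list n js) = mset (root_list n tw)" by blast
  then show "distinct (root_list n js)" "set (root_list n js) = base_roots"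
    using distinct_root_list_tw by (auto simp: base_roots_def dest: mset_eq_setD mset_eq_imp_distinct_iff)
  show "before x y (root_list n tw) \<Longrightarrow> inner_form n x y \<noteq> 0 \<Longrightarrow> before x y (root_list n js)"
    using c by blast
qed

lemma flip_power_small: "\<bar>s\<bar> \<le> int n \<Longrightarrow> (flip n ^^ k) s = s"
  by (induction k) (auto simp: flip_def)

lemma orbit_tw:
  assumes "m < (n + 1) * n"
  shows "tw ! m \<in> index_set n" "int (orbit n (tw ! m)) = ycoord m - xcoord m"
proof -
  show "tw ! m \<in> index_set n" using set_twisted assms length_twisted nth_mem by fastforce
  have k: "m div n \<le> n" using assms by (simp add: less_mult_imp_div_less less_Suc_eq_le[symmetric])
  have t: "m mod n < n" using n3 by simp
  obtain rest where tw: "tw = block_word (m div n) @ map (vee n ^^ (m div n)) w @ rest"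
    using twisted_word_block[OF k] .
  have "(block_word k @ map (vee n ^^ k) w @ rest) ! (k * n + t) = (vee n ^^ k) (w ! t)"
    if "t < n" for k t
    using that by (simp add: length_block_word nth_append length_w)
  then have "tw ! (m div n * n + m mod n) = (vee n ^^ (m div n)) (w ! (m mod n))"
    unfolding tw using t by blast
  then have "tw ! m = (vee n ^^ (m div n)) (w ! (m mod n))" by simp
  moreover have "w ! (m mod n) \<in> index_set n" "orbit n (w ! (m mod n)) \<in> {1..n}"
    using w_index orbit_w t length_w by auto
  ultimately have "head_index n (tw ! m) = head_index n (w ! (m mod n))"
    using signed_refl_vee_power[OF n3] flip_power_small by (simp add: head_index_def)
  then show "int (orbit n (tw ! m)) = ycoord m - xcoord m" by (simp add: head_index_def ycoord_def)
qed

text \<open>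
  The labels of two occurrences of equal or non-commuting letters are comparable in the product order,
  because their differences \<open>y - x\<close> differ by at most one. So such occurrences are never inverted when sorting by
  one of the labels.
\<close>

lemma sorted_word_in_class:
  assumes f: "f = xcoord \<or> f = ycoord"
  shows "\<exists>js\<in>commutation_class n tw.
    root_list n js = map (\<lambda>m. root_of (xcoord m) (ycoord m)) (sort_key f [0..<(n + 1) * n])"
proof -
  let ?Z = "[0..<(n + 1) * n]" and ?ok = "\<lambda>p q. tw ! p \<noteq> tw ! q \<and> \<not> adjacent n (tw ! p) (tw ! q)"
  have "?ok m m'" if m: "m < m'" "m' < (n + 1) * n" and less: "f m' < f m" for m m'
  proof (rule ccontr)
    assume "\<not> ?ok m m'"
    then have "\<bar>int (orbit n (tw ! m)) - int (orbit n (tw ! m'))\<bar> \<le> 1"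
      using orbit_adjacent[OF n3] orbit_tw(1) m by (metis order_less_trans)
    then have d: "\<bar>(ycoord m - xcoord m) - (ycoord m' - xcoord m')\<bar> \<le> 1" using orbit_tw(2) m by simp
    have w: "in_window (xcoord m) (ycoord m)" "in_window (xcoord m') (ycoord m')"
      "position (xcoord m) (ycoord m) = m" "position (xcoord m') (ycoord m') = m'"
      using coords_window m by (meson order_less_trans)+
    have "position (xcoord m') (ycoord m') < position (xcoord m) (ycoord m)"
      by (rule position_less[OF w(2,1)]) (use d less f in auto)
    then show False using w m by simp
  qed
  then have "sorted_wrt (\<lambda>x y. f y < f x \<longrightarrow> ?ok x y) ?Z"
    by (auto simp: sorted_wrt_iff_nth_less)
  then have "(labelled_swap ?ok)\<^sup>*\<^sup>* ?Z (sort_key f ?Z)" by (rule labelled_swaps_sort)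
  moreover have "map ((!) tw) ?Z = tw" using length_twisted map_nth[of tw] by simp
  ultimately show ?thesis
    using labelled_swaps_root_list[of "(!) tw" n ?Z "sort_key f ?Z" "\<lambda>m. root_of (xcoord m) (ycoord m)"]
      root_list_tw by auto
qed

lemma sorted_word_before:
  assumes f: "f = xcoord \<or> f = ycoord"
    and rl: "root_list n js = map (\<lambda>m. root_of (xcoord m) (ycoord m)) (sort_key f [0..<(n + 1) * n])"
    and b: "before (root_of x y) (root_of x' y') (root_list n js)"
    and w: "in_window x y" "in_window x' y'"
  shows "f (position x y) \<le> f (position x' y')"
proof -
  let ?S = "sort_key f [0..<(n + 1) * n]"
  obtain k l where kl: "k < l" "l < length ?S" "root_of (xcoord (?S ! k)) (ycoord (?S ! k)) = root_of x y"
     "root_of (xcoord (?S ! l)) (ycoord (?S ! l)) = root_of x' y'"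
    using b unfolding rl before_def by (auto simp del: length_sort)
  have "?S ! k \<in> set ?S" "?S ! l \<in> set ?S" using kl by (meson nth_mem order_less_trans)+
  then have m: "?S ! k < (n + 1) * n" "?S ! l < (n + 1) * n" by auto
  then have "?S ! k = position x y" "?S ! l = position x' y'"
    using kl(3,4) root_of_inj[OF coords_window(1) w(1)] root_of_inj[OF coords_window(1) w(2)]
      coords_window(2) by metis+
  moreover have "sorted (map f ?S)" by simp
  ultimately have "map f ?S ! k \<le> map f ?S ! l"
    using kl(1,2) by (intro sorted_nth_mono) auto
  then have "f (?S ! k) \<le> f (?S ! l)" using kl(1,2) by (simp del: length_sort)
  then show ?thesis using \<open>?S ! k = position x y\<close> \<open>?S ! l = position x' y'\<close> by simp
qed

text \<open>
  In the word sorted by \<open>x\<close>, being between the two roots bounds \<open>x\<close>; in the word sorted by \<open>y\<close>, it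
  bounds \<open>y\<close>. The sequence cannot arise from the pair by removing a root, for reasons of weight.
\<close>

lemma support_in_box:
  assumes w: "in_window x1 y1" "in_window x2 y2" and lt: "before (root_of x1 y1) (root_of x2 y2) (root_list n tw)"
    and ip: "inner_form n (root_of x1 y1) (root_of x2 y2) \<noteq> 0"
    and c: "class_prec n tw m (pair_sequence (root_of x1 y1) (root_of x2 y2))"
    and xy: "in_window x y" and m: "m (root_of x y) \<noteq> 0"
  shows "x1 \<le> x \<and> x \<le> x2 \<and> y1 \<le> y \<and> y \<le> y2 \<and> (x, y) \<noteq> (x1, y1) \<and> (x, y) \<noteq> (x2, y2)"
proof -
  let ?\<alpha> = "root_of x1 y1" and ?\<beta> = "root_of x2 y2"
  have R: "root_of x y \<in> base_roots" using xy by (auto simp: base_roots_eq)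
  have bet: "before ?\<alpha> (root_of x y) (root_list n js) \<and> before (root_of x y) ?\<beta> (root_list n js)"
    if js: "js \<in> commutation_class n tw" for js
  proof -
    note cl = class_root_list[OF js]
    have "bilex_less n js m (pair_sequence ?\<alpha> ?\<beta>)" using c js by (simp add: class_prec_def)
    from bilex_less_pair[OF cl(1) cl(3)[OF lt ip] this]
    consider \<delta> where "\<delta> \<in> base_roots" "\<forall>\<rho>\<in>base_roots. pair_sequence ?\<alpha> ?\<beta> \<rho> = m \<rho> + root_sequence \<delta> \<rho>"
      | "\<forall>\<rho>\<in>base_roots. m \<rho> \<noteq> 0 \<longrightarrow> before ?\<alpha> \<rho> (root_list n js) \<and> before \<rho> ?\<beta> (root_list n js)"
      unfolding cl(2) by blast
    then show ?thesis
    proof cases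
      case 1
      \<comment> \<open>If \<open>m\<close> were the pair without its root \<open>\<delta>\<close>, then equality of weights would give \<open>\<delta> = 0\<close>.\<close>
      have "wt n tw m i = wt n tw (pair_sequence ?\<alpha> ?\<beta>) i" for i using c by (simp add: class_prec_def)
      then have "(\<Sum>\<rho>\<in>base_roots. int (m \<rho>) * \<rho> i) = (\<Sum>\<rho>\<in>base_roots. int (pair_sequence ?\<alpha> ?\<beta> \<rho>) * \<rho> i)" for i
        by (simp add: wt_tw)
      also have "(\<Sum>\<rho>\<in>base_roots. int (pair_sequence ?\<alpha> ?\<beta> \<rho>) * \<rho> i) =
          (\<Sum>\<rho>\<in>base_roots. int (m \<rho>) * \<rho> i + int (root_sequence \<delta> \<rho>) * \<rho> i)" for i
        using 1(2) by (intro sum.cong) (auto simp: algebra_simps)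
      finally have "\<delta> i = 0" for i
        using sum_root_sequence[OF finite_base_roots 1(1)] by (simp add: sum.distrib)
      moreover obtain x' y' where "in_window x' y'" "\<delta> = root_of x' y'" using 1(1) by (auto simp: base_roots_eq)
      ultimately show ?thesis using is_diff_nonzero[OF root_of_diff] by blast
    next
      case 2
      then show ?thesis using R m by blast
    qed
  qed
  have le: "f (position x1 y1) \<le> f (position x y) \<and> f (position x y) \<le> f (position x2 y2)" if f: "f = xcoord \<or> f = ycoord" for f
  proof -
    obtain js where js: "js \<in> commutation_class n tw"
      "root_list n js = map (\<lambda>m. root_of (xcoord m) (ycoord m)) (sort_key f [0..<(n + 1) * n])"
      using sorted_word_in_class[OF f] by blast
    show ?thesis using bet[OF js(1)] sorted_word_before[OF f js(2)] w xy by blast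
  qed
  have "tw \<in> commutation_class n tw" by (simp add: commutation_class_def)
  then have "position x1 y1 < position x y" "position x y < position x2 y2" using bet before_tw w xy by blast+
  then have "(x, y) \<noteq> (x1, y1)" "(x, y) \<noteq> (x2, y2)" by auto
  then show ?thesis using le[of xcoord] le[of ycoord] position_props(2,3) w xy by simp
qed

section \<open>Linear functionals from antiperiodic functions\<close>

lemma antiperiodic_extension:
  fixes f0 :: "int \<Rightarrow> int"
  shows "\<exists>f. (\<forall>x. f (x + h) = - f x) \<and> (\<forall>x. t \<le> x \<longrightarrow> x < t + h \<longrightarrow> f x = f0 x)"
proof -
  define f where "f x = (if even ((x - t) div h) then 1 else - 1) * f0 (t + (x - t) mod h)" for x
  have "f (x + h) = - f x" for x
  proof -
    have e: "x + h - t = (x - t) + h" by simp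
    have "(x + h - t) div h = (x - t) div h + 1" "(x + h - t) mod h = (x - t) mod h"
      unfolding e using h_pos div_add_self2[of h "x - t"] by simp_all
    then show ?thesis unfolding f_def by simp
  qed
  moreover have "f x = f0 x" if "t \<le> x" "x < t + h" for x
    using that by (simp add: f_def div_pos_pos_trivial mod_pos_pos_trivial)
  ultimately show ?thesis by blast
qed

text \<open>
  Antiperiodicity says that \<open>f\<close>, read as a function of signed indices, is odd, and so \<open>f\<close> prescribes
  the values of a linear functional on the coordinate vectors.
\<close>

lemma antiperiodic_functional:
  fixes f :: "int \<Rightarrow> int"
  assumes f: "\<And>x. f (x + h) = - f x"
  shows "\<exists>g. \<forall>v x y. is_diff n v (label x) (label y) \<longrightarrow> (\<Sum>a = 1..n + 1. ecoord n v a * g a) = f x - f y"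
proof -
  have f2: "f (x + 2 * h * q) = f x" for x q
  proof (induction q rule: int_induct[where k = 0])
    case (step1 i)
    have "f (x + 2 * h * (i + 1)) = f ((x + 2 * h * i + h) + h)" by (rule arg_cong[of _ _ f]) (simp add: algebra_simps)
    then show ?case using step1 by (simp only: f minus_minus)
  next
    case (step2 i)
    have "f (x + 2 * h * i) = f ((x + 2 * h * (i - 1) + h) + h)" by (rule arg_cong[of _ _ f]) (simp add: algebra_simps)
    then show ?case using step2 by (simp only: f minus_minus)
  qed simp
  define G where "G s = f (SOME x. label x = s)" for s
  have G: "G (label x) = f x" for x
  proof -
    have "label (SOME z. label z = label x) = label x" by (rule someI[of "\<lambda>z. label z = label x" x]) simp
    then obtain q where "(SOME z. label z = label x) = x + 2 * h * q" unfolding label_eq_iff mod_eq_iff_ex by blast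
    then show ?thesis by (simp add: G_def f2)
  qed
  have odd: "G (- s) = - G s" if s: "1 \<le> \<bar>s\<bar>" "\<bar>s\<bar> \<le> h" for s
  proof -
    obtain x where "label x = s" using label_surj[OF s] by blast
    then show ?thesis using G[of x] G[of "x + h"] label_half[of x] f[of x] by auto
  qed
  have coord: "(\<Sum>a = 1..n + 1. eps s a * G (int a)) = G s" if s: "1 \<le> \<bar>s\<bar>" "\<bar>s\<bar> \<le> h" for s
  proof -
    have "(\<Sum>a = 1..n + 1. eps s a * G (int a)) = (\<Sum>a = 1..n + 1. if a = nat \<bar>s\<bar> then G s else 0)"
    proof (rule sum.cong)
      fix a assume a: "a \<in> {1..n + 1}"
      show "eps s a * G (int a) = (if a = nat \<bar>s\<bar> then G s else 0)"
      proof (cases "a = nat \<bar>s\<bar>")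
        case True
        then consider "s = int a" | "s = - int a" by linarith
        then show ?thesis using True odd[OF s] a by cases (auto simp: eps_def signed_delta_def)
      next
        case False
        then show ?thesis using s by (auto simp: eps_def signed_delta_def)
      qed
    qed simp
    moreover have "nat \<bar>s\<bar> \<in> {1..n + 1}" using s by (auto simp: h_def)
    ultimately show ?thesis by simp
  qed
  show ?thesis
  proof (intro exI allI impI)
    fix v x y assume "is_diff n v (label x) (label y)"
    then have "ecoord n v = (\<lambda>a. eps (label x) a - eps (label y) a)" by (simp add: is_diff_def)
    then have "(\<Sum>a = 1..n + 1. ecoord n v a * G (int a)) =
        (\<Sum>a = 1..n + 1. eps (label x) a * G (int a)) - (\<Sum>a = 1..n + 1. eps (label y) a * G (int a))"
      by (simp only: left_diff_distrib sum_subtractf)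
    then show "(\<Sum>a = 1..n + 1. ecoord n v a * G (int a)) = f x - f y"
      using coord[OF label_range] G by simp
  qed
qed

lemma ecoord_sum: "finite R \<Longrightarrow> ecoord n (\<lambda>i. \<Sum>\<rho>\<in>R. c \<rho> * \<rho> i) a = (\<Sum>\<rho>\<in>R. c \<rho> * ecoord n \<rho> a)"
proof (induction R rule: finite_induct)
  case empty
  then show ?case by (simp add: ecoord_def)
next
  case (insert \<rho> R)
  then show ?case by (auto simp: ecoord_def algebra_simps)
qed

text \<open>
  A linear functional that is nonnegative on the support of a sequence and vanishes on its weight vanishes on
  the support.
\<close>

lemma separated_support:
  fixes f :: "int \<Rightarrow> int"
  assumes f: "\<And>x. f (x + h) = - f x" and g: "in_window x3 y3" "f x3 = f y3"
    and m: "wt n tw m = root_of x3 y3"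
    and le: "\<And>x y. in_window x y \<Longrightarrow> m (root_of x y) \<noteq> 0 \<Longrightarrow> f y \<le> f x"
    and xy: "in_window x y" "m (root_of x y) \<noteq> 0"
  shows "f x = f y"
proof -
  obtain G where "\<And>v x y. is_diff n v (label x) (label y) \<Longrightarrow> (\<Sum>a = 1..n + 1. ecoord n v a * G a) = f x - f y"
    using antiperiodic_functional[of f] f by metis
  define \<Phi> where "\<Phi> v = (\<Sum>a = 1..n + 1. ecoord n v a * G a)" for v
  have \<Phi>: "\<Phi> (root_of x y) = f x - f y" if "in_window x y" for x y
    unfolding \<Phi>_def by (rule \<open>\<And>v x y. is_diff n v (label x) (label y) \<Longrightarrow> _ v x y\<close>[OF root_of_diff[OF that]])
  have "(\<Sum>\<rho>\<in>base_roots. int (m \<rho>) * \<Phi> \<rho>) = (\<Sum>a = 1..n + 1. (\<Sum>\<rho>\<in>base_roots. int (m \<rho>) * ecoord n \<rho> a) * G a)"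
    unfolding \<Phi>_def sum_distrib_left sum_distrib_right by (subst sum.swap) (simp only: mult.assoc)
  also have "\<dots> = \<Phi> (wt n tw m)" unfolding \<Phi>_def wt_tw ecoord_sum[OF finite_base_roots] ..
  also have "\<dots> = 0" using m \<Phi>[OF g(1)] g(2) by simp
  finally have z: "(\<Sum>\<rho>\<in>base_roots. int (m \<rho>) * \<Phi> \<rho>) = 0" .
  have nn: "0 \<le> int (m \<rho>) * \<Phi> \<rho>" if "\<rho> \<in> base_roots" for \<rho>
  proof -
    obtain x y where "in_window x y" "\<rho> = root_of x y" using \<open>\<rho> \<in> base_roots\<close> by (auto simp: base_roots_eq)
    then show ?thesis using le[of x y] \<Phi>[of x y] by (cases "m \<rho> = 0") auto
  qed
  have "root_of x y \<in> base_roots" using xy by (auto simp: base_roots_eq)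
  then have "int (m (root_of x y)) * \<Phi> (root_of x y) = 0"
    using z sum_nonneg_eq_0_iff[OF finite_base_roots, of "\<lambda>\<rho>. int (m \<rho>) * \<Phi> \<rho>"] nn by simp
  then show ?thesis using xy \<Phi> by simp
qed

end

section \<open>Sums of two roots\<close>

lemma is_diff_add_cancel:
  assumes a: "is_diff n v s t" and b: "is_diff n v' t t'" and c: "is_diff n (v + v') s'' t''"
  shows "(s = s'' \<and> t' = t'') \<or> (s = - t'' \<and> t' = - s'')"
proof -
  have "inner_form n v v' = - 1"
    using inner_form_sum(1)[OF a b c] inner_form_self[OF a] inner_form_commute[of n v "v + v'"] inner_form_commute[of n v' v]
    by (simp add: inner_form_add_left)
  then have "signed_delta s t - signed_delta s t' - signed_delta t t + signed_delta t t' = - 1" using inner_form_diff[OF a b] by simp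
  then have "\<bar>s\<bar> \<noteq> \<bar>t'\<bar>" using a b by (auto simp: signed_delta_def is_diff_def split: if_splits)
  then have "is_diff n (v + v') s t'"
    using a b c by (auto simp: is_diff_def ecoord_add)
  then show ?thesis using is_diff_unique[OF _ c] by blast
qed

text \<open>
  The summands have inner product \<open>-1\<close>, so an index of one cancels an index of the other. The two
  remaining indices form the sum, in one of its two presentations.
\<close>

lemma is_diff_add_cases:
  assumes a: "is_diff n v s t" and b: "is_diff n v' s' t'" and c: "is_diff n (v + v') s'' t''"
  shows "(t = s' \<and> ((s = s'' \<and> t' = t'') \<or> (s = - t'' \<and> t' = - s''))) \<or>
    (s = t' \<and> ((s' = s'' \<and> t = t'') \<or> (s' = - t'' \<and> t = - s''))) \<or>
    (s = - s' \<and> ((t = - s'' \<and> t' = t'') \<or> (t = t'' \<and> t' = - s''))) \<or>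
    (t = - t' \<and> ((s = s'' \<and> s' = - t'') \<or> (s = - t'' \<and> s' = s'')))"
proof -
  have c': "is_diff n (v' + v) s'' t''" using c by (simp add: add.commute)
  have "inner_form n v v' = - 1"
    using inner_form_sum(1)[OF a b c] inner_form_self[OF a] inner_form_commute[of n v "v + v'"] inner_form_commute[of n v' v]
    by (simp add: inner_form_add_left)
  then have "signed_delta s s' - signed_delta s t' - signed_delta t s' + signed_delta t t' = - 1" using inner_form_diff[OF a b] by simp
  then consider "t = s'" | "s = t'" | "s = - s'" | "t = - t'"
    by (auto simp: signed_delta_def split: if_splits)
  then show ?thesis
  proof cases
    case 1 then show ?thesis using is_diff_add_cancel[OF a _ c] b by blast
  next
    case 2 then show ?thesis using is_diff_add_cancel[OF b _ c'] a by blast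
  next
    case 3
    then have "is_diff n v (- t) s'" using is_diff_swap[OF a] by simp
    from is_diff_add_cancel[OF this b c]
    have "(t = - s'' \<and> t' = t'') \<or> (t = t'' \<and> t' = - s'')" by force
    then show ?thesis using 3 by blast
  next
    case 4
    then have "is_diff n v' t (- s')" using is_diff_swap[OF b] by simp
    from is_diff_add_cancel[OF a this c]
    have "(s = s'' \<and> s' = - t'') \<or> (s = - t'' \<and> s' = s'')" by force
    then show ?thesis using 4 by blast
  qed
qed

context twisted_adapted
begin

text \<open>
  The relative positions of \<open>\<alpha> = (x1, y1)\<close>, \<open>\<beta> = (x2, y2)\<close> and \<open>\<gamma> = (x3, y3)\<close> in which the orbit of
  one root is the sum of the two other orbits. That root is \<open>\<gamma>\<close> in the first, \<open>\<alpha>\<close> in the second and \<open>\<beta>\<close>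
  in the third case.
\<close>

definition tight_triple :: "int \<Rightarrow> int \<Rightarrow> int \<Rightarrow> int \<Rightarrow> int \<Rightarrow> int \<Rightarrow> bool" where
  "tight_triple x1 y1 x2 y2 x3 y3 \<longleftrightarrow>
     (x1 = x3 \<and> y1 = x2 \<and> y2 = y3) \<or>
     (y1 = y3 \<and> x2 = x1 + h \<and> y2 = x3 + h) \<or>
     (x2 = x3 \<and> x1 = y3 - h \<and> y1 = y2 - h)"

text \<open>
  The relative position in which the three orbits add up to \<open>2h\<close>.
\<close>

definition loose_triple :: "int \<Rightarrow> int \<Rightarrow> int \<Rightarrow> int \<Rightarrow> int \<Rightarrow> int \<Rightarrow> bool" where
  "loose_triple x1 y1 x2 y2 x3 y3 \<longleftrightarrow> x1 = y3 - h \<and> y1 = x2 \<and> y2 = x3 + h"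

text \<open>
  If a left label reappears half a period later in the window, then the later root has the smaller orbit,
  because windows of larger orbits start earlier. The next lemma is the mirror image for right labels.
\<close>

lemma window_shift_up:
  assumes a: "in_window a b" and c: "in_window (a + h) d"
  shows "d - (a + h) < b - a"
proof (rule ccontr)
  assume "\<not> ?thesis"
  then have le: "nat (b - a) \<le> nat (d - (a + h))" by simp
  have "1 \<le> b - a" "d - (a + h) \<le> int n" using a c by (auto simp: in_window_def)
  then have "1 \<le> nat (b - a)" "nat (d - (a + h)) \<le> n" by linarith+
  then have "start (nat (d - (a + h))) \<le> start (nat (b - a))" using start_mono le by blast
  then show False using a c by (simp add: in_window_def h_def)
qed

lemma window_shift_up':
  assumes a: "in_window a b" and c: "in_window c (b + h)"
  shows "b - a < b + h - c"
proof (rule ccontr)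
  assume "\<not> ?thesis"
  then have le: "nat (b + h - c) \<le> nat (b - a)" by simp
  have "1 \<le> b + h - c" "b - a \<le> int n" using a c by (auto simp: in_window_def)
  then have "1 \<le> nat (b + h - c)" "nat (b - a) \<le> n" by linarith+
  then have "start (nat (b + h - c)) + int (nat (b + h - c)) \<le> start (nat (b - a)) + int (nat (b - a))"
    using start_mono le by blast
  then show False using a c by (simp add: in_window_def h_def)
qed

text \<open>
  Each cancellation between labels determines the labels up to shifts by \<open>h\<close>. The size of the window, or
  for the shifted configurations the two preceding lemmas, exclude the wrong shifts.
\<close>

lemma sum_of_roots_triple:
  assumes w: "in_window x1 y1" "in_window x2 y2" "in_window x3 y3"
    and sum: "root_of x1 y1 + root_of x2 y2 = root_of x3 y3"
  shows "tight_triple x1 y1 x2 y2 x3 y3 \<or> tight_triple x2 y2 x1 y1 x3 y3 \<or>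
    loose_triple x1 y1 x2 y2 x3 y3 \<or> loose_triple x2 y2 x1 y1 x3 y3"
proof -
  note r = window_range[OF w(1)] window_range[OF w(2)] window_range[OF w(3)]
  have eq: "label a = label b \<Longrightarrow> a = b" if "a \<in> {x1, y1, x2, y2, x3, y3}" "b \<in> {x1, y1, x2, y2, x3, y3}" for a b
    by (rule label_window_inj) (use that r in auto)
  have op: "label a = - label b \<Longrightarrow> a = b + h \<or> a = b - h"
    if "a \<in> {x1, y1, x2, y2, x3, y3}" "b \<in> {x1, y1, x2, y2, x3, y3}" for a b
    by (rule label_window_minus) (use that r in auto)
  have d: "is_diff n (root_of x1 y1 + root_of x2 y2) (label x3) (label y3)"
    unfolding sum by (rule root_of_diff[OF w(3)])
  have lt: "x1 < y1 \<and> x2 < y2 \<and> x3 < y3 \<and> y1 \<le> x1 + int n \<and> y2 \<le> x2 + int n \<and> y3 \<le> x3 + int n"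
    using r by simp
  from is_diff_add_cases[OF root_of_diff[OF w(1)] root_of_diff[OF w(2)] d]
  show ?thesis
  proof (elim disjE conjE)
    assume "label y1 = label x2" "label x1 = label x3" "label y2 = label y3"
    then have "y1 = x2" "x1 = x3" "y2 = y3" using eq[of y1 x2] eq[of x1 x3] eq[of y2 y3] by simp_all
    then show ?thesis by (simp add: tight_triple_def)
  next
    assume "label y1 = label x2" "label x1 = - label y3" "label y2 = - label x3"
    then have "y1 = x2" "x1 = y3 + h \<or> x1 = y3 - h" "y2 = x3 + h \<or> y2 = x3 - h" using eq[of y1 x2] op[of x1 y3] op[of y2 x3] by simp_all
    then have "loose_triple x1 y1 x2 y2 x3 y3" unfolding loose_triple_def using lt h_pos by linarith
    then show ?thesis by blast
  next
    assume "label x1 = label y2" "label x2 = label x3" "label y1 = label y3"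
    then have "x1 = y2" "x2 = x3" "y1 = y3" using eq[of x1 y2] eq[of x2 x3] eq[of y1 y3] by simp_all
    then show ?thesis by (simp add: tight_triple_def)
  next
    assume "label x1 = label y2" "label x2 = - label y3" "label y1 = - label x3"
    then have "x1 = y2" "x2 = y3 + h \<or> x2 = y3 - h" "y1 = x3 + h \<or> y1 = x3 - h" using eq[of x1 y2] op[of x2 y3] op[of y1 x3] by simp_all
    then have "loose_triple x2 y2 x1 y1 x3 y3" unfolding loose_triple_def using lt h_pos by linarith
    then show ?thesis by blast
  next
    assume "label x1 = - label x2" "label y1 = - label x3" "label y2 = label y3"
    then have e: "y2 = y3" "x1 = x2 + h \<or> x1 = x2 - h" "y1 = x3 + h \<or> y1 = x3 - h" using op[of x1 x2] op[of y1 x3] eq[of y2 y3] by simp_all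
    have "x1 \<noteq> x2 - h"
    proof
      assume x: "x1 = x2 - h"
      then have "y2 - x2 < y1 - x1" using window_shift_up[OF w(1), of y2] w(2) by simp
      then show False using x e lt h_def by linarith
    qed
    then have "tight_triple x2 y2 x1 y1 x3 y3"
      unfolding tight_triple_def using e lt h_def by linarith
    then show ?thesis by blast
  next
    assume "label x1 = - label x2" "label y1 = label y3" "label y2 = - label x3"
    then have e: "y1 = y3" "x1 = x2 + h \<or> x1 = x2 - h" "y2 = x3 + h \<or> y2 = x3 - h" using op[of x1 x2] eq[of y1 y3] op[of y2 x3] by simp_all
    have "x2 \<noteq> x1 - h"
    proof
      assume x: "x2 = x1 - h"
      then have "y1 - x1 < y2 - x2" using window_shift_up[OF w(2), of y1] w(1) by simp
      then show False using x e lt h_def by linarith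
    qed
    then have "tight_triple x1 y1 x2 y2 x3 y3"
      unfolding tight_triple_def using e lt h_def by linarith
    then show ?thesis by blast
  next
    assume "label y1 = - label y2" "label x1 = label x3" "label x2 = - label y3"
    then have e: "x1 = x3" "y1 = y2 + h \<or> y1 = y2 - h" "x2 = y3 + h \<or> x2 = y3 - h" using op[of y1 y2] eq[of x1 x3] op[of x2 y3] by simp_all
    have "y2 \<noteq> y1 + h"
    proof
      assume y: "y2 = y1 + h"
      then have "y1 - x1 < y2 - x2" using window_shift_up'[OF w(1), of x2] w(2) by simp
      then show False using y e lt h_def by linarith
    qed
    then have "tight_triple x2 y2 x1 y1 x3 y3"
      unfolding tight_triple_def using e lt h_def by linarith
    then show ?thesis by blast
  next
    assume "label y1 = - label y2" "label x1 = - label y3" "label x2 = label x3"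
    then have e: "x2 = x3" "y1 = y2 + h \<or> y1 = y2 - h" "x1 = y3 + h \<or> x1 = y3 - h" using op[of y1 y2] op[of x1 y3] eq[of x2 x3] by simp_all
    have "y1 \<noteq> y2 + h"
    proof
      assume y: "y1 = y2 + h"
      then have "y2 - x2 < y1 - x1" using window_shift_up'[OF w(2), of x1] w(1) by simp
      then show False using y e lt h_def by linarith
    qed
    then have "tight_triple x1 y1 x2 y2 x3 y3"
      unfolding tight_triple_def using e lt h_def by linarith
    then show ?thesis by blast
  qed
qed

section \<open>Functionals that separate a tight triple\<close>

text \<open>
  Here the labels of the rectangle lie within half a period. The function is \<open>0\<close> at \<open>x\<close>, \<open>z\<close> and
  \<open>y\<close>, positive before \<open>z\<close> and negative after it.
\<close>

lemma separating_adjacent: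
  assumes lt: "x < z" "z < y" "y \<le> x + int n"
  shows "\<exists>f :: int \<Rightarrow> int. (\<forall>c. f (c + h) = - f c) \<and> f x = f y \<and>
    (\<forall>a b. x \<le> a \<longrightarrow> a \<le> z \<longrightarrow> z \<le> b \<longrightarrow> b \<le> y \<longrightarrow> f b \<le> f a \<and>
      (f a = f b \<longrightarrow> (a = x \<or> a = z) \<and> (b = z \<or> b = y)))"
proof -
  define f0 :: "int \<Rightarrow> int" where
    "f0 c = (if c = x \<or> c = z then 0 else if c < z then 1 else if c < y then - 1 else 0)" for c
  obtain f where f: "\<forall>c. f (c + h) = - f c" "\<forall>c. x \<le> c \<longrightarrow> c < x + h \<longrightarrow> f c = f0 c"
    using antiperiodic_extension[of x f0] by blast
  have fa: "f a = (if a = x \<or> a = z then 0 else 1)" if "x \<le> a" "a \<le> z" for a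
    using that f(2) lt by (auto simp: f0_def h_def)
  have fb: "f b = (if b = z \<or> b = y then 0 else - 1)" if "z \<le> b" "b \<le> y" for b
    using that f(2) lt by (auto simp: f0_def h_def)
  show ?thesis
    by (rule exI[of _ f]) (use f(1) fa fb lt in auto)
qed

text \<open>
  Here the rectangle covers more than half a period, and the values beyond \<open>t + h\<close> are the negatives of those
  from \<open>t\<close> on. From \<open>y\<close> on, the function decreases to 1 at the end of the half period, so that differences of
  two values in this range and sums of any two values are positive. Before \<open>y\<close> it has the value \<open>f y\<close> at \<open>t\<close> and
  \<open>x\<close>, which makes it vanish on the three exceptional pairs, and a larger value elsewhere.
\<close>

lemma separating_shifted:
  assumes lt: "t < x" "x < y" "y \<le> t + int n"
  shows "\<exists>f :: int \<Rightarrow> int. (\<forall>c. f (c + h) = - f c) \<and> f x = f y \<and>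
    (\<forall>a b. t \<le> a \<longrightarrow> a \<le> t + h \<longrightarrow> y \<le> b \<longrightarrow> b \<le> x + h \<longrightarrow> a < b \<longrightarrow> b \<le> a + int n \<longrightarrow> f b \<le> f a \<and>
      (f a = f b \<longrightarrow> (a = t \<and> b = y) \<or> (a = t + h \<and> b = x + h) \<or> (a = x \<and> b = y)))"
proof -
  define T D where "T = t + h" and "D = T - y"
  define f0 :: "int \<Rightarrow> int" where
    "f0 c = (if c = t \<or> c = x then D else if c < y then D + 1 else T - c)" for c
  obtain f where f: "\<forall>c. f (c + h) = - f c" "\<forall>c. t \<le> c \<longrightarrow> c < t + h \<longrightarrow> f c = f0 c"
    using antiperiodic_extension[of t f0] by blast
  have D: "1 \<le> D" using lt by (simp add: D_def T_def h_def)
  have lo: "f c = (if c = t \<or> c = x then D else D + 1)" if "t \<le> c" "c < y" for c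
    using that f(2) lt by (auto simp: f0_def h_def)
  have hi: "f c = T - c" if "y \<le> c" "c < T" for c
    using that f(2) lt by (auto simp: f0_def T_def)
  have wrap: "f c = (if c = T \<or> c = x + h then - D else - D - 1)" if "T \<le> c" "c \<le> x + h" for c
    using lo[of "c - h"] f(1)[rule_format, of "c - h"] that lt by (auto simp: T_def)
  have "f b \<le> f a \<and> (f a = f b \<longrightarrow> (a = t \<and> b = y) \<or> (a = T \<and> b = x + h) \<or> (a = x \<and> b = y))"
    if ab: "t \<le> a" "a \<le> T" "y \<le> b" "b \<le> x + h" "a < b" "b \<le> a + int n" for a b
  proof (cases "b < T")
    case True
    have fb: "f b = T - b" using hi True ab by simp
    show ?thesis
    proof (cases "a < y")
      case True
      then show ?thesis using lo[of a] fb ab D_def by (auto split: if_splits)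
    next
      case False
      then show ?thesis using hi[of a] fb ab True by auto
    qed
  next
    case False
    have fb: "f b = (if b = T \<or> b = x + h then - D else - D - 1)" using wrap False ab by simp
    have at: "t < a" using False ab by (auto simp: T_def h_def)
    consider "a < y" | "y \<le> a" "a < T" | "a = T" using ab by linarith
    then show ?thesis
    proof cases
      case 1
      then have "1 \<le> f a" using lo[of a] D ab by auto
      then show ?thesis using fb D by auto
    next
      case 2
      then have "1 \<le> f a" using hi[of a] by auto
      then show ?thesis using fb D by auto
    next
      case 3
      then have "f a = - D" using wrap[of T] lt ab by auto
      then show ?thesis using fb D ab 3 by auto
    qed
  qed
  moreover have "f x = f y" using lo[of x] hi[of y] lt D D_def T_def by auto
  ultimately show ?thesis using f(1) unfolding T_def by blast
qed

text \<open>
  Reflecting the labels, \<open>(x, y)\<close> to \<open>(- y, - x)\<close>, exchanges the second and the third kind of tight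
  triple.
\<close>

lemma separating_functional:
  assumes w: "in_window x1 y1" "in_window x2 y2" "in_window x3 y3"
    and t: "tight_triple x1 y1 x2 y2 x3 y3"
  obtains f :: "int \<Rightarrow> int" where "\<And>c. f (c + h) = - f c" "f x3 = f y3"
    "\<And>a b. x1 \<le> a \<Longrightarrow> a \<le> x2 \<Longrightarrow> y1 \<le> b \<Longrightarrow> b \<le> y2 \<Longrightarrow> a < b \<Longrightarrow> b \<le> a + int n \<Longrightarrow> f b \<le> f a"
    "\<And>a b. x1 \<le> a \<Longrightarrow> a \<le> x2 \<Longrightarrow> y1 \<le> b \<Longrightarrow> b \<le> y2 \<Longrightarrow> a < b \<Longrightarrow> b \<le> a + int n \<Longrightarrow> f a = f b \<Longrightarrow>
      (a = x1 \<and> b = y1) \<or> (a = x2 \<and> b = y2) \<or> (a = x3 \<and> b = y3)"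
proof -
  note r = window_range[OF w(1)] window_range[OF w(2)] window_range[OF w(3)]
  from t consider (adjacent) "x1 = x3" "y1 = x2" "y2 = y3" | (up) "y1 = y3" "x2 = x1 + h" "y2 = x3 + h"
    | (down) "x2 = x3" "x1 = y3 - h" "y1 = y2 - h" unfolding tight_triple_def by blast
  then show ?thesis
  proof cases
    case adjacent
    have "x3 < x2" "x2 < y3" "y3 \<le> x3 + int n" using r adjacent by auto
    from separating_adjacent[OF this] obtain f :: "int \<Rightarrow> int" where
      "\<forall>c. f (c + h) = - f c" "f x3 = f y3"
      "\<forall>a b. x3 \<le> a \<longrightarrow> a \<le> x2 \<longrightarrow> x2 \<le> b \<longrightarrow> b \<le> y3 \<longrightarrow> f b \<le> f a \<and>
      (f a = f b \<longrightarrow> (a = x3 \<or> a = x2) \<and> (b = x2 \<or> b = y3))" by blast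
    note f = this
    have box: "f b \<le> f a \<and> (f a = f b \<longrightarrow>
        (a = x1 \<and> b = y1) \<or> (a = x2 \<and> b = y2) \<or> (a = x3 \<and> b = y3))"
      if "x1 \<le> a" "a \<le> x2" "y1 \<le> b" "b \<le> y2" "a < b" for a b
      using f(3)[rule_format, of a b] that adjacent by auto
    show ?thesis by (rule that[of f]) (use f(1,2) box in blast)+
  next
    case up
    have "x1 < x3" "x3 < y3" "y3 \<le> x1 + int n" using r up by auto
    from separating_shifted[OF this] obtain f :: "int \<Rightarrow> int" where
      f: "\<forall>c. f (c + h) = - f c" "f x3 = f y3"
      "\<forall>a b. x1 \<le> a \<longrightarrow> a \<le> x1 + h \<longrightarrow> y3 \<le> b \<longrightarrow> b \<le> x3 + h \<longrightarrow> a < b \<longrightarrow> b \<le> a + int n \<longrightarrow> f b \<le> f a \<and>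
      (f a = f b \<longrightarrow> (a = x1 \<and> b = y3) \<or> (a = x1 + h \<and> b = x3 + h) \<or> (a = x3 \<and> b = y3))" by blast
    show ?thesis by (rule that[of f]) (use f up in auto)
  next
    case down
    have "- y2 < - y3" "- y3 < - x3" "- x3 \<le> - y2 + int n" using r down by auto
    from separating_shifted[OF this] obtain f :: "int \<Rightarrow> int" where
      f: "\<forall>c. f (c + h) = - f c" "f (- y3) = f (- x3)"
      "\<forall>a b. - y2 \<le> a \<longrightarrow> a \<le> - y2 + h \<longrightarrow> - x3 \<le> b \<longrightarrow> b \<le> - y3 + h \<longrightarrow> a < b \<longrightarrow> b \<le> a + int n \<longrightarrow> f b \<le> f a \<and>
      (f a = f b \<longrightarrow> (a = - y2 \<and> b = - x3) \<or> (a = - y2 + h \<and> b = - y3 + h) \<or> (a = - y3 \<and> b = - x3))" by blast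
    define g where "g c = - f (- c)" for c
    have g: "g (c + h) = - g c" for c using f(1)[rule_format, of "- c - h"] by (simp add: g_def)
    have g3: "g x3 = g y3" using f(2) by (simp add: g_def)
    have box: "g b \<le> g a \<and> (g a = g b \<longrightarrow>
        (a = x1 \<and> b = y1) \<or> (a = x2 \<and> b = y2) \<or> (a = x3 \<and> b = y3))"
      if "x1 \<le> a" "a \<le> x2" "y1 \<le> b" "b \<le> y2" "a < b" "b \<le> a + int n" for a b
    proof -
      have F: "f (- a) \<le> f (- b) \<and> (f (- b) = f (- a) \<longrightarrow> (- b = - y2 \<and> - a = - x3) \<or>
          (- b = - y2 + h \<and> - a = - y3 + h) \<or> (- b = - y3 \<and> - a = - x3))"
        by (rule f(3)[rule_format]) (use that down in linarith)+
      moreover have "- b = - y2 + h \<longleftrightarrow> b = y1" "- a = - y3 + h \<longleftrightarrow> a = x1" using down by linarith+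
      ultimately show ?thesis using down(1) unfolding g_def by fastforce
    qed
    show ?thesis by (rule that[of g]) (use g g3 box in blast)+
  qed
qed

section \<open>Minimal pairs\<close>

lemma root_of_inner_form:
  assumes w: "in_window x1 y1" "in_window x2 y2" "in_window x3 y3"
    and sum: "root_of x1 y1 + root_of x2 y2 = root_of x3 y3"
  shows "inner_form n (root_of x1 y1) (root_of x3 y3) \<noteq> 0" "inner_form n (root_of x3 y3) (root_of x2 y2) \<noteq> 0"
    "inner_form n (root_of x1 y1) (root_of x2 y2) \<noteq> 0"
proof -
  have d: "is_diff n (root_of x1 y1 + root_of x2 y2) (label x3) (label y3)"
    unfolding sum by (rule root_of_diff[OF w(3)])
  note a = inner_form_sum[OF root_of_diff[OF w(1)] root_of_diff[OF w(2)] d]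
  show "inner_form n (root_of x1 y1) (root_of x3 y3) \<noteq> 0" "inner_form n (root_of x3 y3) (root_of x2 y2) \<noteq> 0"
    using a unfolding sum by simp_all
  have "inner_form n (root_of x1 y1) (root_of x1 y1) = 2" by (rule inner_form_self[OF root_of_diff[OF w(1)]])
  then show "inner_form n (root_of x1 y1) (root_of x2 y2) \<noteq> 0"
    using a(1) inner_form_commute inner_form_add_left by (metis add_cancel_right_right one_eq_numeral_iff semiring_norm(85) verit_eq_simplify(8))
qed

lemma wt_pair:
  assumes "in_window x1 y1" "in_window x2 y2" "(x1, y1) \<noteq> (x2, y2)"
  shows "wt n tw (pair_sequence (root_of x1 y1) (root_of x2 y2)) = root_of x1 y1 + root_of x2 y2"
proof -
  have "root_of x1 y1 \<noteq> root_of x2 y2" using root_of_inj assms by blast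
  moreover have "root_of x1 y1 \<in> base_roots" "root_of x2 y2 \<in> base_roots" using assms by (auto simp: base_roots_eq)
  ultimately show ?thesis using sum_pair_sequence[OF finite_base_roots] by (auto simp: wt_tw)
qed

lemma wt_root: "in_window x y \<Longrightarrow> wt n tw (root_sequence (root_of x y)) = root_of x y"
  using sum_root_sequence[OF finite_base_roots, of "root_of x y"] by (auto simp: wt_tw base_roots_eq)

lemma class_prec_root_pair:
  assumes w: "in_window x1 y1" "in_window x2 y2" "in_window x3 y3"
    and sum: "root_of x1 y1 + root_of x2 y2 = root_of x3 y3"
    and lt: "position x1 y1 < position x3 y3" "position x3 y3 < position x2 y2"
  shows "class_prec n tw (root_sequence (root_of x3 y3)) (pair_sequence (root_of x1 y1) (root_of x2 y2))"
proof -
  have "(x1, y1) \<noteq> (x2, y2)" using lt by auto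
  then have "wt n tw (root_sequence (root_of x3 y3)) = wt n tw (pair_sequence (root_of x1 y1) (root_of x2 y2))"
    using wt_root wt_pair w sum by simp
  moreover have "bilex_less n js (root_sequence (root_of x3 y3)) (pair_sequence (root_of x1 y1) (root_of x2 y2))"
    if js: "js \<in> commutation_class n tw" for js
    using bilex_less_root_pair class_root_list[OF js] root_of_inner_form[OF w sum] before_tw w lt by blast
  ultimately show ?thesis by (simp add: class_prec_def)
qed

lemma tight_triple_order:
  assumes w: "in_window x1 y1" "in_window x2 y2" "in_window x3 y3" and t: "tight_triple x1 y1 x2 y2 x3 y3"
  shows "position x1 y1 < position x3 y3" "position x3 y3 < position x2 y2"
proof -
  note r = window_range[OF w(1)] window_range[OF w(2)] window_range[OF w(3)]
  have "x1 \<le> x3 \<and> y1 \<le> y3 \<and> (x1 \<noteq> x3 \<or> y1 \<noteq> y3) \<and> x3 \<le> x2 \<and> y3 \<le> y2 \<and> (x3 \<noteq> x2 \<or> y3 \<noteq> y2)"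
    using t r unfolding tight_triple_def h_def by auto
  then show "position x1 y1 < position x3 y3" "position x3 y3 < position x2 y2"
    using position_less w by blast+
qed

text \<open>
  A sequence between \<open>\<gamma>\<close> and \<open>(\<alpha>, \<beta>)\<close> has support in the rectangle, so the separating functional
  forces it to be a multiple of \<open>\<gamma>\<close>. Its weight makes it \<open>\<gamma>\<close>, which is not below itself.
\<close>

lemma tight_triple_minimal:
  assumes w: "in_window x1 y1" "in_window x2 y2" "in_window x3 y3"
    and sum: "root_of x1 y1 + root_of x2 y2 = root_of x3 y3" and t: "tight_triple x1 y1 x2 y2 x3 y3"
  shows "minimal_pair n tw (root_of x1 y1) (root_of x2 y2) (root_of x3 y3)"
proof -
  let ?\<alpha> = "root_of x1 y1" and ?\<beta> = "root_of x2 y2" and ?\<gamma> = "root_of x3 y3"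
  note lt = tight_triple_order[OF w t]
  have b: "before ?\<alpha> ?\<beta> (root_list n tw)" using before_tw w lt by simp
  have False if m: "class_prec n tw (root_sequence ?\<gamma>) m" "class_prec n tw m (pair_sequence ?\<alpha> ?\<beta>)" for m
  proof -
    note box = support_in_box[OF w(1,2) b root_of_inner_form(3)[OF w sum] m(2)]
    obtain f :: "int \<Rightarrow> int" where f: "\<And>c. f (c + h) = - f c" "f x3 = f y3"
      "\<And>a b. x1 \<le> a \<Longrightarrow> a \<le> x2 \<Longrightarrow> y1 \<le> b \<Longrightarrow> b \<le> y2 \<Longrightarrow> a < b \<Longrightarrow> b \<le> a + int n \<Longrightarrow> f b \<le> f a"
      "\<And>a b. x1 \<le> a \<Longrightarrow> a \<le> x2 \<Longrightarrow> y1 \<le> b \<Longrightarrow> b \<le> y2 \<Longrightarrow> a < b \<Longrightarrow> b \<le> a + int n \<Longrightarrow> f a = f b \<Longrightarrow>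
        (a = x1 \<and> b = y1) \<or> (a = x2 \<and> b = y2) \<or> (a = x3 \<and> b = y3)"
      using separating_functional[OF w t] by blast
    have wtm: "wt n tw m = ?\<gamma>" using m(1) wt_root[OF w(3)] by (simp add: class_prec_def)
    have only: "x = x3 \<and> y = y3" if xy: "in_window x y" "m (root_of x y) \<noteq> 0" for x y
    proof -
      have "f x = f y"
      proof (rule separated_support[OF f(1) w(3) f(2) wtm _ xy])
        fix x y assume "in_window x y" "m (root_of x y) \<noteq> 0"
        then show "f y \<le> f x" using box[of x y] f(3)[of x y] window_range[of x y] by auto
      qed
      then show ?thesis using box[OF xy] f(4)[of x y] window_range[OF xy(1)] by auto
    qed
    have other: "m \<rho> = 0" if \<rho>: "\<rho> \<in> base_roots" "\<rho> \<noteq> ?\<gamma>" for \<rho>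
    proof -
      obtain x y where "in_window x y" "\<rho> = root_of x y" using \<rho>(1) unfolding base_roots_eq by blast
      then show ?thesis using only[of x y] \<rho>(2) by blast
    qed
    have "?\<gamma> i = (\<Sum>\<rho>\<in>base_roots. if \<rho> = ?\<gamma> then int (m ?\<gamma>) * ?\<gamma> i else 0)" for i
    proof -
      have "?\<gamma> i = (\<Sum>\<rho>\<in>base_roots. int (m \<rho>) * \<rho> i)" using fun_cong[OF wtm, of i] by (simp add: wt_tw)
      also have "\<dots> = (\<Sum>\<rho>\<in>base_roots. if \<rho> = ?\<gamma> then int (m ?\<gamma>) * ?\<gamma> i else 0)"
      proof (rule sum.cong)
        fix \<rho> assume "\<rho> \<in> base_roots"
        then show "int (m \<rho>) * \<rho> i = (if \<rho> = ?\<gamma> then int (m ?\<gamma>) * ?\<gamma> i else 0)"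
          using other[of \<rho>] by (cases "\<rho> = ?\<gamma>") simp_all
      qed simp
      finally show ?thesis .
    qed
    moreover have "?\<gamma> \<in> base_roots" using w by (auto simp: base_roots_eq)
    ultimately have g: "?\<gamma> i = int (m ?\<gamma>) * ?\<gamma> i" for i using finite_base_roots by simp
    obtain i where "?\<gamma> i \<noteq> 0" using is_diff_nonzero[OF root_of_diff[OF w(3)]] by blast
    then have m1: "m ?\<gamma> = 1" using g[of i] by simp
    \<comment> \<open>To be larger than \<open>\<gamma>\<close> somewhere, \<open>m\<close> would need a second entry, or an entry 2 at \<open>\<gamma>\<close>.\<close>
    have "tw \<in> commutation_class n tw" by (simp add: commutation_class_def)
    then have "bilex_less n tw (root_sequence ?\<gamma>) m" using m(1) by (simp add: class_prec_def)
    then obtain k where k: "k < length tw" "root_sequence ?\<gamma> (root_list n tw ! k) < m (root_list n tw ! k)"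
      unfolding bilex_less_iff by (meson order_le_less_trans)
    then have "root_list n tw ! k \<in> base_roots" by (simp add: base_roots_def)
    then obtain x y where "in_window x y" "root_list n tw ! k = root_of x y" by (auto simp: base_roots_eq)
    then have "root_list n tw ! k = ?\<gamma>" using only[of x y] k(2) by auto
    then show False using k(2) m1 by (simp add: root_sequence_def)
  qed
  then show ?thesis unfolding minimal_pair_def
    using class_prec_root_pair[OF w sum lt] b precedes_iff by blast
qed

lemma inner_form_shared:
  assumes "is_diff n v s t" "is_diff n v' s t'" "t \<noteq> - t'"
  shows "inner_form n v v' \<noteq> 0"
proof -
  have "signed_delta s s = 1" by (simp add: signed_delta_def)
  moreover have "signed_delta s t' = 0" "signed_delta t s = 0"
    using assms(1,2) unfolding is_diff_def signed_delta_def by auto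
  moreover have "0 \<le> signed_delta t t'" using assms(3) by (simp add: signed_delta_def)
  ultimately show ?thesis using inner_form_diff[OF assms(1,2)] by simp
qed

text \<open>
  The roots with labels \<open>(x, z)\<close> and \<open>(z, y)\<close> add up to \<open>\<gamma>\<close> as well. They lie between \<open>\<alpha>\<close> and
  \<open>\<beta>\<close> in every word of the class because the first shares the label \<open>z\<close> with \<open>\<alpha>\<close>, the second shares it with
  \<open>\<beta>\<close>, and so neither of these two pairs of roots is orthogonal.
\<close>

lemma loose_triple_not_minimal:
  assumes w: "in_window x1 y1" "in_window x2 y2" "in_window x3 y3"
    and sum: "root_of x1 y1 + root_of x2 y2 = root_of x3 y3" and t: "loose_triple x1 y1 x2 y2 x3 y3"
  shows "\<not> minimal_pair n tw (root_of x1 y1) (root_of x2 y2) (root_of x3 y3)"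
proof -
  define x y z where "x = x3" and "y = y3" and "z = x2"
  have e: "x3 = x" "y3 = y" "x1 = y - h" "y1 = z" "x2 = z" "y2 = x + h"
    using t by (auto simp: x_def y_def z_def loose_triple_def)
  note w = w[unfolded e] and sum = sum[unfolded e]
  note r = window_range[OF w(1)] window_range[OF w(2)] window_range[OF w(3)]
  have lt: "x < z" "z < y" "y \<le> x + int n" using r h_def by auto
  have w4: "in_window x z" by (rule in_window_between[OF w(1) w(2)]) (use lt r h_def in auto)
  have w5: "in_window z y" by (rule in_window_between[OF w(1) w(2)]) (use lt r h_def in auto)
  let ?\<alpha> = "root_of (y - h) z" and ?\<beta> = "root_of z (x + h)" and ?\<gamma> = "root_of x y"
  let ?\<delta> = "root_of x z" and ?\<delta>' = "root_of z y"
  note d = root_of_diff[OF w(1)] root_of_diff[OF w(2)] root_of_diff[OF w(3)] root_of_diff[OF w4] root_of_diff[OF w5]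
  have sum': "?\<delta> + ?\<delta>' = ?\<gamma>"
  proof -
    have "is_diff n (?\<delta> + ?\<delta>') (label x) (label y)"
      using d(3-5) by (auto simp: is_diff_def ecoord_add)
    then show ?thesis using is_diff_inj[OF n3 _ d(3)] by blast
  qed
  have p: "position (y - h) z < position x z" "position x z < position x y" "position x y < position z y" "position z y < position z (x + h)"
    using position_less[OF w(1) w4] position_less[OF w4 w(3)] position_less[OF w(3) w5] position_less[OF w5 w(2)] lt r h_def by auto
  have ne: "\<bar>label y\<bar> \<noteq> \<bar>label x\<bar>" using label_abs_neq[of "y - x" x] lt by auto
  have uh: "label (y - h) = - label y" "label (x + h) = - label x" using label_half[of "y - h"] label_half[of x] by auto
  have ip1: "inner_form n ?\<alpha> ?\<delta> \<noteq> 0"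
    by (rule inner_form_shared[OF is_diff_swap[OF d(1)] is_diff_swap[OF d(4)]]) (use ne uh in auto)
  have ip2: "inner_form n ?\<delta>' ?\<beta> \<noteq> 0"
    by (rule inner_form_shared[OF d(5) d(2)]) (use ne uh in auto)
  have "bilex_less n js (pair_sequence ?\<delta> ?\<delta>') (pair_sequence ?\<alpha> ?\<beta>)"
    if js: "js \<in> commutation_class n tw" for js
  proof -
    note c = class_root_list[OF js]
    have "before ?\<alpha> ?\<delta> (root_list n js)" "before ?\<delta>' ?\<beta> (root_list n js)" "before ?\<delta> ?\<delta>' (root_list n js)"
      using c(3) ip1 ip2 root_of_inner_form(3)[OF w4 w5 w(3) sum'] before_tw w w4 w5 p by (meson order_less_trans)+
    then show ?thesis using bilex_less_pair_pair c(1) by blast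
  qed
  moreover have "wt n tw (pair_sequence ?\<delta> ?\<delta>') = wt n tw (pair_sequence ?\<alpha> ?\<beta>)"
    using wt_pair[OF w4 w5] wt_pair[OF w(1,2)] sum sum' lt r by auto
  ultimately have "class_prec n tw (pair_sequence ?\<delta> ?\<delta>') (pair_sequence ?\<alpha> ?\<beta>)"
    by (simp add: class_prec_def)
  moreover have "class_prec n tw (root_sequence ?\<gamma>) (pair_sequence ?\<delta> ?\<delta>')"
    by (rule class_prec_root_pair[OF w4 w5 w(3) sum' p(2,3)])
  moreover have "is_sequence n (pair_sequence ?\<delta> ?\<delta>')"
    using root_of_positive w4 w5 by (auto simp: is_sequence_def pair_sequence_def)
  ultimately show ?thesis unfolding minimal_pair_def e by blast
qed

lemma loose_triple_order:
  assumes w: "in_window x1 y1" "in_window x2 y2" and t: "loose_triple x1 y1 x2 y2 x3 y3"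
  shows "position x1 y1 < position x2 y2"
  using position_less[OF w] t window_range[OF w(1)] window_range[OF w(2)] by (auto simp: loose_triple_def)

lemma minimal_pair_iff_tight:
  assumes w: "in_window x1 y1" "in_window x2 y2" "in_window x3 y3"
    and sum: "root_of x1 y1 + root_of x2 y2 = root_of x3 y3"
  shows "minimal_pair n tw (root_of x1 y1) (root_of x2 y2) (root_of x3 y3) \<longleftrightarrow> tight_triple x1 y1 x2 y2 x3 y3"
proof
  assume m: "minimal_pair n tw (root_of x1 y1) (root_of x2 y2) (root_of x3 y3)"
  then have p: "position x1 y1 < position x2 y2"
    using precedes_iff before_tw[OF w(1,2)] by (auto simp: minimal_pair_def)
  have "\<not> loose_triple x1 y1 x2 y2 x3 y3" using loose_triple_not_minimal[OF w sum] m by blast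
  moreover have "\<not> loose_triple x2 y2 x1 y1 x3 y3" using loose_triple_order[OF w(2,1)] p by fastforce
  moreover have "\<not> tight_triple x2 y2 x1 y1 x3 y3" using tight_triple_order[OF w(2,1,3)] p by fastforce
  ultimately show "tight_triple x1 y1 x2 y2 x3 y3" using sum_of_roots_triple[OF w sum] by blast
qed (rule tight_triple_minimal[OF w sum])

text \<open>
  For a tight triple the formulas are immediate. Conversely they exclude the loose triples by the sum of the
  orbits, and the exchanged tight ones because \<open>q < p\<close> says that the first root comes first.
\<close>

lemma tight_triple_iff_coordinates:
  assumes w: "in_window x1 y1" "in_window x2 y2" "in_window x3 y3"
    and sum: "root_of x1 y1 + root_of x2 y2 = root_of x3 y3"
    and i: "i = y1 - x1" and j: "j = y2 - x2" and k: "k = y3 - x3"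
    and l: "l \<in> {i, j, k}" "i \<le> l" "j \<le> l" "k \<le> l"
    and q: "q = (x3 + y3) - (x2 + y2)" and p: "p = (x3 + y3) - (x1 + y1)"
  shows "tight_triple x1 y1 x2 y2 x3 y3 \<longleftrightarrow> i + j + k = 2 * l \<and>
     (l = k \<longrightarrow> q = - i \<and> p = j) \<and>
     (l = i \<longrightarrow> q = i - 2 * h \<and> p = j) \<and>
     (l = j \<longrightarrow> q = - i \<and> p = 2 * h - j)"
proof -
  note r = window_range[OF w(1)] window_range[OF w(2)] window_range[OF w(3)]
  have ijk: "1 \<le> i" "1 \<le> j" "1 \<le> k" "i \<le> int n" "j \<le> int n" "k \<le> int n"
    using r i j k by simp_all
  show ?thesis
  proof
    assume "tight_triple x1 y1 x2 y2 x3 y3"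
    then consider (adjacent) "x1 = x3" "y1 = x2" "y2 = y3" | (up) "y1 = y3" "x2 = x1 + h" "y2 = x3 + h"
      | (down) "x2 = x3" "x1 = y3 - h" "y1 = y2 - h" unfolding tight_triple_def by blast
    then show "i + j + k = 2 * l \<and> (l = k \<longrightarrow> q = - i \<and> p = j) \<and>
     (l = i \<longrightarrow> q = i - 2 * h \<and> p = j) \<and> (l = j \<longrightarrow> q = - i \<and> p = 2 * h - j)"
    proof cases
      case adjacent
      then have "k = i + j" using i j k by simp
      then have "l = k" "l \<noteq> i" "l \<noteq> j" using l ijk by auto
      then show ?thesis using adjacent i j k q p by simp
    next
      case up
      then have "i = j + k" using i j k by simp
      then have "l = i" "l \<noteq> k" "l \<noteq> j" using l ijk by auto
      then show ?thesis using up i j k q p by simp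
    next
      case down
      then have "j = i + k" using i j k by simp
      then have "l = j" "l \<noteq> k" "l \<noteq> i" using l ijk by auto
      then show ?thesis using down i j k q p by simp
    qed
  next
    assume a: "i + j + k = 2 * l \<and> (l = k \<longrightarrow> q = - i \<and> p = j) \<and>
     (l = i \<longrightarrow> q = i - 2 * h \<and> p = j) \<and> (l = j \<longrightarrow> q = - i \<and> p = 2 * h - j)"
    have ln: "l \<le> int n" using l(1) ijk by blast
    from l(1) consider "l = i" | "l = j" | "l = k" by blast
    then have pq: "q < p"
    proof cases
      case 1 then have "q = i - 2 * h" "p = j" using a by auto
      then show ?thesis using ijk h_def by linarith
    next
      case 2 then have "q = - i" "p = 2 * h - j" using a by auto
      then show ?thesis using ijk h_def by linarith
    next
      case 3 then have "q = - i" "p = j" using a by auto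
      then show ?thesis using ijk by linarith
    qed
    have "\<not> loose_triple x1 y1 x2 y2 x3 y3" "\<not> loose_triple x2 y2 x1 y1 x3 y3"
      unfolding loose_triple_def using a ln i j k h_def by linarith+
    moreover have "\<not> tight_triple x2 y2 x1 y1 x3 y3"
      unfolding tight_triple_def using pq q p r h_def by linarith
    ultimately show "tight_triple x1 y1 x2 y2 x3 y3" using sum_of_roots_triple[OF w sum] by blast
  qed
qed

end

text \<open>
  The multiset condition on the orbits says that the largest is the sum of the two others.
\<close>

lemma remove_one_sum_iff:
  fixes i j k l :: nat
  assumes "l \<in> {i, j, k}"
  shows "(\<exists>s m. {#s, m#} = {#i, j, k#} - {#l#} \<and> s + m = l) \<longleftrightarrow> i + j + k = 2 * l"
proof -
  obtain a b where ab: "{#i, j, k#} = {#l, a, b#}"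
  proof -
    from assms consider "l = i" | "l = j" | "l = k" by blast
    then show ?thesis
    proof cases
      case 1 then show ?thesis using that[of j k] by simp
    next
      case 2 then show ?thesis using that[of i k] by (simp add: add_mset_commute)
    next
      case 3 then show ?thesis using that[of i j] by (simp add: add_mset_commute)
    qed
  qed
  have "sum_mset {#i, j, k#} = sum_mset {#l, a, b#}" using ab by simp
  then have s: "i + j + k = l + a + b" by simp
  have d: "{#i, j, k#} - {#l#} = {#a, b#}" unfolding ab by simp
  have "s + m = a + b" if "{#s, m#} = {#a, b#}" for s m
    using arg_cong[OF that, of sum_mset] by simp
  then have "(\<exists>s m. {#s, m#} = {#a, b#} \<and> s + m = l) \<longleftrightarrow> a + b = l" by metis
  also have "\<dots> \<longleftrightarrow> i + j + k = 2 * l" using s by linarith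
  finally show ?thesis unfolding d .
qed

theorem corollary8p25:
  fixes n i j k :: nat and p q r :: int
    and w :: "nat list" and \<xi> :: "nat \<Rightarrow> int" and \<alpha> \<beta> \<gamma> :: "nat \<Rightarrow> int"
  assumes "n \<ge> 3"
    and "orbit_transversal n w"
    and "height_function n w \<xi>"
    and "\<alpha> \<in> positive_roots n" and "\<beta> \<in> positive_roots n" and "\<gamma> \<in> positive_roots n"
    and "folded_coordinates n w \<xi> \<alpha> = (i, p)"
    and "folded_coordinates n w \<xi> \<beta> = (j, q)"
    and "folded_coordinates n w \<xi> \<gamma> = (k, r)"
    and "\<alpha> + \<beta> = \<gamma>"
  shows "minimal_pair n (twisted_word n w) \<alpha> \<beta> \<gamma> \<longleftrightarrow>
    (let l = Max {i, j, k} in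
       l \<le> n \<and>
       (\<exists>s m. {#s, m#} = {#i, j, k#} - {#l#} \<and> s + m = l) \<and>
       (l = k \<longrightarrow> (q - r, p - r) = (- int i, int j)) \<and>
       (l = i \<longrightarrow> (q - r, p - r) = (int i - (2 * int n + 2), int j)) \<and>
       (l = j \<longrightarrow> (q - r, p - r) = (- int i, 2 * int n + 2 - int j)))"
proof -
  interpret twisted_adapted n w \<xi> using assms by unfold_locales
  obtain x1 y1 where 1: "in_window x1 y1" "\<alpha> = root_of x1 y1" using positive_root_window assms(4) by blast
  obtain x2 y2 where 2: "in_window x2 y2" "\<beta> = root_of x2 y2" using positive_root_window assms(5) by blast
  obtain x3 y3 where 3: "in_window x3 y3" "\<gamma> = root_of x3 y3" using positive_root_window assms(6) by blast
  have sum: "root_of x1 y1 + root_of x2 y2 = root_of x3 y3" using assms(10) 1 2 3 by simp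
  have c1: "int i = y1 - x1" "p = \<xi> n + int n - (x1 + y1)"
    using folded_coordinates_root_of[OF 1(1)] assms(7) 1 window_range[OF 1(1)] by auto
  have c2: "int j = y2 - x2" "q = \<xi> n + int n - (x2 + y2)"
    using folded_coordinates_root_of[OF 2(1)] assms(8) 2 window_range[OF 2(1)] by auto
  have c3: "int k = y3 - x3" "r = \<xi> n + int n - (x3 + y3)"
    using folded_coordinates_root_of[OF 3(1)] assms(9) 3 window_range[OF 3(1)] by auto
  define l where "l = Max {i, j, k}"
  have l: "l \<in> {i, j, k}" "i \<le> l" "j \<le> l" "k \<le> l" unfolding l_def by (rule Max_in) auto
  have "i \<le> n" "j \<le> n" "k \<le> n"
    using c1(1) c2(1) c3(1) window_range[OF 1(1)] window_range[OF 2(1)] window_range[OF 3(1)] by linarith+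
  then have ln: "l \<le> n" using l(1) by auto
  have "minimal_pair n tw \<alpha> \<beta> \<gamma> \<longleftrightarrow> tight_triple x1 y1 x2 y2 x3 y3"
    unfolding 1(2) 2(2) 3(2) by (rule minimal_pair_iff_tight[OF 1(1) 2(1) 3(1) sum])
  also have "\<dots> \<longleftrightarrow> int i + int j + int k = 2 * int l \<and>
     (int l = int k \<longrightarrow> q - r = - int i \<and> p - r = int j) \<and>
     (int l = int i \<longrightarrow> q - r = int i - 2 * h \<and> p - r = int j) \<and>
     (int l = int j \<longrightarrow> q - r = - int i \<and> p - r = 2 * h - int j)"
    by (rule tight_triple_iff_coordinates[OF 1(1) 2(1) 3(1) sum]) (use c1 c2 c3 l in auto)
  also have "int i + int j + int k = 2 * int l \<longleftrightarrow>
      (\<exists>s m. {#s, m#} = {#i, j, k#} - {#l#} \<and> s + m = l)"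
    unfolding remove_one_sum_iff[OF l(1)] by linarith
  finally show ?thesis
    using ln unfolding l_def[symmetric] Let_def by (simp add: h_def algebra_simps)
qed

end
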